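(* Let $\Omega\subset\mathbb{R}^N$ be a domain of class $C^2$ with boundary $\Gamma$ and let $1<p\le\infty$. Let $x\in\Omega$ and $R>0$ be such that $B_R(x)\subset\Omega$ and $\overline{B_R(x)}\cap(\mathbb{R}^N\setminus\Omega)=\{y_x\}$ for a point $y_x\in\Gamma$; suppose that $\kappa_j(y_x)<\frac1R$ for every $j=1,\dots,N-1$. For $\varepsilon>0$ let $u^\varepsilon$ be the bounded viscosity solution of $u^\varepsilon-\varepsilon^2\Delta_p^Gu^\varepsilon=0$ in $\Omega$, $u^\varepsilon=1$ on $\Gamma$, and, for $1<q\le\infty$, let $\mu_{q,\varepsilon}(x)$ be the $q$-mean of $u^\varepsilon$ on $B_R(x)$. Then, if $1<q<\infty$, $$\lim_{\varepsilon\to0^+}\left(\frac{\varepsilon}{R}\right)^{-\frac{N+1}{2(q-1)}}\mu_{q,\varepsilon}(x)=\left\{\frac{2^{-\frac{N+1}{2}}N!}{(q-1)^{\frac{N+1}{2}}\,\Gamma\left(\frac{N+1}{2}\right)}\right\}^{\frac1{q-1}}\left\{(p')^{\frac{N+1}{2}}\,\Pi_\Gamma(y_x)\right\}^{-\frac1{2(q-1)}}.$$ If $q=\infty$, then $\lim_{\varepsilon\to0^+}\mu_{\infty,\varepsilon}(x)=\frac12$.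
   Context: $N\ge2$; a domain is a connected open set, not necessarily bounded, with nonempty boundary $\Gamma$. $p'=p/(p-1)$ for $1<p<\infty$ and $p'=1$ for $p=\infty$. $\kappa_1(y),\dots,\kappa_{N-1}(y)$ are the principal curvatures of $\Gamma$ at $y$ with respect to the interior normal direction to $\Gamma$ (positive for spheres bounding balls), and $\Pi_\Gamma(y)=\prod_{j=1}^{N-1}[1-R\,\kappa_j(y)]$. In the formula, $\Gamma\left(\frac{N+1}{2}\right)$ denotes Euler's gamma function. For $q\in[1,\infty]$, the $q$-mean of a continuous function $v$ on a ball $B$ is the unique $\mu\in\mathbb{R}$ with $\|v-\mu\|_{L^q(B)}\le\|v-\lambda\|_{L^q(B)}$ for all $\lambda\in\mathbb{R}$. Game-theoretic $p$-laplacian: $\Delta_p^Gu=\frac1p\Delta u+\left(1-\frac2p\right)\frac{\langle\nabla^2u\,\nabla u,\nabla u\rangle}{|\nabla u|^2}$ (with $1/p=0$ if $p=\infty$), i.e. $\Delta_p^Gu=-F(\nabla u,\nabla^2u)$ where, for $\xi\in\mathbb{R}^N\setminus\{0\}$ and $X$ a symmetric $N\times N$ matrix, $F(\xi,X)=-\mathrm{tr}[A(\xi)X]$, $A(\xi)=\frac1pI+\left(1-\frac2p\right)\frac{\xi\otimes\xi}{|\xi|^2}$. The semicontinuous envelopes are $F_*(\xi,X)=\lim_{\delta\to0^+}\inf\{F(\eta,Y):\eta\ne0,|\eta-\xi|<\delta,|Y-X|<\delta\}$ and $F^*=-(-F)_*$. Viscosity solutions of $u-\varepsilon^2\Delta_p^Gu=0$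 in $\Omega$: an upper semicontinuous $u$ is a subsolution if $u(x)+\varepsilon^2F_*(\nabla\phi(x),\nabla^2\phi(x))\le0$ whenever $\phi\in C^2(\Omega)$ and $u-\phi$ attains its maximum at $x$; a lower semicontinuous $v$ is a supersolution if $v(x)+\varepsilon^2F^*(\nabla\psi(x),\nabla^2\psi(x))\ge0$ whenever $\psi\in C^2(\Omega)$ and $v-\psi$ attains its minimum at $x$; a solution is both. Boundary values are attained continuously on $\Gamma$; the bounded viscosity solution of the problem is unique by comparison. *)

theory Defs
  imports "HOL-Analysis.Analysis" "HOL-Probability.Essential_Supremum"
begin

definition C2_on ::
  "(real^'n) set \<Rightarrow> (real^'n \<Rightarrow> real) \<Rightarrow> (real^'n \<Rightarrow> real^'n) \<Rightarrow> (real^'n \<Rightarrow> real^'n^'n) \<Rightarrow> bool" where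
  "C2_on S v Dv D2v \<longleftrightarrow>
     (\<forall>x\<in>S. GDERIV v x :> Dv x) \<and>
     (\<forall>x\<in>S. (Dv has_derivative (\<lambda>h. D2v x *v h)) (at x)) \<and>
     continuous_on S D2v"

text \<open>Near \<open>y\<close>, the set \<open>\<Omega>\<close> is the part lying above (in the direction of the unit vector \<open>\<nu>\<close>) the
  graph of a \<open>C\<^sup>2\<close> function \<open>f\<close> of the coordinates in the hyperplane orthogonal to \<open>\<nu>\<close>. A function
  on this hyperplane is encoded as a function on the whole space that is constant along \<open>\<nu>\<close>, so that
  \<open>f (z - y)\<close> is the value at the orthogonal projection of \<open>z - y\<close>.\<close>

definition C2_graph_at ::
  "(real^'n) set \<Rightarrow> real^'n \<Rightarrow> real^'n \<Rightarrow> (real^'n \<Rightarrow> real) \<Rightarrow> (real^'n \<Rightarrow> real^'n) \<Rightarrow>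
   (real^'n \<Rightarrow> real^'n^'n) \<Rightarrow> bool" where
  "C2_graph_at \<Omega> y \<nu> f Df D2f \<longleftrightarrow>
     norm \<nu> = 1 \<and> (\<forall>z t. f (z + t *\<^sub>R \<nu>) = f z) \<and>
     (\<exists>r>0. C2_on (ball 0 r) f Df D2f \<and>
            (\<forall>z\<in>ball y r. z \<in> \<Omega> \<longleftrightarrow> f (z - y) < (z - y) \<bullet> \<nu>))"

definition C2_domain :: "(real^'n) set \<Rightarrow> bool" where
  "C2_domain \<Omega> \<longleftrightarrow> open \<Omega> \<and> connected \<Omega> \<and> frontier \<Omega> \<noteq> {} \<and>
     (\<forall>y\<in>frontier \<Omega>. \<exists>\<nu> f Df D2f. C2_graph_at \<Omega> y \<nu> f Df D2f)"

text \<open>The condition \<open>Df 0 = 0\<close> makes \<open>\<nu>\<close> the interior unit normal at the boundary point \<open>y\<close>. The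
  principal curvatures are then the eigenvalues, repeated according to multiplicity, of the Hessian of
  \<open>f\<close> at \<open>0\<close> on the tangent hyperplane; \<open>e\<close> is an orthonormal basis of principal directions. A ball
  of radius \<open>\<rho>\<close> has all principal curvatures \<open>1 / \<rho>\<close>. The list \<open>\<kappa> 1, \<dots>, \<kappa> (N - 1)\<close> is determined
  up to order.\<close>

definition principal_curvatures :: "(real^'n) set \<Rightarrow> real^'n \<Rightarrow> (nat \<Rightarrow> real) \<Rightarrow> bool" where
  "principal_curvatures \<Omega> y \<kappa> \<longleftrightarrow>
     (\<exists>\<nu> f Df D2f e. C2_graph_at \<Omega> y \<nu> f Df D2f \<and> Df 0 = 0 \<and>
        (\<forall>i\<in>{1..CARD('n) - 1}. \<forall>j\<in>{1..CARD('n) - 1}. e i \<bullet> e j = (if i = j then 1 else 0)) \<and>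
        (\<forall>j\<in>{1..CARD('n) - 1}. e j \<bullet> \<nu> = 0 \<and> D2f 0 *v e j = \<kappa> j *\<^sub>R e j))"

definition Pi_curv :: "'n itself \<Rightarrow> real \<Rightarrow> (nat \<Rightarrow> real) \<Rightarrow> real" where
  "Pi_curv _ R \<kappa> = (\<Prod>j = 1..CARD('n) - 1. 1 - R * \<kappa> j)"

definition Lq_norm :: "ereal \<Rightarrow> (real^'n) set \<Rightarrow> (real^'n \<Rightarrow> real) \<Rightarrow> ennreal" where
  "Lq_norm q B v =
     (if q = \<infinity> then esssup (lebesgue_on B) (\<lambda>y. ennreal \<bar>v y\<bar>)
      else if set_integrable lebesgue B (\<lambda>y. \<bar>v y\<bar> powr real_of_ereal q)
      then ennreal ((LINT y:B|lebesgue. \<bar>v y\<bar> powr real_of_ereal q) powr (1 / real_of_ereal q))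
      else \<infinity>)"

definition q_mean :: "ereal \<Rightarrow> (real^'n) set \<Rightarrow> (real^'n \<Rightarrow> real) \<Rightarrow> real" where
  "q_mean q B v =
     (THE \<mu>. \<forall>c. Lq_norm q B (\<lambda>y. v y - \<mu>) \<le> Lq_norm q B (\<lambda>y. v y - c))"

definition inv_exponent :: "ereal \<Rightarrow> real" where
  "inv_exponent p = (if p = \<infinity> then 0 else 1 / real_of_ereal p)"

definition conj_exponent :: "ereal \<Rightarrow> real" where
  "conj_exponent p = (if p = \<infinity> then 1 else real_of_ereal p / (real_of_ereal p - 1))"

definition outer_prod :: "real^'n \<Rightarrow> real^'n \<Rightarrow> real^'n^'n" where
  "outer_prod a b = (\<chi> i j. a $ i * b $ j)"

definition A_mat :: "ereal \<Rightarrow> real^'n \<Rightarrow> real^'n^'n" where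
  "A_mat p \<xi> = inv_exponent p *\<^sub>R mat 1
     + ((1 - 2 * inv_exponent p) / (norm \<xi>)\<^sup>2) *\<^sub>R outer_prod \<xi> \<xi>"

text \<open>The game-theoretic \<open>p\<close>-laplacian of \<open>u\<close> is \<open>- F_op p (\<nabla>u) (\<nabla>\<^sup>2u)\<close>.\<close>

definition F_op :: "ereal \<Rightarrow> real^'n \<Rightarrow> real^'n^'n \<Rightarrow> real" where
  "F_op p \<xi> X = - trace (A_mat p \<xi> ** X)"

text \<open>The matrices \<open>Y\<close> range over symmetric matrices. The real-valued infimum and limit are the intended
  ones for every \<open>G\<close> that is locally bounded (which \<open>F_op p\<close> and its negative are, also near
  \<open>\<xi> = 0\<close>): then the infimum is finite, and bounded and monotone in \<open>\<delta>\<close>.\<close>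

definition lower_env ::
  "(real^'n \<Rightarrow> real^'n^'n \<Rightarrow> real) \<Rightarrow> real^'n \<Rightarrow> real^'n^'n \<Rightarrow> real" where
  "lower_env G \<xi> X = Lim (at_right 0)
     (\<lambda>\<delta>. Inf {G \<eta> Y | \<eta> Y. \<eta> \<noteq> 0 \<and> transpose Y = Y \<and> norm (\<eta> - \<xi>) < \<delta> \<and> norm (Y - X) < \<delta>})"

definition upper_env ::
  "(real^'n \<Rightarrow> real^'n^'n \<Rightarrow> real) \<Rightarrow> real^'n \<Rightarrow> real^'n^'n \<Rightarrow> real" where
  "upper_env G \<xi> X = - lower_env (\<lambda>\<eta> Y. - G \<eta> Y) \<xi> X"

definition usc_on :: "(real^'n) set \<Rightarrow> (real^'n \<Rightarrow> real) \<Rightarrow> bool" where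
  "usc_on S u \<longleftrightarrow> (\<forall>x\<in>S. \<forall>c>u x. \<forall>\<^sub>F y in at x within S. u y < c)"

definition lsc_on :: "(real^'n) set \<Rightarrow> (real^'n \<Rightarrow> real) \<Rightarrow> bool" where
  "lsc_on S u \<longleftrightarrow> (\<forall>x\<in>S. \<forall>c<u x. \<forall>\<^sub>F y in at x within S. c < u y)"

definition visc_subsolution ::
  "ereal \<Rightarrow> real \<Rightarrow> (real^'n) set \<Rightarrow> (real^'n \<Rightarrow> real) \<Rightarrow> bool" where
  "visc_subsolution p \<epsilon> \<Omega> u \<longleftrightarrow> usc_on \<Omega> u \<and>
     (\<forall>v Dv D2v x. C2_on \<Omega> v Dv D2v \<and> x \<in> \<Omega> \<and> (\<forall>y\<in>\<Omega>. u y - v y \<le> u x - v x)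
        \<longrightarrow> u x + \<epsilon>\<^sup>2 * lower_env (F_op p) (Dv x) (D2v x) \<le> 0)"

definition visc_supersolution ::
  "ereal \<Rightarrow> real \<Rightarrow> (real^'n) set \<Rightarrow> (real^'n \<Rightarrow> real) \<Rightarrow> bool" where
  "visc_supersolution p \<epsilon> \<Omega> u \<longleftrightarrow> lsc_on \<Omega> u \<and>
     (\<forall>v Dv D2v x. C2_on \<Omega> v Dv D2v \<and> x \<in> \<Omega> \<and> (\<forall>y\<in>\<Omega>. u x - v x \<le> u y - v y)
        \<longrightarrow> u x + \<epsilon>\<^sup>2 * upper_env (F_op p) (Dv x) (D2v x) \<ge> 0)"

definition visc_solution ::
  "ereal \<Rightarrow> real \<Rightarrow> (real^'n) set \<Rightarrow> (real^'n \<Rightarrow> real) \<Rightarrow> bool" where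
  "visc_solution p \<epsilon> \<Omega> u \<longleftrightarrow> visc_subsolution p \<epsilon> \<Omega> u \<and> visc_supersolution p \<epsilon> \<Omega> u"

definition bounded_visc_solution_bdry1 ::
  "ereal \<Rightarrow> real \<Rightarrow> (real^'n) set \<Rightarrow> (real^'n \<Rightarrow> real) \<Rightarrow> bool" where
  "bounded_visc_solution_bdry1 p \<epsilon> \<Omega> u \<longleftrightarrow>
     visc_solution p \<epsilon> \<Omega> u \<and> bounded (u ` \<Omega>) \<and>
     (\<forall>y\<in>frontier \<Omega>. u y = 1 \<and> (u \<longlongrightarrow> 1) (at y within \<Omega>))"

end

theory Submission
  imports Defs "HOL-Probability.Distributions" "HOL-Real_Asymp.Real_Asymp"
begin

text \<open>For small \<open>\<epsilon>\<close> the solution is a boundary layer. On a function of one variable in the direction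
of its own gradient the operator \<open>\<Delta>\<^sub>p\<^sup>G\<close> is the second derivative divided by \<open>p'\<close>, so to leading order
\<open>u\<^sup>\<epsilon>\<close> is \<open>exp (- \<surd>p' d / \<epsilon>)\<close>, where \<open>d\<close> is the distance to the boundary. Two facts
turn this into the asymptotics of the \<open>q\<close>-mean.

\<^bold>\<open>The layer near the contact point.\<close> Let \<open>g\<close> be the height above the graph that bounds \<open>\<Omega>\<close> near the
contact point \<open>y0\<close>. It suffices to know \<open>- \<epsilon> ln u\<^sup>\<epsilon>\<close> up to a factor \<open>1 \<plusminus> \<delta>\<close> on the part of
the ball near \<open>y0\<close>, and then explicit barriers are good enough: since \<open>\<bar>\<nabla>g\<bar>\<close> is close to
\<open>1\<close> near \<open>y0\<close>, the functions \<open>exp (- (1 \<mp> \<delta>) \<surd>p' (g \<mp> K \<bar>z - y0\<bar>\<^sup>2) / \<epsilon>)\<close> are a strict super- and a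
strict subsolution once \<open>\<epsilon>\<close> is small (\<open>local_barrier\<close>). The quadratic term makes the comparison work on
the lateral boundary of a small neighbourhood, at the price of an exponentially small constant, and
costs nothing inside the ball, because the condition \<open>\<kappa>\<^sub>j < 1 / R\<close> gives
\<open>g \<ge> const \<bar>z - y0\<bar>\<^sup>2\<close> there (\<open>height_lower\<close>). This is \<open>pointwise_estimate\<close>. Away from the boundary
a barrier on small balls shows that \<open>u\<^sup>\<epsilon>\<close> is exponentially small (\<open>interior_exponential_decay\<close>).

\<^bold>\<open>The balance that determines the mean.\<close> For \<open>1 < q < \<infinity>\<close> the \<open>q\<close>-mean is the zero of the decreasing
function that sends \<open>c\<close> to the integral of \<open>sgn (u - c) \<bar>u - c\<bar>\<^sup>q\<^sup>-\<^sup>1\<close> over the ball (\<open>q_mean_bounds\<close>).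
Take \<open>c = t \<epsilon>\<^sup>\<beta>\<close> with \<open>\<beta> = (N + 1) / (2 (q - 1))\<close>. Where \<open>u < c\<close>, which is almost the whole ball, the
integrand is \<open>- c\<^sup>q\<^sup>-\<^sup>1\<close> to leading order, so this part contributes
\<open>- t\<^sup>q\<^sup>-\<^sup>1 \<bar>B\<bar>\<close> times \<open>\<epsilon>\<close> to the power \<open>(N + 1) / 2\<close> (\<open>lower_part_limit\<close>). Where \<open>u > c\<close>, the integral lives at
normal distance \<open>\<epsilon>\<close> and tangential distance \<open>\<surd>\<epsilon>\<close> from \<open>y0\<close>. Zooming in at these scales has Jacobian
\<open>\<epsilon>\<close> to the power \<open>(N + 1) / 2\<close>, turns the ball into a paraboloid and turns \<open>u\<^sup>q\<^sup>-\<^sup>1\<close> into the exponential of a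
quadratic polynomial; in coordinates adapted to the paraboloid it is a product of Gaussians and one
exponential (\<open>upper_part_limit\<close>, \<open>paraboloid_integral\<close>). The two contributions cancel for exactly
one \<open>t\<close>, which is the limit of the rescaled mean; Legendre's duplication formula brings it to the stated
form. For \<open>q = \<infinity>\<close> the mean is the midpoint between the supremum, which is \<open>1\<close> because the ball touches the
boundary, and the infimum, which tends to \<open>0\<close>.\<close>

section \<open>The operator and its semicontinuous envelopes\<close>

lemma inner_matrix_vector_sum:
  fixes X :: "real^'n^'n"
  shows "\<xi> \<bullet> (X *v \<xi>) = (\<Sum>i\<in>UNIV. \<Sum>j\<in>UNIV. \<xi> $ i * X $ i $ j * \<xi> $ j)"
  by (simp add: inner_vec_def matrix_vector_mult_def sum_distrib_left mult.assoc)

lemma F_op_eq: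
  fixes X :: "real^'n^'n"
  shows "F_op p \<xi> X = - (inv_exponent p * trace X
           + (1 - 2 * inv_exponent p) * (\<xi> \<bullet> (X *v \<xi>)) / (norm \<xi>)\<^sup>2)"
proof -
  have 1: "trace (outer_prod \<xi> \<xi> ** X) = \<xi> \<bullet> (X *v \<xi>)"
  proof -
    have "trace (outer_prod \<xi> \<xi> ** X) = (\<Sum>i\<in>UNIV. \<Sum>k\<in>UNIV. \<xi> $ i * \<xi> $ k * X $ k $ i)"
      by (simp add: trace_def matrix_matrix_mult_def outer_prod_def)
    also have "\<dots> = (\<Sum>k\<in>UNIV. \<Sum>i\<in>UNIV. \<xi> $ i * \<xi> $ k * X $ k $ i)"
      by (rule sum.swap)
    finally show ?thesis
      by (simp add: inner_matrix_vector_sum algebra_simps)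
  qed
  have 2: "trace ((a *\<^sub>R A + b *\<^sub>R B) ** X) = a * trace (A ** X) + b * trace (B ** X)"
    for a b and A B :: "real^'n^'n"
    by (simp add: trace_def matrix_matrix_mult_def algebra_simps sum.distrib sum_distrib_left)
  show ?thesis
    by (simp add: F_op_def A_mat_def 1 2)
qed

lemma F_op_scaleR: "F_op p \<xi> (c *\<^sub>R X) = c * F_op p \<xi> X"
  by (simp add: F_op_eq trace_def scaleR_matrix_vector_assoc[symmetric] sum_distrib_left[symmetric] algebra_simps)

lemma F_op_add: "F_op p \<xi> (X + Y) = F_op p \<xi> X + F_op p \<xi> Y"
  by (simp add: F_op_eq trace_def matrix_vector_mult_add_rdistrib inner_add_right sum.distrib
      algebra_simps add_divide_distrib diff_divide_distrib)

lemma F_op_uminus: "F_op p (- \<xi>) (- X) = - F_op p \<xi> X"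
  using F_op_scaleR[of p \<xi> "-1" X] by (simp add: F_op_eq inner_matrix_vector_sum)

lemma F_op_scaleR_grad: "c \<noteq> 0 \<Longrightarrow> F_op p (c *\<^sub>R \<xi>) X = F_op p \<xi> X"
proof -
  assume c: "c \<noteq> 0"
  have "(c *\<^sub>R \<xi>) \<bullet> (X *v (c *\<^sub>R \<xi>)) = c\<^sup>2 * (\<xi> \<bullet> (X *v \<xi>))"
    by (simp add: matrix_vector_mult_scaleR power2_eq_square)
  thus ?thesis using c by (simp add: F_op_eq power_mult_distrib mult.left_commute[of _ "c\<^sup>2"])
qed

lemma norm_transpose_eq: "norm (transpose X) = norm (X :: real^'n^'n)"
proof -
  have "(norm (transpose X))\<^sup>2 = (norm X)\<^sup>2"
    unfolding power2_norm_eq_inner inner_vec_def transpose_def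
    by (simp, subst sum.swap, simp)
  thus ?thesis by simp
qed

lemma norm_matrix_vector_le:
  fixes X :: "real^'n^'n"
  shows "norm (X *v h) \<le> real CARD('n) * norm X * norm h"
proof -
  have "norm (X *v h) \<le> (\<Sum>i\<in>UNIV. \<bar>(X *v h) $ i\<bar>)" by (rule norm_le_l1_cart)
  also have "\<dots> \<le> (\<Sum>i\<in>(UNIV::'n set). norm X * norm h)"
  proof (rule sum_mono)
    fix i
    have "\<bar>(X *v h) $ i\<bar> = \<bar>X $ i \<bullet> h\<bar>"
      by (simp add: matrix_vector_mult_def inner_vec_def)
    also have "\<dots> \<le> norm (X $ i) * norm h" by (rule Cauchy_Schwarz_ineq2)
    also have "\<dots> \<le> norm X * norm h"
      by (intro mult_right_mono Finite_Cartesian_Product.norm_nth_le) auto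
    finally show "\<bar>(X *v h) $ i\<bar> \<le> norm X * norm h" .
  qed
  finally show ?thesis by simp
qed

lemma inner_matrix_le:
  fixes X :: "real^'n^'n"
  shows "\<bar>h \<bullet> (X *v h)\<bar> \<le> real CARD('n) * norm X * (norm h)\<^sup>2"
proof -
  have "\<bar>h \<bullet> (X *v h)\<bar> \<le> norm h * norm (X *v h)" by (rule Cauchy_Schwarz_ineq2)
  also have "\<dots> \<le> norm h * (real CARD('n) * norm X * norm h)"
    by (intro mult_left_mono norm_matrix_vector_le) auto
  finally show ?thesis by (simp add: power2_eq_square mult_ac)
qed

lemma abs_trace_le:
  fixes X :: "real^'n^'n"
  shows "\<bar>trace X\<bar> \<le> real CARD('n) * norm X"
proof -
  have "\<bar>trace X\<bar> \<le> (\<Sum>i\<in>(UNIV::'n set). \<bar>X $ i $ i\<bar>)"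
    unfolding trace_def by (rule sum_abs)
  also have "\<dots> \<le> (\<Sum>i\<in>(UNIV::'n set). norm X)"
    by (intro sum_mono) (metis component_le_norm_cart order_trans Finite_Cartesian_Product.norm_nth_le)
  finally show ?thesis by simp
qed

lemma inv_exponent_bounds:
  assumes "1 < p" shows "0 \<le> inv_exponent p" "inv_exponent p < 1"
    "(1 - inv_exponent p) * conj_exponent p = 1" "conj_exponent p > 0"
  using assms by (cases p; auto simp: inv_exponent_def conj_exponent_def field_simps)+

text \<open>The operator is linear in the matrix and bounded uniformly in the direction \<open>\<xi>\<close>. Near
\<open>\<xi> = 0\<close>, where it is discontinuous, this crude bound replaces continuity.\<close>

lemma F_op_bound:
  fixes X :: "real^'n^'n"
  assumes "1 < p"
  shows "\<bar>F_op p \<xi> X\<bar> \<le> 2 * real CARD('n) * norm X"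
proof -
  let ?i = "inv_exponent p"
  have i: "\<bar>?i\<bar> \<le> 1" "\<bar>1 - 2 * ?i\<bar> \<le> 1" using inv_exponent_bounds[OF assms] by auto
  have "\<bar>\<xi> \<bullet> (X *v \<xi>) / (norm \<xi>)\<^sup>2\<bar> \<le> real CARD('n) * norm X"
    using inner_matrix_le[of \<xi> X] by (cases "\<xi> = 0") (auto simp: abs_div field_simps)
  hence "\<bar>(1 - 2 * ?i) * (\<xi> \<bullet> (X *v \<xi>) / (norm \<xi>)\<^sup>2)\<bar> \<le> 1 * (real CARD('n) * norm X)"
    unfolding abs_mult by (intro mult_mono i) auto
  moreover have "\<bar>?i * trace X\<bar> \<le> 1 * (real CARD('n) * norm X)"
    unfolding abs_mult by (intro mult_mono i abs_trace_le) auto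
  ultimately show ?thesis unfolding F_op_eq times_divide_eq_right[symmetric] by linarith
qed

lemma F_op_continuous:
  fixes b :: "real^'n" and X :: "real^'n^'n"
  assumes "b \<noteq> 0" "e > 0"
  obtains \<delta> where "\<delta> > 0"
    "\<And>\<eta> Y. norm (\<eta> - b) < \<delta> \<Longrightarrow> norm (Y - X) < \<delta> \<Longrightarrow> F_op p b X - e \<le> F_op p \<eta> Y"
proof -
  have "((\<lambda>z. F_op p (fst z) (snd z)) \<longlongrightarrow> F_op p b X) (nhds (b, X))"
    unfolding F_op_eq inner_matrix_vector_sum trace_def
    using assms(1) by (auto intro!: tendsto_eq_intros filterlim_ident)
  hence "\<forall>\<^sub>F z in nhds (b, X). dist (F_op p (fst z) (snd z)) (F_op p b X) < e"
    using assms(2) by (rule tendstoD)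
  then obtain d where d: "d > 0"
    "\<And>z. dist z (b, X) < d \<Longrightarrow> dist (F_op p (fst z) (snd z)) (F_op p b X) < e"
    unfolding eventually_nhds_metric by auto
  show ?thesis
  proof (rule that[of "d/2"])
    fix \<eta> Y assume a: "norm (\<eta> - b) < d/2" "norm (Y - X) < d/2"
    have "dist (\<eta>, Y) (b, X) \<le> dist \<eta> b + dist Y X"
      by (simp add: dist_Pair_Pair sqrt_sum_squares_le_sum)
    hence "dist (\<eta>, Y) (b, X) < d" using a by (simp add: dist_norm)
    from d(2)[OF this] show "F_op p b X - e \<le> F_op p \<eta> Y" by (simp add: dist_real_def)
  qed (use d in auto)
qed

text \<open>The upper bound \<open>U\<close> makes the limit in the definition of the envelope exist: the infima increase as the
neighbourhood shrinks, so they converge to their supremum. Without it the limit would be an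
unspecified number.\<close>

lemma lower_env_ge:
  fixes G :: "real^'n \<Rightarrow> real^'n^'n \<Rightarrow> real"
  assumes X: "transpose X = X" and d0: "\<delta>0 > 0"
    and LU: "\<And>\<eta> Y. \<lbrakk>\<eta> \<noteq> 0; transpose Y = Y; norm (\<eta> - \<xi>) < \<delta>0; norm (Y - X) < \<delta>0\<rbrakk>
               \<Longrightarrow> L \<le> G \<eta> Y \<and> G \<eta> Y \<le> U"
  shows "L \<le> lower_env G \<xi> X"
proof -
  define S where "S \<delta> = {G \<eta> Y | \<eta> Y. \<eta> \<noteq> 0 \<and> transpose Y = Y \<and> norm (\<eta> - \<xi>) < \<delta> \<and> norm (Y - X) < \<delta>}" for \<delta>
  define f where "f \<delta> = Inf (S \<delta>)" for \<delta>
  have ne: "S \<delta> \<noteq> {}" if "\<delta> > 0" for \<delta>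
  proof -
    obtain i :: 'n where True by auto
    define w :: "real^'n" where "w = (\<delta>/2) *\<^sub>R axis i 1"
    have w: "norm w = \<delta>/2" using that by (simp add: w_def norm_axis_1)
    \<comment> \<open>The infimum of an empty set is unspecified; at \<open>\<xi> = 0\<close> the admissible set needs
      a nonzero vector near the origin.\<close>
    have "\<exists>\<eta>. \<eta> \<noteq> 0 \<and> norm (\<eta> - \<xi>) < \<delta>"
    proof (cases "\<xi> = 0")
      case True thus ?thesis using w that by (intro exI[of _ w]) auto
    qed (use that in auto)
    thus ?thesis using X that unfolding S_def by force
  qed
  have lo: "L \<le> z \<and> z \<le> U" if "z \<in> S \<delta>" "\<delta> \<le> \<delta>0" for z \<delta>
    using that LU unfolding S_def by force
  have bdd: "bdd_below (S \<delta>)" if "\<delta> \<le> \<delta>0" for \<delta> using lo that by (meson bdd_belowI)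
  have fL: "L \<le> f \<delta>" if "0 < \<delta>" "\<delta> \<le> \<delta>0" for \<delta>
    unfolding f_def using ne lo that by (intro cInf_greatest) auto
  have fU: "f \<delta> \<le> U" if "0 < \<delta>" "\<delta> \<le> \<delta>0" for \<delta>
  proof -
    have "S \<delta> \<noteq> {}" using ne that by auto
    then obtain z where "z \<in> S \<delta>" by blast
    hence "f \<delta> \<le> z" unfolding f_def by (intro cInf_lower bdd that)
    thus ?thesis using lo[OF \<open>z \<in> S \<delta>\<close>] that by auto
  qed
  have anti: "f b \<le> f a" if "0 < a" "a \<le> b" "b \<le> \<delta>0" for a b
    unfolding f_def
  proof (rule cInf_superset_mono)
    show "S a \<subseteq> S b" using that unfolding S_def by force
  qed (use ne bdd that in auto)
  define l where "l = Sup (f ` {0<..\<delta>0})"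
  have ba: "bdd_above (f ` {0<..\<delta>0})" using fU by (intro bdd_aboveI[of _ U]) auto
  have fl: "f \<delta> \<le> l" if "0 < \<delta>" "\<delta> \<le> \<delta>0" for \<delta>
    unfolding l_def using that by (intro cSup_upper ba) auto
  have "(f \<longlongrightarrow> l) (at_right 0)"
  proof (rule order_tendstoI)
    fix a assume "a < l"
    then obtain b where b: "0 < b" "b \<le> \<delta>0" "a < f b"
      unfolding l_def using d0 by (subst (asm) less_cSup_iff[OF _ ba]) auto
    have "\<forall>\<^sub>F x in at_right 0. x \<in> {0<..<b}" by (rule eventually_at_right_real) (use b in auto)
    thus "\<forall>\<^sub>F x in at_right 0. a < f x"
    proof eventually_elim
      case (elim x) thus ?case using anti[of x b] b by auto
    qed
  next
    fix a assume "a > l"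
    have "\<forall>\<^sub>F x in at_right 0. x \<in> {0<..<\<delta>0}" by (rule eventually_at_right_real) (use d0 in auto)
    thus "\<forall>\<^sub>F x in at_right 0. f x < a"
    proof eventually_elim
      case (elim x) thus ?case using fl[of x] \<open>a > l\<close> by auto
    qed
  qed
  hence "lower_env G \<xi> X = l"
    unfolding lower_env_def f_def S_def by (intro tendsto_Lim) auto
  moreover have "L \<le> l" using fL[of \<delta>0] fl[of \<delta>0] d0 by linarith
  ultimately show ?thesis by simp
qed

section \<open>Touching by twice differentiable functions\<close>

text \<open>Along a segment starting at \<open>x0\<close> the remainder has derivative \<open>o(t \<bar>h\<bar>\<^sup>2)\<close>, since the gradient is differentiable at \<open>x0\<close>.\<close>

lemma second_order_expansion:
  fixes W :: "real^'n \<Rightarrow> real"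
  assumes "open D" "x0 \<in> D" and gd: "\<And>y. y \<in> D \<Longrightarrow> GDERIV W y :> DW y"
    and d2: "(DW has_derivative (\<lambda>h. X *v h)) (at x0)" and "e > 0"
  shows "\<forall>\<^sub>F y in nhds x0. \<bar>W y - W x0 - DW x0 \<bullet> (y - x0) - (y - x0) \<bullet> (X *v (y - x0)) / 2\<bar>
           \<le> e * (norm (y - x0))\<^sup>2"
proof -
  obtain r1 where r1: "r1 > 0" "ball x0 r1 \<subseteq> D" using assms(1,2) by (meson openE)
  obtain r2 where r2: "r2 > 0" "\<And>y. norm (y - x0) < r2 \<Longrightarrow>
      norm (DW y - DW x0 - X *v (y - x0)) \<le> e * norm (y - x0)"
    using d2 \<open>e > 0\<close> unfolding has_derivative_at_alt by metis
  have "\<bar>W y - W x0 - DW x0 \<bullet> h - h \<bullet> (X *v h) / 2\<bar> \<le> e * (norm h)\<^sup>2"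
    if h: "h = y - x0" and y: "norm (y - x0) < min r1 r2" for y h
  proof -
    define \<phi> where "\<phi> t = W (x0 + t *\<^sub>R h) - t * (DW x0 \<bullet> h) - t\<^sup>2 / 2 * (h \<bullet> (X *v h))" for t
    define \<phi>' where "\<phi>' t = DW (x0 + t *\<^sub>R h) \<bullet> h - DW x0 \<bullet> h - t * (h \<bullet> (X *v h))" for t
    have nt: "norm (t *\<^sub>R h) \<le> norm h" if "0 \<le> t" "t \<le> 1" for t
      using that by (simp add: mult_left_le_one_le)
    have der: "(\<phi> has_real_derivative \<phi>' t) (at t)" if "0 \<le> t" "t \<le> 1" for t
    proof -
      have "x0 + t *\<^sub>R h \<in> D" using nt[OF that] y h r1(2) by (auto simp: dist_norm)
      from gd[OF this] have g: "(W has_derivative (\<lambda>k. k \<bullet> DW (x0 + t *\<^sub>R h))) (at (x0 + t *\<^sub>R h))"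
        by (simp add: gderiv_def)
      have l: "((\<lambda>t. x0 + t *\<^sub>R h) has_derivative (\<lambda>s. s *\<^sub>R h)) (at t)"
        by (auto intro!: derivative_eq_intros)
      have "((\<lambda>t. W (x0 + t *\<^sub>R h)) has_derivative (\<lambda>s. (s *\<^sub>R h) \<bullet> DW (x0 + t *\<^sub>R h))) (at t)"
        using has_derivative_compose[OF l g] .
      hence "((\<lambda>t. W (x0 + t *\<^sub>R h)) has_real_derivative DW (x0 + t *\<^sub>R h) \<bullet> h) (at t)"
        unfolding has_field_derivative_def by (simp add: inner_commute mult.commute[of _ "_ \<bullet> _"] mult_commute_abs)
      thus ?thesis unfolding \<phi>_def[abs_def] \<phi>'_def
        by (auto intro!: derivative_eq_intros)
    qed
    obtain t where t: "0 < t" "t < 1" "\<phi> 1 - \<phi> 0 = (1 - 0) * \<phi>' t"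
      using MVT2[of 0 1 \<phi> \<phi>'] der by auto
    have "\<phi>' t = (DW (x0 + t *\<^sub>R h) - DW x0 - X *v (t *\<^sub>R h)) \<bullet> h"
      unfolding \<phi>'_def by (simp add: inner_diff_left matrix_vector_mult_scaleR inner_commute[of h])
    also have "\<bar>\<dots>\<bar> \<le> norm (DW (x0 + t *\<^sub>R h) - DW x0 - X *v (t *\<^sub>R h)) * norm h"
      by (rule Cauchy_Schwarz_ineq2)
    also have "\<dots> \<le> (e * norm (t *\<^sub>R h)) * norm h"
    proof (intro mult_right_mono)
      have "norm (t *\<^sub>R h) < r2" using nt[of t] t y h by auto
      thus "norm (DW (x0 + t *\<^sub>R h) - DW x0 - X *v (t *\<^sub>R h)) \<le> e * norm (t *\<^sub>R h)"
        using r2(2)[of "x0 + t *\<^sub>R h"] by simp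
    qed auto
    also have "\<dots> \<le> (e * norm h) * norm h"
      using nt[of t] t \<open>e > 0\<close> by (intro mult_right_mono mult_left_mono) auto
    finally have "\<bar>\<phi>' t\<bar> \<le> e * (norm h)\<^sup>2" by (simp add: power2_eq_square mult.assoc)
    thus ?thesis using t(3) h by (simp add: \<phi>_def)
  qed
  thus ?thesis using r1 r2 unfolding eventually_nhds_metric dist_norm
    by (intro exI[of _ "min r1 r2"]) auto
qed

lemma outer_prod_mult: "outer_prod a b *v k = (b \<bullet> k) *\<^sub>R a"
  by (simp add: vec_eq_iff outer_prod_def matrix_vector_mult_def inner_vec_def sum_distrib_left mult_ac)

lemma has_derivative_matrix_vector [derivative_intros]:
  "(f has_derivative f') F \<Longrightarrow> ((\<lambda>x. X *v f x) has_derivative (\<lambda>k. (X :: real^'n^'m) *v f' k)) F"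
  by (rule bounded_linear.has_derivative[OF matrix_vector_mul_bounded_linear])

text \<open>Test functions have to be smooth and to touch from above on all of \<open>\<Omega>\<close>. A quadratic polynomial plus a
large multiple of \<open>\<bar>y - a\<bar>\<^sup>4\<close> is both, for every bounded \<open>u\<close> that it touches locally, and the quartic term
changes neither gradient nor Hessian at \<open>a\<close>. This takes the place of a cutoff function.\<close>

lemma quartic_test_function:
  fixes X :: "real^'n^'n"
  assumes X: "transpose X = X"
  shows "C2_on S (\<lambda>y. b \<bullet> (y - a) + (y - a) \<bullet> (X *v (y - a)) / 2 + M * ((y - a) \<bullet> (y - a))\<^sup>2)
     (\<lambda>y. b + X *v (y - a) + (4 * M * ((y - a) \<bullet> (y - a))) *\<^sub>R (y - a))
     (\<lambda>y. X + (4 * M * ((y - a) \<bullet> (y - a))) *\<^sub>R mat 1 + (8 * M) *\<^sub>R outer_prod (y - a) (y - a))"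
proof -
  have sym: "h \<bullet> (X *v k) = k \<bullet> (X *v h)" for h k
    by (metis X dot_lmul_matrix inner_commute transpose_matrix_vector)
  have m1: "mat 1 *v k = k" for k :: "real^'n" by simp
  show ?thesis unfolding C2_on_def gderiv_def
  proof (intro conjI ballI)
    fix y
    define w where "w = y - a"
    have w: "y - a = w" by (simp add: w_def)
    have d1: "((\<lambda>y. y - a) has_derivative (\<lambda>h. h)) (at y)"
      by (auto intro!: derivative_eq_intros)
    have dq: "((\<lambda>y. (y - a) \<bullet> (y - a)) has_derivative (\<lambda>h. w \<bullet> h + h \<bullet> w)) (at y)"
      using has_derivative_inner[OF d1 d1] by (simp only: w)
    have dX: "((\<lambda>y. (y - a) \<bullet> (X *v (y - a))) has_derivative (\<lambda>h. w \<bullet> (X *v h) + h \<bullet> (X *v w))) (at y)"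
      using has_derivative_inner[OF d1 has_derivative_matrix_vector[OF d1, of X]] by (simp only: w)
    have dqq: "((\<lambda>y. ((y - a) \<bullet> (y - a)) * ((y - a) \<bullet> (y - a))) has_derivative
        (\<lambda>h. (w \<bullet> w) * (w \<bullet> h + h \<bullet> w) + (w \<bullet> h + h \<bullet> w) * (w \<bullet> w))) (at y)"
      using has_derivative_mult[OF dq dq] by (simp only: w)
    have D: "((\<lambda>y. b \<bullet> (y - a) + (1/2) * ((y - a) \<bullet> (X *v (y - a)))
          + M * (((y - a) \<bullet> (y - a)) * ((y - a) \<bullet> (y - a)))) has_derivative
        (\<lambda>h. b \<bullet> h + (1/2) * (w \<bullet> (X *v h) + h \<bullet> (X *v w))
          + M * ((w \<bullet> w) * (w \<bullet> h + h \<bullet> w) + (w \<bullet> h + h \<bullet> w) * (w \<bullet> w)))) (at y)"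
      by (intro has_derivative_add has_derivative_inner_right has_derivative_mult_right d1 dX dqq)
    have eq: "(\<lambda>y. b \<bullet> (y - a) + (y - a) \<bullet> (X *v (y - a)) / 2 + M * ((y - a) \<bullet> (y - a))\<^sup>2)
      = (\<lambda>y. b \<bullet> (y - a) + (1/2) * ((y - a) \<bullet> (X *v (y - a)))
          + M * (((y - a) \<bullet> (y - a)) * ((y - a) \<bullet> (y - a))))"
      by (simp add: power2_eq_square)
    show "((\<lambda>y. b \<bullet> (y - a) + (y - a) \<bullet> (X *v (y - a)) / 2 + M * ((y - a) \<bullet> (y - a))\<^sup>2) has_derivative
          (\<lambda>h. h \<bullet> (b + X *v (y - a) + (4 * M * ((y - a) \<bullet> (y - a))) *\<^sub>R (y - a)))) (at y)"
      unfolding eq w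
    proof (rule has_derivative_eq_rhs[OF D], rule ext)
      fix h
      show "b \<bullet> h + (1/2) * (w \<bullet> (X *v h) + h \<bullet> (X *v w))
          + M * ((w \<bullet> w) * (w \<bullet> h + h \<bullet> w) + (w \<bullet> h + h \<bullet> w) * (w \<bullet> w))
        = h \<bullet> (b + X *v w + (4 * M * (w \<bullet> w)) *\<^sub>R w)"
        unfolding sym[of w h] inner_commute[of w h] inner_commute[of b h] inner_add_right inner_scaleR_right
        by algebra
    qed
    have D2: "((\<lambda>y. b + X *v (y - a) + (4 * M * ((y - a) \<bullet> (y - a))) *\<^sub>R (y - a)) has_derivative
        (\<lambda>h. 0 + X *v h + ((4 * M * (w \<bullet> w)) *\<^sub>R h + (4 * M * (w \<bullet> h + h \<bullet> w)) *\<^sub>R w))) (at y)"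
      using has_derivative_add[OF has_derivative_add[OF has_derivative_const[of b] has_derivative_matrix_vector[OF d1, of X]]
          has_derivative_scaleR[OF has_derivative_mult_right[OF dq, of "4 * M"] d1]] by (simp only: w)
    show "((\<lambda>y. b + X *v (y - a) + (4 * M * ((y - a) \<bullet> (y - a))) *\<^sub>R (y - a)) has_derivative
          (*v) (X + (4 * M * ((y - a) \<bullet> (y - a))) *\<^sub>R mat 1 + (8 * M) *\<^sub>R outer_prod (y - a) (y - a))) (at y)"
      unfolding w
    proof (rule has_derivative_eq_rhs[OF D2], rule ext)
      fix h
      show "0 + X *v h + ((4 * M * (w \<bullet> w)) *\<^sub>R h + (4 * M * (w \<bullet> h + h \<bullet> w)) *\<^sub>R w)
        = (X + (4 * M * (w \<bullet> w)) *\<^sub>R mat 1 + (8 * M) *\<^sub>R outer_prod w w) *v h"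
        by (simp add: matrix_vector_mult_add_rdistrib outer_prod_mult m1
            scaleR_matrix_vector_assoc[symmetric] inner_commute[of h w])
    qed
  next
    show "continuous_on S (\<lambda>y. X + (4 * M * ((y - a) \<bullet> (y - a))) *\<^sub>R mat 1 + (8 * M) *\<^sub>R outer_prod (y - a) (y - a))"
      unfolding outer_prod_def
      by (intro continuous_intros continuous_on_vec_lambda)
  qed
qed

text \<open>A bounded subsolution satisfies the differential inequality at every point where it is touched from above to
second order, even if only locally. The inequality is expressed by a lower bound \<open>L\<close> for the operator in
a neighbourhood, which is what the lower envelope remembers.\<close>

lemma visc_subsolution_touch:
  fixes u :: "real^'n \<Rightarrow> real" and X :: "real^'n^'n"
  assumes p: "1 < p" and sub: "visc_subsolution p \<epsilon> \<Omega> u" and bdd: "bounded (u ` \<Omega>)" and x0: "x0 \<in> \<Omega>"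
    and X: "transpose X = X"
    and touch: "\<And>e. e > 0 \<Longrightarrow> \<exists>s>0. \<forall>y\<in>\<Omega>. norm (y - x0) < s \<longrightarrow>
        u y \<le> u x0 + b \<bullet> (y - x0) + (y - x0) \<bullet> (X *v (y - x0)) / 2 + e * (norm (y - x0))\<^sup>2"
    and \<delta>: "\<delta> > 0" and L: "\<And>\<eta> Y. norm (\<eta> - b) < \<delta> \<Longrightarrow> norm (Y - X) < \<delta> \<Longrightarrow> L \<le> F_op p \<eta> Y"
  shows "u x0 + \<epsilon>\<^sup>2 * L \<le> 0"
proof -
  define m where "m = norm (mat 1 :: real^'n^'n)"
  define e where "e = \<delta> / (4 * (m + 1))"
  have m: "m \<ge> 0" by (simp add: m_def)
  have e: "e > 0" and em: "2 * e * m < \<delta> / 2"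
    using \<delta> m by (auto simp: e_def field_simps)
  \<comment> \<open>The error \<open>e \<bar>y - x0\<bar>\<^sup>2\<close> is absorbed into the Hessian, which moves it by less than \<open>\<delta> / 2\<close>.\<close>
  define X' where "X' = X + (2 * e) *\<^sub>R mat 1"
  have X'sym: "transpose X' = X'"
    using X by (simp add: X'_def transpose_def vec_eq_iff mat_def)
  have X'X: "norm (X' - X) < \<delta> / 2" using em e by (simp add: X'_def m_def)
  have qX': "h \<bullet> (X' *v h) / 2 = h \<bullet> (X *v h) / 2 + e * (norm h)\<^sup>2" for h
    by (simp add: X'_def matrix_vector_mult_add_rdistrib scaleR_matrix_vector_assoc[symmetric]
        inner_add_right power2_norm_eq_inner add_divide_distrib)
  obtain s where s: "s > 0" "\<And>y. y \<in> \<Omega> \<Longrightarrow> norm (y - x0) < s \<Longrightarrow>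
      u y \<le> u x0 + b \<bullet> (y - x0) + (y - x0) \<bullet> (X *v (y - x0)) / 2 + e * (norm (y - x0))\<^sup>2"
    using touch[OF e] by auto
  obtain U0 where U0: "\<And>y. y \<in> \<Omega> \<Longrightarrow> \<bar>u y\<bar> \<le> U0"
    using bdd by (auto simp: bounded_iff)
  have U0': "U0 \<ge> 0" using U0[OF x0] by linarith
  define C where "C = real CARD('n) * norm X'"
  have C: "C \<ge> 0" by (simp add: C_def)
  \<comment> \<open>Each of the three terms compensates, at distance at least \<open>s\<close>, one of the linear term, the
    quadratic term and the oscillation of \<open>u\<close>.\<close>
  define M where "M = norm b / s ^ 3 + C / s\<^sup>2 + 2 * U0 / s ^ 4"
  have M: "M \<ge> 0" using s(1) C U0' by (simp add: M_def)
  define v where "v y = b \<bullet> (y - x0) + (y - x0) \<bullet> (X' *v (y - x0)) / 2 + M * ((y - x0) \<bullet> (y - x0))\<^sup>2" for y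
  have far: "2 * U0 \<le> v y" if "s \<le> norm (y - x0)" for y
  proof -
    define h n where "h = y - x0" and "n = norm h"
    have n: "s \<le> n" "n > 0" using that s(1) by (auto simp: n_def h_def)
    have h4: "(h \<bullet> h)\<^sup>2 = n ^ 4"
      by (simp add: n_def power2_norm_eq_inner[symmetric])
    have "norm b * n \<le> norm b / s ^ 3 * n ^ 4"
    proof -
      have "s ^ 3 \<le> n ^ 3" using n s by (intro power_mono) auto
      hence "norm b * n * s ^ 3 \<le> norm b * n * n ^ 3" using n by (intro mult_left_mono) auto
      thus ?thesis using s(1) by (simp add: field_simps power4_eq_xxxx power3_eq_cube)
    qed
    moreover have "C * n\<^sup>2 \<le> C / s\<^sup>2 * n ^ 4"
    proof -
      have "s\<^sup>2 \<le> n\<^sup>2" using n s by (intro power_mono) auto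
      hence "C * n\<^sup>2 * s\<^sup>2 \<le> C * n\<^sup>2 * n\<^sup>2" using n C by (intro mult_left_mono) auto
      thus ?thesis using s(1) by (simp add: field_simps power4_eq_xxxx power2_eq_square)
    qed
    moreover have "2 * U0 \<le> 2 * U0 / s ^ 4 * n ^ 4"
    proof -
      have "s ^ 4 \<le> n ^ 4" using n s by (intro power_mono) auto
      hence "2 * U0 * s ^ 4 \<le> 2 * U0 * n ^ 4" using U0' by (intro mult_left_mono) auto
      thus ?thesis using s(1) by (simp add: field_simps)
    qed
    moreover have "\<bar>b \<bullet> h\<bar> \<le> norm b * n" unfolding n_def by (rule Cauchy_Schwarz_ineq2)
    moreover have "\<bar>h \<bullet> (X' *v h)\<bar> \<le> C * n\<^sup>2" unfolding n_def C_def by (rule inner_matrix_le)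
    moreover have "C * n\<^sup>2 \<ge> 0" using C by simp
    moreover have "M * n ^ 4 = norm b / s ^ 3 * n ^ 4 + C / s\<^sup>2 * n ^ 4 + 2 * U0 / s ^ 4 * n ^ 4"
      by (simp add: M_def algebra_simps)
    ultimately show ?thesis unfolding v_def h_def[symmetric] h4 by linarith
  qed
  have vx0: "v x0 = 0" by (simp add: v_def)
  have max: "u y - v y \<le> u x0 - v x0" if y: "y \<in> \<Omega>" for y
  proof (cases "norm (y - x0) < s")
    case True
    have "0 \<le> M * ((y - x0) \<bullet> (y - x0))\<^sup>2" using M by simp
    thus ?thesis using s(2)[OF y True] vx0 v_def[of y] qX'[of "y - x0"] by linarith
  next
    case False
    hence "2 * U0 \<le> v y" by (intro far) auto
    thus ?thesis using U0[OF y] U0[OF x0] unfolding vx0 by linarith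
  qed
  have "C2_on \<Omega> v
     (\<lambda>y. b + X' *v (y - x0) + (4 * M * ((y - x0) \<bullet> (y - x0))) *\<^sub>R (y - x0))
     (\<lambda>y. X' + (4 * M * ((y - x0) \<bullet> (y - x0))) *\<^sub>R mat 1 + (8 * M) *\<^sub>R outer_prod (y - x0) (y - x0))"
    unfolding v_def[abs_def] by (rule quartic_test_function[OF X'sym])
  from sub[unfolded visc_subsolution_def, THEN conjunct2, rule_format, OF conjI[OF this conjI[OF x0]]] max
  have "u x0 + \<epsilon>\<^sup>2 * lower_env (F_op p) (b + X' *v (x0 - x0) + (4 * M * ((x0 - x0) \<bullet> (x0 - x0))) *\<^sub>R (x0 - x0))
     (X' + (4 * M * ((x0 - x0) \<bullet> (x0 - x0))) *\<^sub>R mat 1 + (8 * M) *\<^sub>R outer_prod (x0 - x0) (x0 - x0)) \<le> 0"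
    by blast
  moreover have "outer_prod 0 0 = (0 :: real^'n^'n)" by (simp add: outer_prod_def vec_eq_iff)
  ultimately have 1: "u x0 + \<epsilon>\<^sup>2 * lower_env (F_op p) b X' \<le> 0" by simp
  have "L \<le> lower_env (F_op p) b X'"
  proof (rule lower_env_ge[OF X'sym, of "\<delta>/2"])
    fix \<eta> Y assume a: "norm (\<eta> - b) < \<delta> / 2" "norm (Y - X') < \<delta> / 2"
    have "norm (Y - X) \<le> norm (Y - X') + norm (X' - X)" using norm_triangle_ineq[of "Y - X'" "X' - X"] by simp
    hence YX: "norm (Y - X) < \<delta>" using a X'X by linarith
    have "norm Y \<le> norm X' + \<delta>" using a(2) \<delta> norm_triangle_sub[of Y X'] by linarith
    hence "2 * real CARD('n) * norm Y \<le> 2 * real CARD('n) * (norm X' + \<delta>)"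
      by (intro mult_left_mono) auto
    moreover have "\<bar>F_op p \<eta> Y\<bar> \<le> 2 * real CARD('n) * norm Y" by (rule F_op_bound[OF p])
    ultimately show "L \<le> F_op p \<eta> Y \<and> F_op p \<eta> Y \<le> 2 * real CARD('n) * (norm X' + \<delta>)"
      using L[OF _ YX, of \<eta>] a \<delta> by linarith
  qed (use \<delta> in auto)
  hence "\<epsilon>\<^sup>2 * L \<le> \<epsilon>\<^sup>2 * lower_env (F_op p) b X'" by (intro mult_left_mono) auto
  thus ?thesis using 1 by linarith
qed

text \<open>The two ways in which viscosity is used. Where the gradient of the touching function vanishes, the envelope is
controlled only by the norm of the Hessian; elsewhere the operator is continuous and
the classical inequality holds.\<close>

lemma visc_subsolution_max:
  fixes u W :: "real^'n \<Rightarrow> real" and X :: "real^'n^'n"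
  assumes p: "1 < p" and sub: "visc_subsolution p \<epsilon> \<Omega> u" and bdd: "bounded (u ` \<Omega>)"
    and D: "open D" "D \<subseteq> \<Omega>" "x0 \<in> D"
    and gd: "\<And>y. y \<in> D \<Longrightarrow> GDERIV W y :> DW y"
    and d2: "(DW has_derivative (\<lambda>h. X *v h)) (at x0)"
    and mx: "\<And>y. y \<in> D \<Longrightarrow> u y - W y \<le> u x0 - W x0"
  shows "u x0 \<le> \<epsilon>\<^sup>2 * (2 * real CARD('n) * norm X)"
    and "DW x0 \<noteq> 0 \<Longrightarrow> u x0 + \<epsilon>\<^sup>2 * F_op p (DW x0) X \<le> 0"
proof -
  \<comment> \<open>Admissible Hessians are symmetric; symmetrizing changes neither the trace nor the quadratic form.\<close>
  define Y where "Y = (1/2) *\<^sub>R (X + transpose X)"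
  have Y: "transpose Y = Y"
    by (simp add: Y_def transpose_def vec_eq_iff add.commute)
  have "h \<bullet> (h v* X) = h \<bullet> (X *v h)" for h
    using dot_lmul_matrix[of h X h] inner_commute[of h "h v* X"] by simp
  hence qY: "h \<bullet> (Y *v h) = h \<bullet> (X *v h)" for h
    by (simp add: Y_def scaleR_matrix_vector_assoc[symmetric] matrix_vector_mult_add_rdistrib
        inner_add_right)
  have trY: "trace Y = trace X"
    by (simp add: Y_def trace_def transpose_def)
  have FY: "F_op p \<xi> Y = F_op p \<xi> X" for \<xi>
    by (simp add: F_op_eq qY trY)
  have nY: "norm Y \<le> norm X"
    using norm_triangle_ineq[of X "transpose X"] by (simp add: Y_def norm_transpose_eq)
  have touch: "\<exists>s>0. \<forall>y\<in>\<Omega>. norm (y - x0) < s \<longrightarrow>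
        u y \<le> u x0 + DW x0 \<bullet> (y - x0) + (y - x0) \<bullet> (Y *v (y - x0)) / 2 + e * (norm (y - x0))\<^sup>2"
    if "e > 0" for e
  proof -
    have "\<forall>\<^sub>F y in nhds x0. y \<in> D \<and> \<bar>W y - W x0 - DW x0 \<bullet> (y - x0) - (y - x0) \<bullet> (X *v (y - x0)) / 2\<bar>
           \<le> e * (norm (y - x0))\<^sup>2"
      by (intro eventually_conj second_order_expansion[OF D(1,3) gd d2 that] eventually_nhds_in_open D)
    then obtain s where "s > 0" and s: "\<And>y. norm (y - x0) < s \<Longrightarrow> y \<in> D \<and>
        \<bar>W y - W x0 - DW x0 \<bullet> (y - x0) - (y - x0) \<bullet> (X *v (y - x0)) / 2\<bar> \<le> e * (norm (y - x0))\<^sup>2"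
      unfolding eventually_nhds_metric dist_norm by auto
    thus ?thesis
    proof (intro exI[of _ s] conjI ballI impI)
      fix y assume "norm (y - x0) < s"
      from s[OF this] mx[of y]
      show "u y \<le> u x0 + DW x0 \<bullet> (y - x0) + (y - x0) \<bullet> (Y *v (y - x0)) / 2 + e * (norm (y - x0))\<^sup>2"
        unfolding qY by linarith
    qed
  qed
  have x0: "x0 \<in> \<Omega>" using D by auto
  note T = visc_subsolution_touch[OF p sub bdd x0 Y touch]
  show "u x0 \<le> \<epsilon>\<^sup>2 * (2 * real CARD('n) * norm X)"
  proof (rule field_le_epsilon)
    fix e :: real assume e: "e > 0"
    define d where "d = e / (\<epsilon>\<^sup>2 * (2 * real CARD('n)) + 1)"
    have d: "d > 0" using e by (simp add: d_def add_nonneg_pos)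
    have "u x0 + \<epsilon>\<^sup>2 * (- (2 * real CARD('n) * (norm X + d))) \<le> 0"
    proof (rule T[OF _ d])
      fix \<eta> Z assume "norm (Z - Y) < d"
      hence "norm Z \<le> norm X + d" using norm_triangle_sub[of Z Y] nY by linarith
      hence "2 * real CARD('n) * norm Z \<le> 2 * real CARD('n) * (norm X + d)"
        by (intro mult_left_mono) auto
      thus "- (2 * real CARD('n) * (norm X + d)) \<le> F_op p \<eta> Z"
        using F_op_bound[OF p, of \<eta> Z] by linarith
    qed auto
    moreover have "\<epsilon>\<^sup>2 * (2 * real CARD('n) * d) \<le> e"
    proof -
      have "(\<epsilon>\<^sup>2 * (2 * real CARD('n)) + 1) * d = e"
        unfolding d_def by (simp add: add_nonneg_eq_0_iff)
      thus ?thesis using d by (simp add: algebra_simps)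
    qed
    ultimately show "u x0 \<le> \<epsilon>\<^sup>2 * (2 * real CARD('n) * norm X) + e"
      by (simp add: algebra_simps)
  qed
  assume nz: "DW x0 \<noteq> 0"
  have "u x0 + \<epsilon>\<^sup>2 * F_op p (DW x0) X \<le> e" if e: "e > 0" for e
  proof -
    define d where "d = e / (\<epsilon>\<^sup>2 + 1)"
    have d: "d > 0" using e by (simp add: d_def add_nonneg_pos)
    obtain \<delta> where "\<delta> > 0" "\<And>\<eta> Z. norm (\<eta> - DW x0) < \<delta> \<Longrightarrow> norm (Z - Y) < \<delta> \<Longrightarrow>
        F_op p (DW x0) Y - d \<le> F_op p \<eta> Z"
      using F_op_continuous[OF nz d] by metis
    from T[OF _ this] have "u x0 + \<epsilon>\<^sup>2 * (F_op p (DW x0) X - d) \<le> 0" by (simp add: FY)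
    moreover have "\<epsilon>\<^sup>2 * d \<le> e"
    proof -
      have "(\<epsilon>\<^sup>2 + 1) * d = e" unfolding d_def by (simp add: add_nonneg_eq_0_iff)
      thus ?thesis using d by (simp add: algebra_simps)
    qed
    ultimately show ?thesis by (simp add: algebra_simps)
  qed
  thus "u x0 + \<epsilon>\<^sup>2 * F_op p (DW x0) X \<le> 0"
    using field_le_epsilon[of "u x0 + \<epsilon>\<^sup>2 * F_op p (DW x0) X" 0] by simp
qed

text \<open>The operator is odd in the pair of gradient and Hessian, so the theory of subsolutions covers
supersolutions as well.\<close>

lemma visc_supersolution_uminus:
  fixes u :: "real^'n \<Rightarrow> real"
  assumes "visc_supersolution p \<epsilon> \<Omega> u"
  shows "visc_subsolution p \<epsilon> \<Omega> (\<lambda>y. - u y)"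
  unfolding visc_subsolution_def
proof (intro conjI allI impI)
  show "usc_on \<Omega> (\<lambda>y. - u y)"
    unfolding usc_on_def
  proof (intro ballI allI impI)
    fix z c assume "z \<in> \<Omega>" "- u z < c"
    hence "\<forall>\<^sub>F y in at z within \<Omega>. - c < u y"
      using assms unfolding visc_supersolution_def lsc_on_def by auto
    thus "\<forall>\<^sub>F y in at z within \<Omega>. - u y < c" by eventually_elim auto
  qed
  fix v Dv D2v x
  assume a: "C2_on \<Omega> v Dv D2v \<and> x \<in> \<Omega> \<and> (\<forall>y\<in>\<Omega>. - u y - v y \<le> - u x - v x)"
  have "C2_on \<Omega> (\<lambda>y. - v y) (\<lambda>y. - Dv y) (\<lambda>y. - D2v y)"
    using a unfolding C2_on_def
    by (auto intro!: GDERIV_minus continuous_intros derivative_eq_intros simp: fun_eq_iff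
        vec_eq_iff matrix_vector_mult_def sum_negf)
  moreover have "\<forall>y\<in>\<Omega>. u x - - v x \<le> u y - - v y" using a by fastforce
  ultimately have "u x + \<epsilon>\<^sup>2 * upper_env (F_op p) (- Dv x) (- D2v x) \<ge> 0"
    using assms a unfolding visc_supersolution_def by blast
  moreover have "upper_env (F_op p) (- Dv x) (- D2v x) = - lower_env (F_op p) (Dv x) (D2v x)"
  proof -
    have "{- F_op p \<eta> Y |\<eta> Y. \<eta> \<noteq> 0 \<and> transpose Y = Y \<and> norm (\<eta> - - Dv x) < \<delta> \<and> norm (Y - - D2v x) < \<delta>}
        = {F_op p \<eta> Y |\<eta> Y. \<eta> \<noteq> 0 \<and> transpose Y = Y \<and> norm (\<eta> - Dv x) < \<delta> \<and> norm (Y - D2v x) < \<delta>}"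
      (is "?A = ?B") for \<delta>
    proof -
      have t: "transpose (- Y) = - Y \<longleftrightarrow> transpose Y = Y" for Y :: "real^'n^'n"
        by (simp add: transpose_def vec_eq_iff)
      have n: "norm (- a - b) = norm (a + b)" for a b :: "'a::real_normed_vector"
        using norm_minus_cancel[of "a + b"] by (simp add: algebra_simps)
      show ?thesis
      proof (intro equalityI subsetI)
        fix z assume "z \<in> ?A"
        then obtain \<eta> Y where "z = - F_op p \<eta> Y" "\<eta> \<noteq> 0" "transpose Y = Y" "norm (\<eta> - - Dv x) < \<delta>" "norm (Y - - D2v x) < \<delta>"
          by blast
        thus "z \<in> ?B"
          by (intro CollectI exI[of _ "-\<eta>"] exI[of _ "-Y"]) (simp add: F_op_uminus t n)
      next
        fix z assume "z \<in> ?B"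
        then obtain \<eta> Y where "z = F_op p \<eta> Y" "\<eta> \<noteq> 0" "transpose Y = Y" "norm (\<eta> - Dv x) < \<delta>" "norm (Y - D2v x) < \<delta>"
          by blast
        thus "z \<in> ?A"
          by (intro CollectI exI[of _ "-\<eta>"] exI[of _ "-Y"])
             (simp add: F_op_uminus t norm_minus_commute)
      qed
    qed
    thus ?thesis unfolding upper_env_def lower_env_def by simp
  qed
  ultimately show "- u x + \<epsilon>\<^sup>2 * lower_env (F_op p) (Dv x) (D2v x) \<le> 0" by simp
qed

section \<open>Maximum principle and comparison with barriers\<close>

lemma usc_lsc_imp_continuous_on:
  assumes "usc_on S u" "lsc_on S u" shows "continuous_on S u"
  unfolding continuous_on_def
proof (intro ballI order_tendstoI)
  fix x c assume "x \<in> S" "c < u x" thus "\<forall>\<^sub>F y in at x within S. c < u y"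
    using assms(2) by (auto simp: lsc_on_def)
next
  fix x c assume "x \<in> S" "u x < c" thus "\<forall>\<^sub>F y in at x within S. u y < c"
    using assms(1) by (auto simp: usc_on_def)
qed

lemma bounded_visc_solution_subsolutions:
  assumes "bounded_visc_solution_bdry1 p \<epsilon> \<Omega> u"
  shows "visc_subsolution p \<epsilon> \<Omega> u" "visc_subsolution p \<epsilon> \<Omega> (\<lambda>y. - u y)"
    "bounded (u ` \<Omega>)" "bounded ((\<lambda>y. - u y) ` \<Omega>)" "\<And>y. y \<in> frontier \<Omega> \<Longrightarrow> u y = 1"
  using assms visc_supersolution_uminus[of p \<epsilon> \<Omega> u]
  by (auto simp: bounded_visc_solution_bdry1_def visc_solution_def bounded_iff)

lemma bounded_visc_solution_continuous:
  assumes "bounded_visc_solution_bdry1 p \<epsilon> \<Omega> u" "open \<Omega>"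
  shows "continuous_on (closure \<Omega>) u"
proof -
  have c\<Omega>: "continuous_on \<Omega> u"
    using assms by (intro usc_lsc_imp_continuous_on)
      (auto simp: bounded_visc_solution_bdry1_def visc_solution_def visc_subsolution_def visc_supersolution_def)
  have cl: "closure \<Omega> = \<Omega> \<union> frontier \<Omega>"
    using closure_subset by (auto simp: frontier_def interior_open[OF assms(2)])
  show ?thesis unfolding continuous_on_def
  proof
    fix y assume "y \<in> closure \<Omega>"
    show "(u \<longlongrightarrow> u y) (at y within closure \<Omega>)"
    proof (cases "y \<in> \<Omega>")
      case True
      hence "isCont u y" using c\<Omega> assms(2) by (simp add: continuous_on_eq_continuous_at)
      thus ?thesis by (metis isContD tendsto_within_subset top_greatest)
    next
      case False
      hence y: "y \<in> frontier \<Omega>" using \<open>y \<in> closure \<Omega>\<close> cl by auto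
      have 1: "(u \<longlongrightarrow> 1) (at y within \<Omega>)" "u y = 1"
        using assms y by (auto simp: bounded_visc_solution_bdry1_def)
      have "\<forall>\<^sub>F z in at y within frontier \<Omega>. u z = 1"
        using bounded_visc_solution_subsolutions(5)[OF assms(1)] by (auto simp: eventually_at_filter)
      hence 2: "(u \<longlongrightarrow> 1) (at y within frontier \<Omega>)" by (rule tendsto_eventually)
      show ?thesis unfolding cl 1(2) by (intro Lim_Un 1(1) 2)
    qed
  qed
qed

text \<open>The domain may be unbounded, so a maximum need not exist. Subtracting \<open>\<sigma> \<bar>y - x1\<bar>\<^sup>2\<close> forces one. If it is interior,
the value there is at most a multiple of \<open>\<epsilon>\<^sup>2 \<sigma>\<close>, which is too small for a suitable \<open>\<sigma>\<close>.\<close>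

lemma visc_subsolution_max_principle:
  fixes w :: "real^'n \<Rightarrow> real"
  assumes p: "1 < p" and op: "open \<Omega>" and sub: "visc_subsolution p \<epsilon> \<Omega> w" and bdd: "bounded (w ` \<Omega>)"
    and cont: "continuous_on (closure \<Omega>) w" and fr: "\<And>y. y \<in> frontier \<Omega> \<Longrightarrow> w y \<le> c" and c: "0 \<le> c"
    and x1: "x1 \<in> \<Omega>"
  shows "w x1 \<le> c"
proof (rule ccontr)
  assume "\<not> w x1 \<le> c"
  hence gt: "w x1 > c" by simp
  define k where "k = \<epsilon>\<^sup>2 * (2 * real CARD('n) * (2 * norm (mat 1 :: real^'n^'n)))"
  have k: "k \<ge> 0" by (simp add: k_def)
  define \<sigma> where "\<sigma> = w x1 / (k + 1)"
  have wx1: "w x1 > 0" using gt c by simp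
  have \<sigma>: "\<sigma> > 0" using k wx1 by (simp add: \<sigma>_def)
  have ks: "k * \<sigma> < w x1" using k wx1 by (simp add: \<sigma>_def field_simps)
  obtain U0 where U0: "\<And>y. y \<in> \<Omega> \<Longrightarrow> \<bar>w y\<bar> \<le> U0"
    using bdd by (auto simp: bounded_iff)
  have U0': "U0 \<ge> 0" using U0[OF x1] by linarith
  define \<rho> where "\<rho> = sqrt (2 * U0 / \<sigma>)"
  have \<rho>: "\<rho> \<ge> 0" "\<sigma> * \<rho>\<^sup>2 = 2 * U0" using \<sigma> U0' by (auto simp: \<rho>_def)
  \<comment> \<open>This is \<open>\<sigma> \<bar>y - x1\<bar>\<^sup>2\<close>, written as an instance of the quartic test function.\<close>
  define W where "W = (\<lambda>y. 0 \<bullet> (y - x1) + (y - x1) \<bullet> (((2 * \<sigma>) *\<^sub>R mat 1) *v (y - x1)) / 2 + 0 * ((y - x1) \<bullet> (y - x1))\<^sup>2)"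
  have W: "W y = \<sigma> * (norm (y - x1))\<^sup>2" for y
    by (simp add: W_def scaleR_matrix_vector_assoc[symmetric] power2_norm_eq_inner)
  have "C2_on \<Omega> W (\<lambda>y. 0 + ((2 * \<sigma>) *\<^sub>R mat 1) *v (y - x1) + (4 * 0 * ((y - x1) \<bullet> (y - x1))) *\<^sub>R (y - x1))
     (\<lambda>y. (2 * \<sigma>) *\<^sub>R mat 1 + (4 * 0 * ((y - x1) \<bullet> (y - x1))) *\<^sub>R mat 1 + (8 * 0) *\<^sub>R outer_prod (y - x1) (y - x1))"
    unfolding W_def by (rule quartic_test_function) (simp add: transpose_def vec_eq_iff mat_def)
  hence C2: "C2_on \<Omega> W (\<lambda>y. ((2 * \<sigma>) *\<^sub>R mat 1) *v (y - x1)) (\<lambda>y. (2 * \<sigma>) *\<^sub>R mat 1)"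
    by simp
  define K where "K = closure \<Omega> \<inter> cball x1 \<rho>"
  have cK: "compact K" unfolding K_def by (intro closed_Int_compact) auto
  have x1K: "x1 \<in> K" using x1 closure_subset \<rho> by (auto simp: K_def)
  have "continuous_on K (\<lambda>y. w y - W y)" unfolding W
    by (intro continuous_intros continuous_on_subset[OF cont]) (auto simp: K_def)
  then obtain x0 where x0: "x0 \<in> K" "\<And>y. y \<in> K \<Longrightarrow> w y - W y \<le> w x0 - W x0"
    using continuous_attains_sup[OF cK] x1K by blast
  have "w x1 \<le> w x0 - W x0" using x0(2)[OF x1K] by (simp add: W)
  moreover have "W x0 \<ge> 0" using \<sigma> by (simp add: W)
  ultimately have wx0: "w x1 \<le> w x0" "w x1 \<le> w x0 - W x0" by auto
  have "x0 \<notin> frontier \<Omega>" using fr[of x0] wx0(1) gt by auto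
  hence x0\<Omega>: "x0 \<in> \<Omega>" using x0(1) by (auto simp: K_def frontier_def interior_open[OF op])
  have mx: "w y - W y \<le> w x0 - W x0" if y: "y \<in> \<Omega>" for y
  proof (cases "y \<in> cball x1 \<rho>")
    case True thus ?thesis using y closure_subset by (intro x0(2)) (auto simp: K_def)
  next
    case False
    hence "\<rho> \<le> norm (y - x1)" by (simp add: dist_norm norm_minus_commute)
    hence "\<sigma> * \<rho>\<^sup>2 \<le> W y" unfolding W using \<rho> \<sigma> by (intro mult_left_mono power_mono) auto
    thus ?thesis using wx0(2) U0[OF y] U0[OF x1] \<rho>(2) by linarith
  qed
  have "w x0 \<le> \<epsilon>\<^sup>2 * (2 * real CARD('n) * norm ((2 * \<sigma>) *\<^sub>R (mat 1 :: real^'n^'n)))"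
    using C2 by (intro visc_subsolution_max(1)[OF p sub bdd op order_refl x0\<Omega> _ _ mx])
      (auto simp: C2_on_def x0\<Omega>)
  also have "\<dots> = k * \<sigma>" using \<sigma> by (simp add: k_def)
  finally show False using ks wx0(1) by linarith
qed

lemma bounded_visc_solution_range:
  assumes "1 < p" "open \<Omega>" "bounded_visc_solution_bdry1 p \<epsilon> \<Omega> u" "x \<in> closure \<Omega>"
  shows "0 \<le> u x" "u x \<le> 1"
proof -
  note s = bounded_visc_solution_subsolutions[OF assms(3)]
  note ct = bounded_visc_solution_continuous[OF assms(3,2)]
  have "0 \<le> u x \<and> u x \<le> 1"
  proof (cases "x \<in> \<Omega>")
    case True
    have "u x \<le> 1"
      by (rule visc_subsolution_max_principle[OF assms(1,2) s(1,3) ct]) (use s True in auto)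
    moreover have "- u x \<le> 0"
      by (rule visc_subsolution_max_principle[OF assms(1,2) s(2,4) continuous_on_minus[OF ct]])
         (use s True in auto)
    ultimately show ?thesis by simp
  next
    case False
    hence "x \<in> frontier \<Omega>" using assms by (auto simp: frontier_def interior_open)
    thus ?thesis using s(5) by auto
  qed
  thus "0 \<le> u x" "u x \<le> 1" by auto
qed

text \<open>Comparison with a strict classical supersolution \<open>V\<close>: where \<open>w - V\<close> is maximal and positive, \<open>V\<close>
touches \<open>w\<close> up to a constant, and the zeroth order term contradicts strictness. At each point strictness may be
verified in either of the two forms of the touching inequality.\<close>

lemma visc_barrier:
  fixes w :: "real^'n \<Rightarrow> real"
  assumes p: "1 < p" and sub: "visc_subsolution p \<epsilon> \<Omega> w" and bdd: "bounded (w ` \<Omega>)"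
    and S: "compact S" "continuous_on S w" "continuous_on S V"
    and D: "open D" "D \<subseteq> S" "D \<subseteq> \<Omega>"
    and bd: "\<And>y. y \<in> S - D \<Longrightarrow> w y \<le> V y"
    and gd: "\<And>y. y \<in> D \<Longrightarrow> GDERIV V y :> DV y"
    and d2: "\<And>y. y \<in> D \<Longrightarrow> (DV has_derivative (\<lambda>h. D2V y *v h)) (at y)"
    and strict: "\<And>y. y \<in> D \<Longrightarrow> \<epsilon>\<^sup>2 * (2 * real CARD('n) * norm (D2V y)) < V y
        \<or> (DV y \<noteq> 0 \<and> V y + \<epsilon>\<^sup>2 * F_op p (DV y) (D2V y) > 0)"
    and y: "y \<in> S"
  shows "w y \<le> V y"
proof (rule ccontr)
  assume "\<not> w y \<le> V y"
  have "continuous_on S (\<lambda>y. w y - V y)" using S by (intro continuous_intros)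
  then obtain x0 where x0: "x0 \<in> S" "\<And>y. y \<in> S \<Longrightarrow> w y - V y \<le> w x0 - V x0"
    using continuous_attains_sup[OF S(1)] y by blast
  have gt: "w x0 > V x0" using x0(2)[OF y] \<open>\<not> w y \<le> V y\<close> by linarith
  hence x0D: "x0 \<in> D" using bd[of x0] x0(1) by force
  note m = visc_subsolution_max[OF p sub bdd D(1,3) x0D gd d2[OF x0D]]
  have "w x0 \<le> \<epsilon>\<^sup>2 * (2 * real CARD('n) * norm (D2V x0))"
    using D(2) x0(2) by (intro m(1)) auto
  moreover have "DV x0 \<noteq> 0 \<Longrightarrow> w x0 + \<epsilon>\<^sup>2 * F_op p (DV x0) (D2V x0) \<le> 0"
    using D(2) x0(2) by (intro m(2)) auto
  ultimately show False using strict[OF x0D] gt by linarith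
qed

section \<open>Exponential barriers and decay in the interior\<close>

lemma norm_outer_prod_self: "norm (outer_prod b b) \<le> (norm (b :: real^'n))\<^sup>2"
proof -
  have "(norm (outer_prod b b))\<^sup>2 = (\<Sum>i\<in>UNIV. \<Sum>j\<in>UNIV. (b $ i * b $ i) * (b $ j * b $ j))"
    by (simp add: power2_norm_eq_inner inner_vec_def outer_prod_def mult_ac)
  also have "\<dots> = ((norm b)\<^sup>2)\<^sup>2"
    by (simp add: power2_norm_eq_inner inner_vec_def sum_product power2_eq_square[of "sum _ _"])
  finally show ?thesis by (auto intro: power2_le_imp_le[of _ "(norm b)\<^sup>2"])
qed

text \<open>For functions of the form \<open>s exp (\<psi> / \<epsilon>) + C\<close> the Hessian is dominated by the rank one term
\<open>\<nabla>\<psi> \<otimes> \<nabla>\<psi> / \<epsilon>\<^sup>2\<close>, so that strictness only depends on the length of \<open>\<nabla>\<psi>\<close> when \<open>\<epsilon>\<close> is small.\<close>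

lemma exp_barrier_derivatives:
  fixes \<psi> :: "real^'n \<Rightarrow> real"
  assumes gd: "GDERIV \<psi> y :> D\<psi> y" and \<epsilon>: "\<epsilon> > 0"
  shows "GDERIV (\<lambda>y. s * exp (\<psi> y / \<epsilon>) + C) y :> (s * exp (\<psi> y / \<epsilon>) / \<epsilon>) *\<^sub>R D\<psi> y"
    and "(D\<psi> has_derivative (\<lambda>h. H *v h)) (at y) \<Longrightarrow>
      ((\<lambda>y. (s * exp (\<psi> y / \<epsilon>) / \<epsilon>) *\<^sub>R D\<psi> y) has_derivative
       (\<lambda>h. ((s * exp (\<psi> y / \<epsilon>) / \<epsilon>) *\<^sub>R ((1/\<epsilon>) *\<^sub>R outer_prod (D\<psi> y) (D\<psi> y) + H)) *v h)) (at y)"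
proof -
  have g: "(\<psi> has_derivative (\<lambda>h. h \<bullet> D\<psi> y)) (at y)" using gd by (simp add: gderiv_def)
  have e: "((\<lambda>y. exp (\<psi> y / \<epsilon>)) has_derivative (\<lambda>h. exp (\<psi> y / \<epsilon>) * ((h \<bullet> D\<psi> y) / \<epsilon>))) (at y)"
    using has_derivative_exp[OF has_derivative_mult_left[OF g, of "1/\<epsilon>"]] by (simp add: mult_ac)
  show "GDERIV (\<lambda>y. s * exp (\<psi> y / \<epsilon>) + C) y :> (s * exp (\<psi> y / \<epsilon>) / \<epsilon>) *\<^sub>R D\<psi> y"
    using has_derivative_add_const[OF has_derivative_mult_right[OF e, of s], of C]
    unfolding gderiv_def by (simp add: mult_ac)
  have e2: "((\<lambda>y. s * exp (\<psi> y / \<epsilon>) / \<epsilon>) has_derivative (\<lambda>h. s * exp (\<psi> y / \<epsilon>) * ((h \<bullet> D\<psi> y) / \<epsilon>) / \<epsilon>)) (at y)"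
    using has_derivative_mult_right[OF e, of "s / \<epsilon>"] by (simp add: mult_ac)
  assume h: "(D\<psi> has_derivative (\<lambda>h. H *v h)) (at y)"
  show "((\<lambda>y. (s * exp (\<psi> y / \<epsilon>) / \<epsilon>) *\<^sub>R D\<psi> y) has_derivative
       (\<lambda>h. ((s * exp (\<psi> y / \<epsilon>) / \<epsilon>) *\<^sub>R ((1/\<epsilon>) *\<^sub>R outer_prod (D\<psi> y) (D\<psi> y) + H)) *v h)) (at y)"
    by (rule has_derivative_eq_rhs[OF has_derivative_scaleR[OF e2 h]])
       (simp add: fun_eq_iff scaleR_matrix_vector_assoc[symmetric] matrix_vector_mult_add_rdistrib
        outer_prod_mult inner_commute scaleR_add_right)
qed

text \<open>The rank one term points in the direction of the gradient, where the operator is the second derivative times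
\<open>1 - 1 / p\<close>, the reciprocal of \<open>p'\<close>. This is the origin of \<open>p'\<close> in the final formula.\<close>

lemma F_op_exp_barrier:
  fixes b :: "real^'n"
  assumes b: "b \<noteq> 0" and c: "c \<noteq> 0" "\<epsilon> > 0"
  shows "\<epsilon>\<^sup>2 * F_op p ((c / \<epsilon>) *\<^sub>R b) ((c / \<epsilon>) *\<^sub>R ((1/\<epsilon>) *\<^sub>R outer_prod b b + H))
    = c * (\<epsilon> * F_op p b H - (1 - inv_exponent p) * (norm b)\<^sup>2)"
proof -
  have q: "b \<bullet> (outer_prod b b *v b) = (norm b)\<^sup>2 * (norm b)\<^sup>2"
    by (simp add: outer_prod_mult power2_norm_eq_inner)
  have t: "trace (outer_prod b b) = (norm b)\<^sup>2"
    by (simp add: trace_def outer_prod_def power2_norm_eq_inner inner_vec_def)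
  have alg: "- (i * n + (1 - 2 * i) * (n * n) / n) = - (1 - i) * n" if "n \<noteq> 0" for i n :: real
    using that by (simp add: field_simps)
  have "F_op p b (outer_prod b b) = - (1 - inv_exponent p) * (norm b)\<^sup>2"
    unfolding F_op_eq q t using b alg[of "(norm b)\<^sup>2" "inv_exponent p"] by simp
  hence "F_op p ((c / \<epsilon>) *\<^sub>R b) ((c / \<epsilon>) *\<^sub>R ((1/\<epsilon>) *\<^sub>R outer_prod b b + H))
    = (c / \<epsilon>) * ((1/\<epsilon>) * (- (1 - inv_exponent p) * (norm b)\<^sup>2) + F_op p b H)"
    using c F_op_scaleR_grad[of "c / \<epsilon>" p b] by (simp add: F_op_scaleR F_op_add)
  also have "\<epsilon>\<^sup>2 * \<dots> = c * (\<epsilon> * F_op p b H - (1 - inv_exponent p) * (norm b)\<^sup>2)"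
    using c by (simp add: power2_eq_square field_simps)
  finally show ?thesis .
qed

text \<open>The barrier is \<open>exp (a (\<bar>y - z\<bar>\<^sup>2 - r\<^sup>2) / \<epsilon>)\<close>, which is \<open>1\<close> on the sphere and exponentially small at the centre. Its
gradient vanishes at the centre, so strictness comes from the crude inequality, for \<open>a\<close> small.\<close>

lemma ball_barrier:
  fixes \<Omega> :: "(real^'n) set"
  assumes p: "1 < p" and op: "open \<Omega>" and r: "r > 0"
  shows "\<exists>c>0. \<forall>\<epsilon> u z. 0 < \<epsilon> \<longrightarrow> \<epsilon> \<le> 1 \<longrightarrow> cball z r \<subseteq> \<Omega> \<longrightarrow> bounded_visc_solution_bdry1 p \<epsilon> \<Omega> u \<longrightarrow>
    u z \<le> exp (- c / \<epsilon>)"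
proof -
  define m where "m = norm (mat 1 :: real^'n^'n)"
  define N where "N = real CARD('n)"
  have N: "N \<ge> 1" unfolding N_def using zero_less_card_finite[where 'a='n] by linarith
  have m: "m \<ge> 0" by (simp add: m_def)
  \<comment> \<open>Small enough that the Hessian of the barrier is dominated by its value for every \<open>\<epsilon> \<le> 1\<close>.\<close>
  define a where "a = min 1 (1 / (4 * N * (4 * r\<^sup>2 + 2 * m + 1)))"
  have den: "4 * N * (4 * r\<^sup>2 + 2 * m + 1) > 0" using N m by (intro mult_pos_pos) (auto intro: add_nonneg_pos)
  have a: "a > 0" "a \<le> 1" using den by (auto simp: a_def)
  have a2: "2 * N * (4 * a\<^sup>2 * r\<^sup>2 + 2 * a * m) < 1"
  proof -
    have "a \<le> 1 / (4 * N * (4 * r\<^sup>2 + 2 * m + 1))" unfolding a_def by simp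
    hence "a * (4 * N * (4 * r\<^sup>2 + 2 * m + 1)) \<le> 1" using den by (simp add: field_simps)
    hence "2 * N * (a * (4 * r\<^sup>2 + 2 * m + 1)) \<le> 1/2" by (simp add: algebra_simps)
    moreover have "4 * a\<^sup>2 * r\<^sup>2 + 2 * a * m \<le> a * (4 * r\<^sup>2 + 2 * m + 1)"
    proof -
      have "a\<^sup>2 \<le> a" using a by (simp add: power2_eq_square mult_left_le)
      hence "a\<^sup>2 * (4 * r\<^sup>2) \<le> a * (4 * r\<^sup>2)" by (intro mult_right_mono) auto
      thus ?thesis using a m by (simp add: algebra_simps)
    qed
    hence "2 * N * (4 * a\<^sup>2 * r\<^sup>2 + 2 * a * m) \<le> 2 * N * (a * (4 * r\<^sup>2 + 2 * m + 1))"
      using N by (intro mult_left_mono) auto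
    ultimately show ?thesis by linarith
  qed
  have "u z \<le> exp (- (a * r\<^sup>2) / \<epsilon>)"
    if \<epsilon>: "0 < \<epsilon>" "\<epsilon> \<le> 1" and z: "cball z r \<subseteq> \<Omega>" and sol: "bounded_visc_solution_bdry1 p \<epsilon> \<Omega> u" for \<epsilon> u z
  proof -
    note s = bounded_visc_solution_subsolutions[OF sol]
    define X where "X = (2 * a) *\<^sub>R (mat 1 :: real^'n^'n)"
    define \<psi> where "\<psi> y = a * ((y - z) \<bullet> (y - z)) - a * r\<^sup>2" for y
    define D\<psi> where "D\<psi> y = (2 * a) *\<^sub>R (y - z)" for y
    have g: "GDERIV \<psi> y :> D\<psi> y" for y
      unfolding gderiv_def \<psi>_def[abs_def] D\<psi>_def
      by (auto intro!: derivative_eq_intros simp: fun_eq_iff inner_commute algebra_simps)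
    have h: "(D\<psi> has_derivative (\<lambda>h. X *v h)) (at y)" for y
      unfolding D\<psi>_def[abs_def] X_def
      by (auto intro!: derivative_eq_intros simp: fun_eq_iff scaleR_matrix_vector_assoc[symmetric])
    define V where "V y = 1 * exp (\<psi> y / \<epsilon>) + 0" for y
    define DV where "DV y = (1 * exp (\<psi> y / \<epsilon>) / \<epsilon>) *\<^sub>R D\<psi> y" for y
    define D2V where "D2V y = (1 * exp (\<psi> y / \<epsilon>) / \<epsilon>) *\<^sub>R ((1/\<epsilon>) *\<^sub>R outer_prod (D\<psi> y) (D\<psi> y) + X)" for y
    have gV: "GDERIV V y :> DV y" for y
      unfolding V_def[abs_def] DV_def by (rule exp_barrier_derivatives(1)[OF g \<epsilon>(1)])
    have hV: "(DV has_derivative (\<lambda>h. D2V y *v h)) (at y)" for y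
      unfolding DV_def[abs_def] D2V_def by (rule exp_barrier_derivatives(2)[OF g \<epsilon>(1) h])
    have "u z \<le> V z"
    proof (rule visc_barrier[OF p s(1) s(3), of "cball z r" V "ball z r" DV D2V])
      show "continuous_on (cball z r) u"
        using bounded_visc_solution_continuous[OF sol op] z closure_subset
        by (meson continuous_on_subset subset_trans)
      show "continuous_on (cball z r) V" unfolding V_def \<psi>_def using \<epsilon> by (intro continuous_intros) auto
      fix y assume y: "y \<in> cball z r - ball z r"
      hence "norm (y - z) = r" by (auto simp: dist_norm norm_minus_commute)
      hence "(y - z) \<bullet> (y - z) = r\<^sup>2" by (simp flip: power2_norm_eq_inner)
      hence "V y = 1" by (simp add: V_def \<psi>_def)
      thus "u y \<le> V y" using bounded_visc_solution_range(2)[OF p op sol, of y] y z closure_subset[of \<Omega>]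
          by (metis DiffD1 subsetD)
    next
      fix y assume y: "y \<in> ball z r"
      have "norm (D2V y) = exp (\<psi> y / \<epsilon>) / \<epsilon> * norm ((1/\<epsilon>) *\<^sub>R outer_prod (D\<psi> y) (D\<psi> y) + X)"
        using \<epsilon> by (simp add: D2V_def)
      also have "\<dots> \<le> exp (\<psi> y / \<epsilon>) / \<epsilon> * (4 * a\<^sup>2 * r\<^sup>2 / \<epsilon> + 2 * a * m)"
      proof (intro mult_left_mono)
        have "norm (y - z) \<le> r" using y by (simp add: dist_norm norm_minus_commute)
        hence "(norm (D\<psi> y))\<^sup>2 \<le> 4 * a\<^sup>2 * r\<^sup>2"
          unfolding D\<psi>_def by (simp add: power_mult_distrib mult_left_mono power_mono)
        hence "norm ((1/\<epsilon>) *\<^sub>R outer_prod (D\<psi> y) (D\<psi> y)) \<le> 4 * a\<^sup>2 * r\<^sup>2 / \<epsilon>"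
          using norm_outer_prod_self[of "D\<psi> y"] \<epsilon> by (simp add: divide_right_mono)
        moreover have "norm X = 2 * a * m" using a by (simp add: X_def m_def)
        ultimately show "norm ((1/\<epsilon>) *\<^sub>R outer_prod (D\<psi> y) (D\<psi> y) + X) \<le> 4 * a\<^sup>2 * r\<^sup>2 / \<epsilon> + 2 * a * m"
          using norm_triangle_ineq[of "(1/\<epsilon>) *\<^sub>R outer_prod (D\<psi> y) (D\<psi> y)" X] by linarith
      qed (use \<epsilon> in auto)
      finally have "\<epsilon>\<^sup>2 * (2 * N * norm (D2V y)) \<le> \<epsilon>\<^sup>2 * (2 * N * (exp (\<psi> y / \<epsilon>) / \<epsilon> * (4 * a\<^sup>2 * r\<^sup>2 / \<epsilon> + 2 * a * m)))"
        using N by (intro mult_left_mono) auto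
      also have "\<dots> = exp (\<psi> y / \<epsilon>) * (2 * N * (4 * a\<^sup>2 * r\<^sup>2 + \<epsilon> * (2 * a * m)))"
        using \<epsilon> by (simp add: field_simps power2_eq_square)
      also have "\<dots> < exp (\<psi> y / \<epsilon>) * 1"
      proof (intro mult_strict_left_mono)
        have "\<epsilon> * (2 * a * m) \<le> 1 * (2 * a * m)" using \<epsilon> a m by (intro mult_right_mono) auto
        hence "2 * N * (4 * a\<^sup>2 * r\<^sup>2 + \<epsilon> * (2 * a * m)) \<le> 2 * N * (4 * a\<^sup>2 * r\<^sup>2 + 2 * a * m)"
          using N by (intro mult_left_mono) auto
        thus "2 * N * (4 * a\<^sup>2 * r\<^sup>2 + \<epsilon> * (2 * a * m)) < 1" using a2 by linarith
      qed auto
      finally show "\<epsilon>\<^sup>2 * (2 * real CARD('n) * norm (D2V y)) < V y \<or>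
          (DV y \<noteq> 0 \<and> V y + \<epsilon>\<^sup>2 * F_op p (DV y) (D2V y) > 0)" by (simp add: V_def N_def)
    qed (use gV hV r z in auto)
    thus ?thesis by (simp add: V_def \<psi>_def)
  qed
  thus ?thesis using a r by (intro exI[of _ "a * r\<^sup>2"]) auto
qed

lemma interior_exponential_decay:
  fixes \<Omega> :: "(real^'n) set"
  assumes p: "1 < p" and op: "open \<Omega>" and K: "compact K" "K \<subseteq> \<Omega>"
  shows "\<exists>c>0. \<forall>\<epsilon> u z. 0 < \<epsilon> \<longrightarrow> \<epsilon> \<le> 1 \<longrightarrow> bounded_visc_solution_bdry1 p \<epsilon> \<Omega> u \<longrightarrow> z \<in> K \<longrightarrow>
    u z \<le> exp (- c / \<epsilon>)"
proof -
  obtain e where e: "e > 0" "(\<Union>x\<in>K. cball x e) \<subseteq> \<Omega>"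
    using compact_subset_open_imp_cball_epsilon_subset[OF K(1) op K(2)] by auto
  obtain c where "c > 0" "\<And>\<epsilon> u z. 0 < \<epsilon> \<Longrightarrow> \<epsilon> \<le> 1 \<Longrightarrow> cball z e \<subseteq> \<Omega> \<Longrightarrow>
      bounded_visc_solution_bdry1 p \<epsilon> \<Omega> u \<Longrightarrow> u z \<le> exp (- c / \<epsilon>)"
    using ball_barrier[OF p op e(1)] by blast
  thus ?thesis using e(2) by (intro exI[of _ c]) blast
qed

section \<open>The geometry at the contact point\<close>

text \<open>The domain is the region above the graph of \<open>f\<close> near the contact point \<open>y0\<close>. The map \<open>\<sigma>\<close> matches the coordinates other
than \<open>k\<close> with the principal directions, so that in the orthonormal frame formed by the \<open>e (\<sigma> j)\<close>
and \<open>\<nu>\<close> the normal coordinate is the one with index \<open>k\<close>.\<close>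

locale touching_ball =
  fixes \<Omega> :: "(real^'n) set" and x y0 :: "real^'n" and R :: real and p :: ereal
    and \<kappa> :: "nat \<Rightarrow> real" and \<nu> :: "real^'n" and f Df D2f and e :: "nat \<Rightarrow> real^'n" and r0 :: real
    and k :: 'n and \<sigma> :: "'n \<Rightarrow> nat"
  assumes op: "open \<Omega>" and p: "1 < p" and R: "R > 0" and ball: "ball x R \<subseteq> \<Omega>"
    and y0: "y0 \<in> frontier \<Omega>"
    and contact: "closure (ball x R) \<inter> (UNIV - \<Omega>) = {y0}"
    and norm_\<nu>: "norm \<nu> = 1" and f_inv: "\<And>z t. f (z + t *\<^sub>R \<nu>) = f z"
    and r0: "r0 > 0" and C2: "C2_on (ball 0 r0) f Df D2f"
    and graph: "\<And>z. z \<in> ball y0 r0 \<Longrightarrow> z \<in> \<Omega> \<longleftrightarrow> f (z - y0) < (z - y0) \<bullet> \<nu>"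
    and Df0: "Df 0 = 0"
    and \<sigma>: "bij_betw \<sigma> (UNIV - {k}) {1..CARD('n) - 1}"
    and ortho: "\<And>i j. i \<in> {1..CARD('n) - 1} \<Longrightarrow> j \<in> {1..CARD('n) - 1} \<Longrightarrow> e i \<bullet> e j = (if i = j then 1 else 0)"
    and e\<nu>: "\<And>j. j \<in> {1..CARD('n) - 1} \<Longrightarrow> e j \<bullet> \<nu> = 0"
    and eig: "\<And>j. j \<in> {1..CARD('n) - 1} \<Longrightarrow> D2f 0 *v e j = \<kappa> j *\<^sub>R e j"
    and curv: "\<And>j. j \<in> {1..CARD('n) - 1} \<Longrightarrow> \<kappa> j < 1 / R"
begin

text \<open>The defining function of the domain; it vanishes on the boundary near \<open>y0\<close>.\<close>

definition height :: "real^'n \<Rightarrow> real" where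
  "height z = (z - y0) \<bullet> \<nu> - f (z - y0)"

lemma f_gderiv: "norm h < r0 \<Longrightarrow> GDERIV f h :> Df h"
  and Df_deriv: "norm h < r0 \<Longrightarrow> (Df has_derivative (\<lambda>v. D2f h *v v)) (at h)"
  using C2 by (auto simp: C2_on_def)

lemma f_cont: "norm h < r0 \<Longrightarrow> isCont f h"
  using f_gderiv[of h] by (auto simp: gderiv_def intro: has_derivative_continuous)

lemma height_cont: "continuous_on (ball y0 r0) height"
proof -
  have "isCont height z" if "z \<in> ball y0 r0" for z
  proof -
    have "isCont f (z - y0)" using that by (intro f_cont) (simp add: dist_norm norm_minus_commute)
    hence "isCont (\<lambda>z. f (z - y0)) z"
      by (intro isCont_o2[where f="\<lambda>z. z - y0" and g=f]) (auto intro!: continuous_intros)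
    thus ?thesis unfolding height_def[abs_def] by (intro continuous_intros)
  qed
  thus ?thesis by (simp add: continuous_at_imp_continuous_on)
qed

lemma height_pos: "z \<in> ball y0 r0 \<Longrightarrow> z \<in> \<Omega> \<longleftrightarrow> height z > 0"
  using graph[of z] by (simp add: height_def)

lemma height_nonneg:
  assumes "z \<in> ball y0 r0" "z \<in> closure \<Omega>" shows "height z \<ge> 0"
proof (rule ccontr)
  assume n: "\<not> height z \<ge> 0"
  have "isCont height z" using height_cont assms(1) by (simp add: continuous_on_eq_continuous_at)
  hence "\<forall>\<^sub>F w in nhds z. height w < 0"
    using n order_tendstoD(2)[of height "height z" "nhds z" 0]
    by (simp add: isCont_def tendsto_at_iff_tendsto_nhds)
  moreover have "\<forall>\<^sub>F w in nhds z. w \<in> ball y0 r0" by (rule eventually_nhds_in_open) (use assms in auto)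
  ultimately have "\<forall>\<^sub>F w in nhds z. w \<notin> \<Omega>"
    by eventually_elim (use height_pos in fastforce)
  then obtain U where "open U" "z \<in> U" "\<forall>w\<in>U. w \<notin> \<Omega>" unfolding eventually_nhds by auto
  thus False using assms(2) by (auto simp: closure_iff_nhds_not_empty)
qed

lemma height_frontier:
  assumes "z \<in> ball y0 r0" "z \<in> frontier \<Omega>" shows "height z = 0"
proof -
  have "z \<notin> \<Omega>" "z \<in> closure \<Omega>" using assms op by (auto simp: frontier_def interior_open)
  thus ?thesis using height_pos[OF assms(1)] height_nonneg[OF assms(1)] by auto
qed

lemma f0: "f 0 = 0"
  using height_frontier[OF _ y0] r0 by (simp add: height_def)

lemma y0_notin: "y0 \<notin> \<Omega>"
  using y0 op by (auto simp: frontier_def interior_open)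

lemma norm_x_y0: "norm (x - y0) = R"
proof -
  have "y0 \<in> cball x R" using contact R by auto
  moreover have "y0 \<notin> ball x R" using ball y0_notin by auto
  ultimately show ?thesis by (auto simp: dist_norm)
qed

text \<open>The ball touches the graph from above, so the two are tangent. If the direction \<open>n\<close> to the centre were not
\<open>\<nu>\<close>, then \<open>n - \<nu>\<close> would point into the ball but below the graph.\<close>

lemma center: "x - y0 = R *\<^sub>R \<nu>"
proof -
  define n where "n = (1/R) *\<^sub>R (x - y0)"
  have n: "norm n = 1" "x - y0 = R *\<^sub>R n" using norm_x_y0 R by (auto simp: n_def)
  have "n = \<nu>"
  proof (rule ccontr)
    assume ne: "n \<noteq> \<nu>"
    define w where "w = n - \<nu>"
    have nn: "n \<bullet> n = 1" "\<nu> \<bullet> \<nu> = 1" using n norm_\<nu> by (auto simp: norm_eq_1)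
    have "0 < w \<bullet> w" using ne by (simp add: w_def)
    hence lt: "n \<bullet> \<nu> < 1" using nn by (simp add: w_def inner_diff inner_commute)
    have wn: "w \<bullet> n > 0" "w \<bullet> \<nu> < 0" using nn lt by (auto simp: w_def inner_diff inner_commute)
    have der: "(f has_derivative (\<lambda>h. h \<bullet> 0)) (at 0)"
      using f_gderiv[of 0] r0 Df0 by (simp add: gderiv_def)
    define c where "c = - (w \<bullet> \<nu>) / (2 * (norm w + 1))"
    have c: "c > 0" using wn by (simp add: c_def divide_neg_pos add_nonneg_pos)
    have "\<exists>d>0. \<forall>h. norm (h - 0) < d \<longrightarrow> norm (f h - f 0 - (h - 0) \<bullet> 0) \<le> c * norm (h - 0)"
      using der c unfolding has_derivative_at_alt by blast
    then obtain d where d: "d > 0" "\<And>h. norm h < d \<Longrightarrow> \<bar>f h\<bar> \<le> c * norm h"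
      by (auto simp: f0)
    \<comment> \<open>Short enough for the linearization of \<open>f\<close>, for the graph description and for staying in the ball.\<close>
    define t where "t = min (min (d / (2 * (norm w + 1))) (r0 / (2 * (norm w + 1)))) (R * (w \<bullet> n) / (norm w + 1)\<^sup>2)"
    have nw: "norm w + 1 > 0" by (simp add: add_nonneg_pos)
    have t: "t > 0" using d r0 R wn nw by (auto simp: t_def)
    have t1: "t * norm w < d" "t * norm w < r0"
    proof -
      have "t \<le> d / (2 * (norm w + 1))" "t \<le> r0 / (2 * (norm w + 1))" by (auto simp: t_def)
      hence "t * (norm w + 1) \<le> d / 2" "t * (norm w + 1) \<le> r0 / 2"
        using nw by (auto simp: field_simps)
      thus "t * norm w < d" "t * norm w < r0" using t d r0 by (auto simp: algebra_simps)
    qed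
    have t2: "t * (norm w)\<^sup>2 < 2 * R * (w \<bullet> n)"
    proof -
      have "t \<le> R * (w \<bullet> n) / (norm w + 1)\<^sup>2" by (simp add: t_def)
      hence "t * (norm w + 1)\<^sup>2 \<le> R * (w \<bullet> n)" using nw by (simp add: field_simps)
      moreover have "t * (norm w)\<^sup>2 \<le> t * (norm w + 1)\<^sup>2"
        using t by (intro mult_left_mono power_mono) auto
      moreover have "R * (w \<bullet> n) < 2 * R * (w \<bullet> n)" using R wn by simp
      ultimately show ?thesis by linarith
    qed
    define z where "z = y0 + t *\<^sub>R w"
    have "z \<in> ball x R"
    proof -
      have xz: "x - z = R *\<^sub>R n - t *\<^sub>R w" using n(2) by (simp add: z_def algebra_simps)
      have "(norm (R *\<^sub>R n - t *\<^sub>R w))\<^sup>2 = R * R * (n \<bullet> n) - 2 * R * t * (w \<bullet> n) + t * t * (w \<bullet> w)"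
        unfolding power2_norm_eq_inner
        by (simp add: inner_diff_left inner_diff_right inner_commute algebra_simps)
      hence "(norm (x - z))\<^sup>2 = R\<^sup>2 + t * (t * (norm w)\<^sup>2 - 2 * R * (w \<bullet> n))"
        unfolding xz nn power2_norm_eq_inner[of w] by (simp add: algebra_simps power2_eq_square[of R])
      also have "\<dots> < R\<^sup>2" using t t2 by (simp add: mult_pos_neg)
      finally show ?thesis using R by (simp add: dist_norm power2_less_imp_less)
    qed
    hence "z \<in> \<Omega>" using ball by auto
    moreover have "z \<in> ball y0 r0" using t t1 by (simp add: z_def dist_norm)
    ultimately have "height z > 0" using height_pos by auto
    hence "f (t *\<^sub>R w) < t * (w \<bullet> \<nu>)" by (simp add: height_def z_def)
    moreover have "\<bar>f (t *\<^sub>R w)\<bar> \<le> c * (t * norm w)" using d(2)[of "t *\<^sub>R w"] t t1 by simp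
    moreover have "c * norm w \<le> - (w \<bullet> \<nu>) / 2"
    proof -
      have "c * (norm w + 1) = - (w \<bullet> \<nu>) / 2" using nw by (simp add: c_def field_simps)
      thus ?thesis using c by (simp add: algebra_simps)
    qed
    hence "t * (c * norm w) \<le> t * (- (w \<bullet> \<nu>) / 2)" using t by (intro mult_left_mono) auto
    moreover have "t * (w \<bullet> \<nu>) < 0" using t wn by (simp add: mult_pos_neg)
    ultimately show False by (simp add: algebra_simps)
  qed
  thus ?thesis using n(2) by simp
qed

text \<open>With the contact point as origin, the ball is the set where twice the radius times the normal coordinate
exceeds the squared norm.\<close>

lemma in_ball_iff: "z \<in> ball x R \<longleftrightarrow> (norm (z - y0))\<^sup>2 < 2 * R * ((z - y0) \<bullet> \<nu>)"
proof -
  have "x - z = R *\<^sub>R \<nu> - (z - y0)" using center by (simp add: algebra_simps)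
  moreover have "\<nu> \<bullet> \<nu> = 1" using norm_\<nu> by (simp add: norm_eq_1)
  ultimately have "(norm (x - z))\<^sup>2 = R\<^sup>2 + (norm (z - y0))\<^sup>2 - 2 * R * ((z - y0) \<bullet> \<nu>)"
    unfolding power2_norm_eq_inner
    by (simp add: inner_diff_left inner_diff_right inner_commute power2_eq_square)
       (simp add: algebra_simps inner_commute)
  moreover have "z \<in> ball x R \<longleftrightarrow> (norm (x - z))\<^sup>2 < R\<^sup>2"
    using R power_mono_iff[of R "norm (x - z)" 2] by (simp add: dist_norm flip: not_le)
  ultimately show ?thesis by auto
qed

definition frame :: "real^'n \<Rightarrow> real^'n" where
  "frame \<zeta> = \<zeta> $ k *\<^sub>R \<nu> + (\<Sum>j\<in>UNIV - {k}. \<zeta> $ j *\<^sub>R e (\<sigma> j))"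

lemma \<sigma>_in: "j \<noteq> k \<Longrightarrow> \<sigma> j \<in> {1..CARD('n) - 1}"
  using \<sigma> by (auto simp: bij_betw_def)

lemma \<sigma>_eq: "i \<noteq> k \<Longrightarrow> j \<noteq> k \<Longrightarrow> \<sigma> i = \<sigma> j \<longleftrightarrow> i = j"
  using \<sigma> by (auto simp: bij_betw_def inj_on_def)

lemma linear_frame: "linear frame"
  unfolding frame_def
  by (intro linearI) (simp_all add: scaleR_left_distrib sum.distrib scaleR_sum_right algebra_simps)

lemma frame_inner: "frame \<zeta> \<bullet> frame \<eta> = \<zeta> \<bullet> \<eta>"
proof -
  have 1: "e (\<sigma> i) \<bullet> e (\<sigma> j) = (if i = j then 1 else 0)" if "i \<noteq> k" "j \<noteq> k" for i j
    using ortho[OF \<sigma>_in[OF that(1)] \<sigma>_in[OF that(2)]] \<sigma>_eq[OF that] by simp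
  have 2: "e (\<sigma> i) \<bullet> \<nu> = 0" "\<nu> \<bullet> e (\<sigma> i) = 0" if "i \<noteq> k" for i
    using e\<nu>[OF \<sigma>_in[OF that]] by (auto simp: inner_commute)
  have 3: "\<nu> \<bullet> \<nu> = 1" using norm_\<nu> by (simp add: norm_eq_1)
  have "frame \<zeta> \<bullet> frame \<eta> = \<zeta> $ k * \<eta> $ k
     + (\<Sum>i\<in>UNIV - {k}. \<Sum>j\<in>UNIV - {k}. \<zeta> $ i * (\<eta> $ j * (e (\<sigma> i) \<bullet> e (\<sigma> j))))"
    unfolding frame_def
    by (simp add: inner_add_left inner_add_right inner_sum_left inner_sum_right 2 3 sum_distrib_left)
       (subst sum.swap, simp add: mult_ac)
  also have "(\<Sum>i\<in>UNIV - {k}. \<Sum>j\<in>UNIV - {k}. \<zeta> $ i * (\<eta> $ j * (e (\<sigma> i) \<bullet> e (\<sigma> j))))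
     = (\<Sum>i\<in>UNIV - {k}. \<zeta> $ i * \<eta> $ i)"
  proof (intro sum.cong refl)
    fix i assume i: "i \<in> UNIV - {k}"
    have "(\<Sum>j\<in>UNIV - {k}. \<zeta> $ i * (\<eta> $ j * (e (\<sigma> i) \<bullet> e (\<sigma> j))))
      = (\<Sum>j\<in>UNIV - {k}. if i = j then \<zeta> $ i * \<eta> $ i else 0)"
      using i by (intro sum.cong refl) (auto simp: 1)
    thus "(\<Sum>j\<in>UNIV - {k}. \<zeta> $ i * (\<eta> $ j * (e (\<sigma> i) \<bullet> e (\<sigma> j)))) = \<zeta> $ i * \<eta> $ i" using i by simp
  qed
  also have "\<zeta> $ k * \<eta> $ k + (\<Sum>i\<in>UNIV - {k}. \<zeta> $ i * \<eta> $ i) = \<zeta> \<bullet> \<eta>"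
    by (simp add: inner_vec_def sum.remove[of UNIV k])
  finally show ?thesis .
qed

lemma orthogonal_frame: "orthogonal_transformation frame"
  by (simp add: orthogonal_transformation_def linear_frame frame_inner)

lemma norm_frame [simp]: "norm (frame \<zeta>) = norm \<zeta>"
  by (simp add: norm_eq_sqrt_inner frame_inner)

lemma frame_normal: "frame \<zeta> \<bullet> \<nu> = \<zeta> $ k"
proof -
  have "frame (axis k 1) = \<nu>" unfolding frame_def by (simp add: axis_def)
  thus ?thesis using frame_inner[of \<zeta> "axis k 1"] by (simp add: inner_axis)
qed

lemma frame_surj: "\<exists>\<zeta>. h = frame \<zeta>"
  using orthogonal_transformation_surj[OF orthogonal_frame] by (metis surjD)

definition tan2 :: "real^'n \<Rightarrow> real" where "tan2 \<zeta> = (\<Sum>j\<in>UNIV - {k}. (\<zeta> $ j)\<^sup>2)"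
definition quad :: "real^'n \<Rightarrow> real" where "quad \<zeta> = (\<Sum>j\<in>UNIV - {k}. \<kappa> (\<sigma> j) * (\<zeta> $ j)\<^sup>2)"

lemma norm_tan2: "(norm \<zeta>)\<^sup>2 = tan2 \<zeta> + (\<zeta> $ k)\<^sup>2"
  by (simp add: tan2_def power2_norm_eq_inner inner_vec_def sum.remove[of UNIV k]) (simp add: power2_eq_square)

lemma tan2_nonneg: "tan2 \<zeta> \<ge> 0" by (simp add: tan2_def sum_nonneg)

text \<open>Invariance along \<open>\<nu>\<close> makes the remainder quadratic in the tangential part alone, however large
the normal coordinate is.\<close>

lemma f_frame_expansion:
  assumes "\<eta> > 0"
  shows "\<exists>r>0. \<forall>\<zeta>. tan2 \<zeta> < r \<longrightarrow> \<bar>f (frame \<zeta>) - quad \<zeta> / 2\<bar> \<le> \<eta> * tan2 \<zeta>"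
proof -
  have "\<forall>\<^sub>F y in nhds 0. \<bar>f y - f 0 - Df 0 \<bullet> (y - 0) - (y - 0) \<bullet> (D2f 0 *v (y - 0)) / 2\<bar> \<le> \<eta> * (norm (y - 0))\<^sup>2"
    using r0 by (intro second_order_expansion[of "ball 0 r0"] assms f_gderiv Df_deriv) auto
  then obtain d where d: "d > 0" "\<And>y. norm y < d \<Longrightarrow> \<bar>f y - y \<bullet> (D2f 0 *v y) / 2\<bar> \<le> \<eta> * (norm y)\<^sup>2"
    unfolding eventually_nhds_metric by (auto simp: f0 Df0)
  have "\<bar>f (frame \<zeta>) - quad \<zeta> / 2\<bar> \<le> \<eta> * tan2 \<zeta>" if "tan2 \<zeta> < d\<^sup>2" for \<zeta>
  proof -
    define \<zeta>' where "\<zeta>' = (\<chi> j. if j = k then 0 else \<zeta> $ j)"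
    have fr: "frame \<zeta>' = (\<Sum>j\<in>UNIV - {k}. \<zeta> $ j *\<^sub>R e (\<sigma> j))"
      unfolding frame_def \<zeta>'_def by (auto intro!: sum.cong)
    have t: "tan2 \<zeta>' = tan2 \<zeta>" unfolding tan2_def \<zeta>'_def by (auto intro!: sum.cong)
    have n: "(norm (frame \<zeta>'))\<^sup>2 = tan2 \<zeta>" by (simp add: norm_tan2 t) (simp add: \<zeta>'_def)
    have lt: "norm (frame \<zeta>') < d" using that n d(1) by (metis power2_less_imp_less less_imp_le)
    have "f (frame \<zeta>) = f (frame \<zeta>')"
      using f_inv[of "frame \<zeta>'" "\<zeta> $ k"] unfolding fr by (simp add: frame_def add.commute)
    moreover have "frame \<zeta>' \<bullet> (D2f 0 *v frame \<zeta>') = quad \<zeta>"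
    proof -
      define \<eta>' where "\<eta>' = (\<chi> j. if j = k then 0 else \<kappa> (\<sigma> j) * \<zeta> $ j)"
      have "D2f 0 *v frame \<zeta>' = (\<Sum>j\<in>UNIV - {k}. \<zeta> $ j *\<^sub>R (D2f 0 *v e (\<sigma> j)))"
        unfolding fr by (simp add: linear_sum[OF matrix_vector_mul_linear] matrix_vector_mult_scaleR)
      also have "\<dots> = (\<Sum>j\<in>UNIV - {k}. \<eta>' $ j *\<^sub>R e (\<sigma> j))"
        using eig \<sigma>_in by (intro sum.cong) (auto simp: \<eta>'_def mult.commute)
      also have "\<dots> = frame \<eta>'" unfolding frame_def by (simp add: \<eta>'_def)
      finally have "frame \<zeta>' \<bullet> (D2f 0 *v frame \<zeta>') = \<zeta>' \<bullet> \<eta>'" by (simp add: frame_inner)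
      also have "\<dots> = quad \<zeta>"
        unfolding quad_def inner_vec_def
        by (subst sum.remove[of UNIV k]) (auto simp: \<zeta>'_def \<eta>'_def power2_eq_square mult_ac intro!: sum.cong)
      finally show ?thesis .
    qed
    ultimately show ?thesis using d(2)[OF lt] n by simp
  qed
  thus ?thesis using d(1) by (intro exI[of _ "d\<^sup>2"]) auto
qed

lemma quad_upper: "\<exists>\<kappa>0. 0 \<le> \<kappa>0 \<and> \<kappa>0 < 1 / R \<and> (\<forall>\<zeta>. quad \<zeta> \<le> \<kappa>0 * tan2 \<zeta>)"
proof -
  define \<kappa>0 where "\<kappa>0 = Max (insert 0 (\<kappa> ` {1..CARD('n) - 1}))"
  have "0 \<le> \<kappa>0" unfolding \<kappa>0_def by (intro Max_ge) auto
  moreover have "\<kappa>0 < 1 / R" unfolding \<kappa>0_def using R curv by (subst Max_less_iff) auto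
  moreover have "\<kappa> j \<le> \<kappa>0" if "j \<in> {1..CARD('n) - 1}" for j
    unfolding \<kappa>0_def using that by (intro Max_ge) auto
  hence "quad \<zeta> \<le> \<kappa>0 * tan2 \<zeta>" for \<zeta>
    unfolding quad_def tan2_def sum_distrib_left using \<sigma>_in
    by (intro sum_mono mult_right_mono) auto
  ultimately show ?thesis by blast
qed

text \<open>This is where the condition \<open>\<kappa>\<^sub>j < 1 / R\<close> enters. In the ball the squared tangential
part is less than \<open>2 R\<close> times the normal coordinate \<open>s\<close>, so the graph rises to at most \<open>R max(0, \<kappa>\<^sub>j)\<close> times \<open>s\<close>, up to a small
error, and lies below the point by a fixed fraction of \<open>s\<close>.\<close>

lemma height_lower:
  "\<exists>c>0. \<exists>r>0. r < r0 \<and> (\<forall>z\<in>ball x R. norm (z - y0) < r \<longrightarrow> c * ((z - y0) \<bullet> \<nu>) \<le> height z)"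
proof -
  obtain \<kappa>0 where k0: "0 \<le> \<kappa>0" "\<kappa>0 < 1 / R" "\<And>\<zeta>. quad \<zeta> \<le> \<kappa>0 * tan2 \<zeta>" using quad_upper by blast
  have k0R: "\<kappa>0 * R < 1" using k0(2) R by (simp add: field_simps)
  define c where "c = (1 - \<kappa>0 * R) / 2"
  define \<eta> where "\<eta> = c / (2 * R)"
  have c: "c > 0" and \<eta>: "\<eta> > 0" using k0R R by (auto simp: c_def \<eta>_def)
  obtain r where r: "r > 0" "\<And>\<zeta>. tan2 \<zeta> < r \<Longrightarrow> \<bar>f (frame \<zeta>) - quad \<zeta> / 2\<bar> \<le> \<eta> * tan2 \<zeta>"
    using f_frame_expansion[OF \<eta>] by blast
  define r1 where "r1 = min (sqrt r) (r0 / 2)"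
  have "c * ((z - y0) \<bullet> \<nu>) \<le> height z" if z: "z \<in> ball x R" "norm (z - y0) < r1" for z
  proof -
    obtain \<zeta> where \<zeta>: "z - y0 = frame \<zeta>" using frame_surj by blast
    have s: "(z - y0) \<bullet> \<nu> = \<zeta> $ k" by (simp add: \<zeta> frame_normal)
    have n: "(norm (z - y0))\<^sup>2 = tan2 \<zeta> + (\<zeta> $ k)\<^sup>2" by (simp add: \<zeta> norm_tan2)
    have "norm (z - y0) < sqrt r" using z(2) by (simp add: r1_def)
    hence "(norm (z - y0))\<^sup>2 < (sqrt r)\<^sup>2" by (intro power_strict_mono) auto
    hence "tan2 \<zeta> < r" using n r(1) by (simp) (smt (verit) zero_le_power2)
    from r(2)[OF this] have "f (z - y0) \<le> quad \<zeta> / 2 + \<eta> * tan2 \<zeta>" unfolding \<zeta> by linarith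
    also have "\<dots> \<le> (\<kappa>0 / 2 + \<eta>) * tan2 \<zeta>" using k0(3)[of \<zeta>] by (simp add: algebra_simps)
    also have "\<dots> \<le> (\<kappa>0 / 2 + \<eta>) * (2 * R * \<zeta> $ k)"
    proof (intro mult_left_mono)
      have "tan2 \<zeta> + (\<zeta> $ k)\<^sup>2 < 2 * R * \<zeta> $ k" using in_ball_iff[THEN iffD1, OF z(1)] n s by simp
      thus "tan2 \<zeta> \<le> 2 * R * \<zeta> $ k" by (smt (verit) zero_le_power2)
    qed (use k0 \<eta> in auto)
    also have "\<dots> = (1 - c) * \<zeta> $ k" using R by (simp add: \<eta>_def c_def field_simps)
    finally show ?thesis unfolding height_def s by (simp add: algebra_simps)
  qed
  moreover have "r1 > 0" "r1 < r0" using r(1) r0 by (auto simp: r1_def)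
  ultimately show ?thesis using c by blast
qed

end

section \<open>The boundary layer near the contact point\<close>

locale touching_ball_solutions = touching_ball \<Omega> x y0 R p \<kappa> \<nu> f Df D2f e r0 k \<sigma>
  for \<Omega> :: "(real^'n) set" and x y0 R p \<kappa> \<nu> f Df D2f e r0 k \<sigma> +
  fixes u :: "real \<Rightarrow> real^'n \<Rightarrow> real"
  assumes sol: "\<And>\<epsilon>. \<epsilon> > 0 \<Longrightarrow> bounded_visc_solution_bdry1 p \<epsilon> \<Omega> (u \<epsilon>)"
begin

abbreviation "P \<equiv> conj_exponent p"

lemma P_pos: "P > 0" using inv_exponent_bounds[OF p] by simp

lemma u_range: "\<epsilon> > 0 \<Longrightarrow> y \<in> closure \<Omega> \<Longrightarrow> 0 \<le> u \<epsilon> y \<and> u \<epsilon> y \<le> 1"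
  using bounded_visc_solution_range[OF p op sol, of \<epsilon> y] by blast

lemma u_cont: "\<epsilon> > 0 \<Longrightarrow> continuous_on (closure \<Omega>) (u \<epsilon>)"
  by (rule bounded_visc_solution_continuous[OF sol op])

lemma u_frontier: "\<epsilon> > 0 \<Longrightarrow> y \<in> frontier \<Omega> \<Longrightarrow> u \<epsilon> y = 1"
  by (rule bounded_visc_solution_subsolutions(5)[OF sol])

lemma ball_closure: "ball x R \<subseteq> closure \<Omega>"
  using ball closure_subset by blast

lemma u_interior_decay:
  assumes "compact K" "K \<subseteq> \<Omega>"
  shows "\<exists>c>0. \<forall>\<epsilon> z. 0 < \<epsilon> \<longrightarrow> \<epsilon> \<le> 1 \<longrightarrow> z \<in> K \<longrightarrow> u \<epsilon> z \<le> exp (- c / \<epsilon>)"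
  using interior_exponential_decay[OF p op assms] sol by metis

text \<open>For \<open>s = 1\<close> this is the upper barrier for \<open>u\<close>, for \<open>s = -1\<close> the upper barrier for \<open>- u\<close>; this way both
estimates follow from comparison of a subsolution with a supersolution.\<close>

definition barrier :: "real \<Rightarrow> real \<Rightarrow> real \<Rightarrow> real \<Rightarrow> real^'n \<Rightarrow> real" where
  "barrier s \<delta> K \<epsilon> z
     = s * exp (- ((1 - s * \<delta>) * sqrt P) * (height z - s * K * (norm (z - y0))\<^sup>2) / \<epsilon>)"

text \<open>The gradient of the exponent is \<open>- \<mu> (\<nu> - v)\<close> with \<open>v\<close> small near the contact point, so its squared
length divided by \<open>p'\<close> is close to \<open>(1 - s \<delta>)\<^sup>2\<close>: below \<open>1\<close> for \<open>s = 1\<close> and above \<open>1\<close> for \<open>s = -1\<close>. The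
term with the Hessian of the exponent carries a factor \<open>\<epsilon>\<close>.\<close>

lemma local_barrier:
  assumes s: "s = 1 \<or> s = -1" and \<delta>: "0 < \<delta>" "\<delta> < 1" and K: "K > 0"
  shows "\<exists>r1>0. r1 < r0 \<and> (\<exists>\<epsilon>1>0. \<forall>r \<epsilon> C. 0 < r \<longrightarrow> r \<le> r1 \<longrightarrow> 0 < \<epsilon> \<longrightarrow> \<epsilon> < \<epsilon>1 \<longrightarrow> 0 \<le> C \<longrightarrow>
      (\<forall>z\<in>closure \<Omega>. norm (z - y0) \<le> r \<longrightarrow> z \<in> frontier \<Omega> \<or> norm (z - y0) = r \<longrightarrow>
         s * u \<epsilon> z \<le> barrier s \<delta> K \<epsilon> z + C) \<longrightarrow>
      (\<forall>z\<in>closure \<Omega>. norm (z - y0) \<le> r \<longrightarrow> s * u \<epsilon> z \<le> barrier s \<delta> K \<epsilon> z + C))"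
proof -
  define \<eta> where "\<eta> = \<delta> / 4"
  have \<eta>: "\<eta> > 0" using \<delta> by (simp add: \<eta>_def)
  have s1: "\<bar>s\<bar> = 1" using s by auto
  note ex = inv_exponent_bounds[OF p]
  have sd: "1 - s * \<delta> > 0" using s \<delta> by auto
  define \<mu> where "\<mu> = (1 - s * \<delta>) * sqrt P"
  have \<mu>: "\<mu> > 0" unfolding \<mu>_def using sd ex by (intro mult_pos_pos) auto
  have \<mu>2: "(1 - inv_exponent p) * \<mu>\<^sup>2 = (1 - s * \<delta>)\<^sup>2"
    using ex(3,4) by (simp add: \<mu>_def power_mult_distrib mult.left_commute)
  define m where "m = norm (mat 1 :: real^'n^'n)"
  define N where "N = real CARD('n)"
  have N: "N \<ge> 1" unfolding N_def using zero_less_card_finite[where 'a='n] by linarith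
  have m: "m \<ge> 0" by (simp add: m_def)
  have "isCont Df 0" using Df_deriv[of 0] r0 by (auto intro: has_derivative_continuous)
  then obtain r2 where r2: "r2 > 0" "\<And>h. norm h < r2 \<Longrightarrow> norm (Df h) < \<eta> / 2"
    using \<eta> Df0 unfolding continuous_at_eps_delta
    by (metis diff_zero dist_norm half_gt_zero)
  define r1 where "r1 = min (min (r0 / 2) (r2 / 2)) (\<eta> / (4 * K))"
  have r1: "r1 > 0" "r1 \<le> r0 / 2" "r1 < r2" "r1 \<le> \<eta> / (4 * K)"
    using r0 r2 \<eta> K by (auto simp: r1_def)
  have "compact (D2f ` cball 0 (r0/2))"
    using C2 r0 by (intro compact_continuous_image) (auto simp: C2_on_def intro: continuous_on_subset)
  then obtain M where M: "\<And>h. norm h \<le> r0 / 2 \<Longrightarrow> norm (D2f h) \<le> M"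
    using compact_imp_bounded by (force simp: bounded_iff)
  have M0: "M \<ge> 0" using M[of 0] r0 norm_ge_zero[of "D2f 0"] by (simp del: norm_ge_zero)
  define HM where "HM = \<mu> * (M + 2 * K * m)"
  have HM: "HM \<ge> 0" using M0 K m \<mu> by (simp add: HM_def)
  define \<theta> where "\<theta> = \<delta> / 4"
  define \<epsilon>1 where "\<epsilon>1 = \<theta> / (2 * N * HM + 1)"
  have \<epsilon>1: "\<epsilon>1 > 0" using \<delta> N HM by (simp add: \<epsilon>1_def \<theta>_def add_nonneg_pos)
  have main: "s * u \<epsilon> z \<le> barrier s \<delta> K \<epsilon> z + C"
    if r: "0 < r" "r \<le> r1" and \<epsilon>: "0 < \<epsilon>" "\<epsilon> < \<epsilon>1" and C: "0 \<le> C"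
      and bd: "\<And>z. z \<in> closure \<Omega> \<Longrightarrow> norm (z - y0) \<le> r \<Longrightarrow> z \<in> frontier \<Omega> \<or> norm (z - y0) = r \<Longrightarrow>
         s * u \<epsilon> z \<le> barrier s \<delta> K \<epsilon> z + C"
      and z: "z \<in> closure \<Omega>" "norm (z - y0) \<le> r"
    for r \<epsilon> C z
  proof -
    let ?w = "\<lambda>z. s * u \<epsilon> z"
    have sub: "visc_subsolution p \<epsilon> \<Omega> ?w" "bounded (?w ` \<Omega>)" "continuous_on (closure \<Omega>) ?w"
      using s bounded_visc_solution_subsolutions(1-4)[OF sol[OF \<epsilon>(1)]] u_cont[OF \<epsilon>(1)]
      by (auto intro: continuous_on_minus)
    define \<psi> where "\<psi> z = - \<mu> * (height z - s * K * ((z - y0) \<bullet> (z - y0)))" for z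
    define v where "v z = Df (z - y0) + (2 * s * K) *\<^sub>R (z - y0)" for z
    define D\<psi> where "D\<psi> z = (- \<mu>) *\<^sub>R (\<nu> - v z)" for z
    define H where "H z = \<mu> *\<^sub>R (D2f (z - y0) + (2 * s * K) *\<^sub>R mat 1)" for z
    have dist: "norm (z - y0) = dist y0 z" for z by (simp add: dist_norm norm_minus_commute)
    have g: "GDERIV \<psi> z :> D\<psi> z" if "norm (z - y0) < r0" for z
    proof -
      have d1: "((\<lambda>z. z - y0) has_derivative (\<lambda>h. h)) (at z)" by (auto intro!: derivative_eq_intros)
      have "((\<lambda>z. f (z - y0)) has_derivative (\<lambda>h. h \<bullet> Df (z - y0))) (at z)"
        using has_derivative_compose[OF d1 f_gderiv[OF that, unfolded gderiv_def]] .
      hence "((\<lambda>z. - \<mu> * (((z - y0) \<bullet> \<nu> - f (z - y0)) - s * K * ((z - y0) \<bullet> (z - y0)))) has_derivative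
         (\<lambda>h. - \<mu> * ((h \<bullet> \<nu> - h \<bullet> Df (z - y0)) - s * K * ((z - y0) \<bullet> h + h \<bullet> (z - y0))))) (at z)"
        by (intro has_derivative_mult_right has_derivative_diff has_derivative_inner_left d1
            has_derivative_inner)
      thus ?thesis unfolding gderiv_def \<psi>_def[abs_def] height_def
        by (rule has_derivative_eq_rhs)
           (simp add: fun_eq_iff D\<psi>_def v_def inner_diff_right inner_add_right inner_commute algebra_simps)
    qed
    have h: "(D\<psi> has_derivative (\<lambda>h. H z *v h)) (at z)" if "norm (z - y0) < r0" for z
    proof -
      have d1: "((\<lambda>z. z - y0) has_derivative (\<lambda>h. h)) (at z)" by (auto intro!: derivative_eq_intros)
      have "((\<lambda>z. Df (z - y0)) has_derivative (\<lambda>h. D2f (z - y0) *v h)) (at z)"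
        using has_derivative_compose[OF d1 Df_deriv[OF that]] .
      hence "((\<lambda>z. (- \<mu>) *\<^sub>R (\<nu> - (Df (z - y0) + (2 * s * K) *\<^sub>R (z - y0)))) has_derivative
         (\<lambda>h. (- \<mu>) *\<^sub>R (0 - (D2f (z - y0) *v h + (2 * s * K) *\<^sub>R h)))) (at z)"
        by (intro has_derivative_scaleR_right has_derivative_diff has_derivative_const has_derivative_add d1)
      thus ?thesis unfolding D\<psi>_def[abs_def] v_def
        by (rule has_derivative_eq_rhs)
           (simp add: fun_eq_iff H_def scaleR_matrix_vector_assoc[symmetric] matrix_vector_mult_add_rdistrib
             algebra_simps)
    qed
    define V where "V z = s * exp (\<psi> z / \<epsilon>) + C" for z
    define DV where "DV z = (s * exp (\<psi> z / \<epsilon>) / \<epsilon>) *\<^sub>R D\<psi> z" for z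
    define D2V where "D2V z = (s * exp (\<psi> z / \<epsilon>) / \<epsilon>) *\<^sub>R ((1/\<epsilon>) *\<^sub>R outer_prod (D\<psi> z) (D\<psi> z) + H z)" for z
    have Veq: "V z = barrier s \<delta> K \<epsilon> z + C" for z
      by (simp add: V_def \<psi>_def barrier_def \<mu>_def power2_norm_eq_inner)
    have strict: "DV z \<noteq> 0 \<and> V z + \<epsilon>\<^sup>2 * F_op p (DV z) (D2V z) > 0" if zr: "norm (z - y0) < r" for z
    proof -
      have zz: "norm (z - y0) < r2" "norm (z - y0) \<le> r0 / 2" "norm (z - y0) \<le> \<eta> / (4 * K)"
        using zr r r1 by auto
      have "norm (v z) \<le> norm (Df (z - y0)) + norm ((2 * s * K) *\<^sub>R (z - y0))"
        unfolding v_def by (rule norm_triangle_ineq)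
      moreover have "norm ((2 * s * K) *\<^sub>R (z - y0)) \<le> \<eta> / 2"
      proof -
        have "norm ((2 * s * K) *\<^sub>R (z - y0)) = 2 * K * norm (z - y0)"
          unfolding norm_scaleR using K s1 by (simp add: abs_mult)
        thus ?thesis using zz(3) K by (simp add: field_simps)
      qed
      ultimately have nv: "norm (v z) \<le> \<eta>" using r2(2)[OF zz(1)] by linarith
      define n where "n = norm (\<nu> - v z)"
      have n: "1 - \<eta> \<le> n" "n \<le> 1 + \<eta>"
        using nv norm_\<nu> norm_triangle_ineq4[of \<nu> "v z"] norm_triangle_ineq2[of \<nu> "v z"] by (auto simp: n_def)
      have n0: "n > 0" using n \<delta> by (simp add: \<eta>_def)
      \<comment> \<open>The factor \<open>n\<close> differs from \<open>1\<close> by at most \<open>\<delta> / 4\<close>, which does not use up the margin \<open>\<delta>\<close> in the exponent.\<close>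
      have \<theta>: "\<theta> \<le> s * (1 - (1 - s * \<delta>)\<^sup>2 * n\<^sup>2)"
        using s
      proof
        assume s: "s = 1"
        have "(1 - \<delta>) * n \<le> (1 - \<delta>) * (1 + \<eta>)" using n \<delta> by (intro mult_left_mono) auto
        also have "\<dots> \<le> 1 - \<theta>" using \<delta> by (simp add: \<eta>_def \<theta>_def algebra_simps)
        finally have a: "(1 - \<delta>) * n \<le> 1 - \<theta>" .
        have "((1 - \<delta>) * n)\<^sup>2 \<le> (1 - \<delta>) * n"
          using a n0 \<delta> by (simp add: power2_eq_square mult_left_le \<theta>_def)
        thus ?thesis using a s by (simp add: power_mult_distrib)
      next
        assume s: "s = -1"
        have "1 + \<theta> \<le> (1 + \<delta>) * (1 - \<eta>)"
        proof -
          have "\<delta> * \<delta> \<le> \<delta> * 1" using \<delta> by (intro mult_left_mono) auto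
          moreover have "(1 + \<delta>) * (1 - \<delta> / 4) = 1 + 3 * \<delta> / 4 - \<delta> * \<delta> / 4"
            by (simp add: field_simps)
          ultimately show ?thesis using \<delta> unfolding \<eta>_def \<theta>_def by linarith
        qed
        also have "\<dots> \<le> (1 + \<delta>) * n" using n \<delta> by (intro mult_left_mono) auto
        finally have a: "1 + \<theta> \<le> (1 + \<delta>) * n" .
        have "(1 + \<delta>) * n * 1 \<le> (1 + \<delta>) * n * ((1 + \<delta>) * n)"
          using a n0 \<delta> by (intro mult_left_mono) (auto simp: \<theta>_def)
        hence "(1 + \<delta>) * n \<le> ((1 + \<delta>) * n)\<^sup>2" by (simp add: power2_eq_square)
        thus ?thesis using a s by (simp add: power_mult_distrib)
      qed
      have b: "D\<psi> z \<noteq> 0" using n0 \<mu> by (auto simp: D\<psi>_def n_def)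
      have nb: "(1 - inv_exponent p) * (norm (D\<psi> z))\<^sup>2 = (1 - s * \<delta>)\<^sup>2 * n\<^sup>2"
        using \<mu>2 \<mu> by (simp add: D\<psi>_def n_def power_mult_distrib mult.assoc[symmetric])
      have "norm (H z) \<le> HM"
      proof -
        have "norm (D2f (z - y0) + (2 * s * K) *\<^sub>R mat 1) \<le> norm (D2f (z - y0)) + norm ((2 * s * K) *\<^sub>R (mat 1 :: real^'n^'n))"
          by (rule norm_triangle_ineq)
        also have "\<dots> \<le> M + 2 * K * m" using M[OF zz(2)] s1 K by (simp add: m_def abs_mult)
        finally show ?thesis using \<mu> by (simp add: H_def HM_def mult_left_mono)
      qed
      hence "2 * N * norm (H z) \<le> 2 * N * HM" using N by (intro mult_left_mono) auto
      hence F: "\<bar>F_op p (D\<psi> z) (H z)\<bar> \<le> 2 * N * HM"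
        using F_op_bound[OF p, of "D\<psi> z" "H z"] unfolding N_def by linarith
      have "\<bar>\<epsilon> * F_op p (D\<psi> z) (H z)\<bar> < \<theta>"
      proof -
        have "\<bar>\<epsilon> * F_op p (D\<psi> z) (H z)\<bar> \<le> \<epsilon> * (2 * N * HM)"
          using F \<epsilon> by (simp add: abs_mult mult_left_mono)
        also have "\<dots> \<le> \<epsilon> * (2 * N * HM + 1)" using \<epsilon> by (intro mult_left_mono) auto
        also have "\<dots> < \<epsilon>1 * (2 * N * HM + 1)"
          using \<epsilon> N HM by (intro mult_strict_right_mono) (auto simp: add_nonneg_pos)
        also have "\<dots> = \<theta>" using N HM unfolding \<epsilon>1_def by (simp add: add_nonneg_eq_0_iff)
        finally show ?thesis .
      qed
      hence "\<bar>s * (\<epsilon> * F_op p (D\<psi> z) (H z))\<bar> < \<theta>" using s1 by (simp add: abs_mult)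
      hence pos: "s * (1 - (1 - s * \<delta>)\<^sup>2 * n\<^sup>2) + s * (\<epsilon> * F_op p (D\<psi> z) (H z)) > 0" using \<theta> by linarith
      have "V z + \<epsilon>\<^sup>2 * F_op p (DV z) (D2V z)
        = C + exp (\<psi> z / \<epsilon>) * (s * (1 - (1 - s * \<delta>)\<^sup>2 * n\<^sup>2) + s * (\<epsilon> * F_op p (D\<psi> z) (H z)))"
      proof -
        have "s * exp (\<psi> z / \<epsilon>) \<noteq> 0" using s1 by auto
        from F_op_exp_barrier[OF b this \<epsilon>(1), of p "H z", unfolded nb] show ?thesis
          unfolding V_def DV_def D2V_def by (simp only: algebra_simps)
      qed
      moreover have "0 < exp (\<psi> z / \<epsilon>) * (s * (1 - (1 - s * \<delta>)\<^sup>2 * n\<^sup>2) + s * (\<epsilon> * F_op p (D\<psi> z) (H z)))"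
        using pos by (intro mult_pos_pos) auto
      ultimately show ?thesis using C b \<epsilon> s1 by (auto simp: DV_def)
    qed
    have cl: "closure \<Omega> = \<Omega> \<union> frontier \<Omega>"
      using closure_subset by (auto simp: frontier_def interior_open[OF op])
    have rr0: "r < r0" using r r1 r0 by linarith
    have "?w z \<le> V z"
    proof (rule visc_barrier[OF p sub(1,2), of "closure \<Omega> \<inter> cball y0 r" V "\<Omega> \<inter> ball y0 r" DV D2V])
      show "compact (closure \<Omega> \<inter> cball y0 r)" by (intro closed_Int_compact) auto
      show "continuous_on (closure \<Omega> \<inter> cball y0 r) ?w" by (rule continuous_on_subset[OF sub(3)]) auto
      have "continuous_on (closure \<Omega> \<inter> cball y0 r) height"
        using rr0 by (intro continuous_on_subset[OF height_cont]) auto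
      thus "continuous_on (closure \<Omega> \<inter> cball y0 r) V"
        unfolding V_def \<psi>_def using \<epsilon> by (intro continuous_intros) auto
      show "open (\<Omega> \<inter> ball y0 r)" using op by auto
      show "\<Omega> \<inter> ball y0 r \<subseteq> closure \<Omega> \<inter> cball y0 r" using closure_subset by force
      fix y assume y: "y \<in> closure \<Omega> \<inter> cball y0 r - \<Omega> \<inter> ball y0 r"
      show "?w y \<le> V y" unfolding Veq
        using y cl by (intro bd) (auto simp: dist)
    next
      fix y assume y: "y \<in> \<Omega> \<inter> ball y0 r"
      hence y': "norm (y - y0) < r" "norm (y - y0) < r0" using rr0 by (auto simp: dist)
      show "GDERIV V y :> DV y" unfolding V_def[abs_def] DV_def
        by (rule exp_barrier_derivatives(1)[where \<psi>=\<psi> and D\<psi>=D\<psi>, OF g[OF y'(2)] \<epsilon>(1)])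
      show "(DV has_derivative (\<lambda>h. D2V y *v h)) (at y)" unfolding DV_def[abs_def] D2V_def
        by (rule exp_barrier_derivatives(2)[where \<psi>=\<psi> and D\<psi>=D\<psi>, OF g[OF y'(2)] \<epsilon>(1) h[OF y'(2)]])
      show "\<epsilon>\<^sup>2 * (2 * real CARD('n) * norm (D2V y)) < V y \<or>
          (DV y \<noteq> 0 \<and> V y + \<epsilon>\<^sup>2 * F_op p (DV y) (D2V y) > 0)" using strict[OF y'(1)] by blast
    qed (use z in \<open>auto simp: dist\<close>)
    thus ?thesis unfolding Veq .
  qed
  show ?thesis
  proof (rule exI[of _ r1], intro conjI, rule r1(1))
    show "r1 < r0" using r1(2) r0 by linarith
    show "\<exists>\<epsilon>1>0. \<forall>r \<epsilon> C. 0 < r \<longrightarrow> r \<le> r1 \<longrightarrow> 0 < \<epsilon> \<longrightarrow> \<epsilon> < \<epsilon>1 \<longrightarrow> 0 \<le> C \<longrightarrow>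
      (\<forall>z\<in>closure \<Omega>. norm (z - y0) \<le> r \<longrightarrow> z \<in> frontier \<Omega> \<or> norm (z - y0) = r \<longrightarrow>
         s * u \<epsilon> z \<le> barrier s \<delta> K \<epsilon> z + C) \<longrightarrow>
      (\<forall>z\<in>closure \<Omega>. norm (z - y0) \<le> r \<longrightarrow> s * u \<epsilon> z \<le> barrier s \<delta> K \<epsilon> z + C)"
      by (rule exI[of _ \<epsilon>1]) (use \<epsilon>1 main in blast)
  qed
qed

text \<open>Comparison takes place in the part of \<open>\<Omega>\<close> in a small ball around the contact point. On the boundary of \<open>\<Omega>\<close> the barrier is at least \<open>s\<close> thanks to the sign of
the quadratic term. On the spherical part, for \<open>s = 1\<close>, either the height is below \<open>K r\<^sup>2\<close> and the barrier is at least \<open>1\<close>, or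
the point lies in a compact part of \<open>\<Omega>\<close>, where \<open>u\<close> is exponentially small; for \<open>s = -1\<close> the barrier itself is
exponentially small there. Inside the ball the quadratic term is at most \<open>\<delta>\<close> times the height, by the choice of \<open>K\<close>, and turns
one factor \<open>1 - s \<delta>\<close> into two.\<close>

lemma pointwise_estimate:
  assumes s: "s = 1 \<or> s = -1" and \<delta>: "0 < \<delta>" "\<delta> < 1"
  obtains r c \<epsilon>1 where "r > 0" "c > 0" "\<epsilon>1 > 0"
    "\<And>\<epsilon> z. 0 < \<epsilon> \<Longrightarrow> \<epsilon> < \<epsilon>1 \<Longrightarrow> z \<in> ball x R \<Longrightarrow> norm (z - y0) \<le> r \<Longrightarrow>
       s * u \<epsilon> z \<le> s * exp (- ((1 - s * \<delta>)\<^sup>2 * sqrt P * height z) / \<epsilon>) + exp (- c / \<epsilon>)"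
proof -
  obtain c' rh where h: "c' > 0" "rh > 0" "rh < r0"
    "\<And>z. z \<in> ball x R \<Longrightarrow> norm (z - y0) < rh \<Longrightarrow> c' * ((z - y0) \<bullet> \<nu>) \<le> height z"
    using height_lower by blast
  define K where "K = \<delta> * c' / (2 * R)"
  have K: "K > 0" using \<delta> h R by (simp add: K_def)
  define \<mu> where "\<mu> = (1 - s * \<delta>) * sqrt P"
  have \<mu>: "\<mu> > 0" unfolding \<mu>_def using \<delta> s P_pos by (intro mult_pos_pos) auto
  obtain r1 \<epsilon>1 where b: "r1 > 0" "r1 < r0" "\<epsilon>1 > 0"
    and B: "\<forall>r \<epsilon> C. 0 < r \<longrightarrow> r \<le> r1 \<longrightarrow> 0 < \<epsilon> \<longrightarrow> \<epsilon> < \<epsilon>1 \<longrightarrow> 0 \<le> C \<longrightarrow>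
      (\<forall>z\<in>closure \<Omega>. norm (z - y0) \<le> r \<longrightarrow> z \<in> frontier \<Omega> \<or> norm (z - y0) = r \<longrightarrow>
         s * u \<epsilon> z \<le> barrier s \<delta> K \<epsilon> z + C) \<longrightarrow>
      (\<forall>z\<in>closure \<Omega>. norm (z - y0) \<le> r \<longrightarrow> s * u \<epsilon> z \<le> barrier s \<delta> K \<epsilon> z + C)"
    using local_barrier[OF s \<delta> K] by (elim exE conjE) (rule that)
  define r where "r = min r1 (rh / 2)"
  have r: "r > 0" "r \<le> r1" "r < rh" "r < r0" using b h by (auto simp: r_def)
  define Q where "Q = {z \<in> sphere y0 r. K * r\<^sup>2 \<le> height z}"
  have sph: "sphere y0 r \<subseteq> ball y0 r0" using r by auto
  have "compact Q"
  proof -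
    have Q: "Q = sphere y0 r \<inter> height -` {K * r\<^sup>2..}" by (auto simp: Q_def)
    have "closed Q" unfolding Q
      by (intro continuous_closed_preimage continuous_on_subset[OF height_cont sph]) auto
    moreover have "bounded Q" unfolding Q by (rule bounded_subset[OF bounded_sphere]) auto
    ultimately show ?thesis by (simp add: compact_eq_bounded_closed)
  qed
  moreover have "Q \<subseteq> \<Omega>"
  proof
    fix z assume z: "z \<in> Q"
    have "0 < K * r\<^sup>2" using K r by simp
    hence "height z > 0" "z \<in> ball y0 r0" using z sph unfolding Q_def by fastforce+
    thus "z \<in> \<Omega>" using height_pos by blast
  qed
  ultimately obtain c1 where c1: "c1 > 0"
    "\<And>\<epsilon> z. 0 < \<epsilon> \<Longrightarrow> \<epsilon> \<le> 1 \<Longrightarrow> z \<in> Q \<Longrightarrow> u \<epsilon> z \<le> exp (- c1 / \<epsilon>)"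
    using u_interior_decay[of Q] by blast
  define c where "c = min c1 (\<mu> * (K * r\<^sup>2))"
  have c: "c > 0" "c \<le> c1" "c \<le> \<mu> * (K * r\<^sup>2)" using c1 \<mu> K r by (auto simp: c_def)
  have "s * u \<epsilon> z \<le> s * exp (- ((1 - s * \<delta>)\<^sup>2 * sqrt P * height z) / \<epsilon>) + exp (- c / \<epsilon>)"
    if \<epsilon>: "0 < \<epsilon>" "\<epsilon> < min \<epsilon>1 1" and z: "z \<in> ball x R" "norm (z - y0) \<le> r" for \<epsilon> z
  proof -
    have mono: "exp (- a / \<epsilon>) \<le> exp (- a' / \<epsilon>)" if "a' \<le> a" for a a' :: real
      using that \<epsilon> by (simp add: divide_right_mono)
    have "s * u \<epsilon> z \<le> barrier s \<delta> K \<epsilon> z + exp (- c / \<epsilon>)"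
    proof (rule B[rule_format, OF r(1,2) \<epsilon>(1) _ _ _ _ z(2)])
      show "z \<in> closure \<Omega>" using z(1) ball_closure by blast
      fix y assume y: "y \<in> closure \<Omega>" "norm (y - y0) \<le> r" "y \<in> frontier \<Omega> \<or> norm (y - y0) = r"
      have u01: "0 \<le> u \<epsilon> y" "u \<epsilon> y \<le> 1" using u_range[OF \<epsilon>(1) y(1)] by auto
      have yb: "y \<in> ball y0 r0" using y r by (simp add: dist_norm norm_minus_commute)
      define t where "t = \<mu> * (height y - s * K * (norm (y - y0))\<^sup>2)"
      define E E' where "E = exp (- t / \<epsilon>)" and "E' = exp (- c / \<epsilon>)"
      have nn: "E \<ge> 0" "E' \<ge> 0" by (auto simp: E_def E'_def)
      have bar: "barrier s \<delta> K \<epsilon> y = s * E" by (simp add: barrier_def t_def E_def \<mu>_def)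
      have hf: "height y = 0" if "y \<in> frontier \<Omega>" using height_frontier[OF yb that] .
      have "s * u \<epsilon> y \<le> s * E + E'"
        using s
      proof
        assume s: "s = 1"
        show ?thesis
        proof (cases "y \<in> Q")
          case True
          have "u \<epsilon> y \<le> exp (- c1 / \<epsilon>)" using c1(2)[OF \<epsilon>(1) _ True] \<epsilon> by simp
          also have "\<dots> \<le> E'" unfolding E'_def by (rule mono[OF c(2)])
          finally show ?thesis using s nn by simp
        next
          case False
          have "height y \<le> K * (norm (y - y0))\<^sup>2"
            using y(3) hf K False by (auto simp: Q_def dist_norm norm_minus_commute)
          hence "t \<le> 0" using \<mu> s by (simp add: t_def mult_le_0_iff)
          hence "1 \<le> E" using mono[of t 0] by (simp add: E_def)
          thus ?thesis using s u01 nn by simp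
        qed
      next
        assume s: "s = -1"
        have hy: "height y \<ge> 0" using height_nonneg[OF yb y(1)] .
        show ?thesis
        proof (cases "y \<in> frontier \<Omega>")
          case True
          have "0 \<le> t" using \<mu> K hy s by (simp add: t_def)
          hence "E \<le> 1" using mono[of 0 t] by (simp add: E_def)
          thus ?thesis using s u_frontier[OF \<epsilon>(1) True] nn by simp
        next
          case False
          hence nr: "norm (y - y0) = r" using y(3) by simp
          have "\<mu> * (K * r\<^sup>2) \<le> t" unfolding t_def nr using \<mu> hy s by (intro mult_left_mono) auto
          hence "E \<le> E'" unfolding E_def E'_def using c(3) by (intro mono) linarith
          thus ?thesis using s u01 by simp
        qed
      qed
      thus "s * u \<epsilon> y \<le> barrier s \<delta> K \<epsilon> y + exp (- c / \<epsilon>)" unfolding bar E'_def .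
    qed (use \<epsilon> in auto)
    also have "barrier s \<delta> K \<epsilon> z \<le> s * exp (- ((1 - s * \<delta>)\<^sup>2 * sqrt P * height z) / \<epsilon>)"
    proof -
      define n where "n = (norm (z - y0))\<^sup>2"
      have "n \<le> 2 * R * ((z - y0) \<bullet> \<nu>)" using in_ball_iff[THEN iffD1, OF z(1)] by (simp add: n_def)
      hence "K * n \<le> K * (2 * R * ((z - y0) \<bullet> \<nu>))" using K by (intro mult_left_mono) auto
      also have "\<dots> = \<delta> * (c' * ((z - y0) \<bullet> \<nu>))" using R by (simp add: K_def)
      also have "\<dots> \<le> \<delta> * height z" using h(4)[OF z(1)] z(2) r \<delta> by simp
      finally have n: "\<mu> * (K * n) \<le> \<mu> * (\<delta> * height z)" using \<mu> by simp
      have e: "(1 - s * \<delta>)\<^sup>2 * sqrt P * height z = \<mu> * height z - s * (\<mu> * (\<delta> * height z))"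
        by (simp add: \<mu>_def power2_eq_square algebra_simps)
      have f: "barrier s \<delta> K \<epsilon> z = s * exp (- (\<mu> * height z - s * (\<mu> * (K * n))) / \<epsilon>)"
        by (simp add: barrier_def n_def \<mu>_def algebra_simps)
      show ?thesis using s
      proof
        assume s: "s = 1"
        hence "exp (- (\<mu> * height z - s * (\<mu> * (K * n))) / \<epsilon>) \<le> exp (- (\<mu> * height z - s * (\<mu> * (\<delta> * height z))) / \<epsilon>)"
          using n by (intro mono) simp
        thus ?thesis unfolding e f using s by simp
      next
        assume s: "s = -1"
        hence "exp (- (\<mu> * height z - s * (\<mu> * (\<delta> * height z))) / \<epsilon>) \<le> exp (- (\<mu> * height z - s * (\<mu> * (K * n))) / \<epsilon>)"
          using n by (intro mono) simp
        thus ?thesis unfolding e f using s by simp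
      qed
    qed
    finally show ?thesis by simp
  qed
  with r c b show ?thesis by (intro that[of r c "min \<epsilon>1 1"]) auto
qed

text \<open>A bound on the whole ball that is integrable after zooming in. Away from the contact point the exponentially small
constant is rewritten in this form, as the normal coordinate is at most \<open>2 R\<close> in the ball.\<close>

lemma uniform_upper:
  obtains c \<epsilon>1 where "c > 0" "\<epsilon>1 > 0"
    "\<And>\<epsilon> z. 0 < \<epsilon> \<Longrightarrow> \<epsilon> < \<epsilon>1 \<Longrightarrow> z \<in> ball x R \<Longrightarrow> u \<epsilon> z \<le> 2 * exp (- (c * ((z - y0) \<bullet> \<nu>)) / \<epsilon>)"
proof -
  obtain c' rh where h: "c' > 0" "rh > 0" "rh < r0"
    "\<And>z. z \<in> ball x R \<Longrightarrow> norm (z - y0) < rh \<Longrightarrow> c' * ((z - y0) \<bullet> \<nu>) \<le> height z"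
    using height_lower by blast
  obtain r1 c1 \<epsilon>1 where a: "r1 > 0" "c1 > 0" "\<epsilon>1 > 0"
    "\<And>\<epsilon> z. 0 < \<epsilon> \<Longrightarrow> \<epsilon> < \<epsilon>1 \<Longrightarrow> z \<in> ball x R \<Longrightarrow> norm (z - y0) \<le> r1 \<Longrightarrow>
     1 * u \<epsilon> z \<le> 1 * exp (- ((1 - 1 * (1/2))\<^sup>2 * sqrt P * height z) / \<epsilon>) + exp (- c1 / \<epsilon>)"
    by (rule pointwise_estimate[of 1 "1/2"]) auto
  define r where "r = min r1 (rh / 2)"
  have r: "r > 0" "r \<le> r1" "r < rh" using a h by (auto simp: r_def)
  define Q where "Q = cball x R - ball y0 r"
  have "compact Q" unfolding Q_def by (intro compact_diff) auto
  moreover have "Q \<subseteq> \<Omega>"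
  proof
    fix z assume z: "z \<in> Q"
    hence "z \<noteq> y0" "z \<in> closure (ball x R)" using r R by (auto simp: Q_def)
    thus "z \<in> \<Omega>" using contact by auto
  qed
  ultimately obtain c2 where c2: "c2 > 0"
    "\<And>\<epsilon> z. 0 < \<epsilon> \<Longrightarrow> \<epsilon> \<le> 1 \<Longrightarrow> z \<in> Q \<Longrightarrow> u \<epsilon> z \<le> exp (- c2 / \<epsilon>)"
    using u_interior_decay[of Q] by blast
  have sP: "sqrt P > 0" using inv_exponent_bounds[OF p] by simp
  define c where "c = min (sqrt P / 4 * c') (min (c1 / (2 * R)) (c2 / (2 * R)))"
  have c: "c > 0" using sP h a c2 R by (simp add: c_def)
  have cc: "c \<le> sqrt P / 4 * c'" "2 * R * c \<le> c1" "2 * R * c \<le> c2"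
  proof -
    have "c \<le> c1 / (2 * R)" "c \<le> c2 / (2 * R)" by (auto simp: c_def)
    thus "2 * R * c \<le> c1" "2 * R * c \<le> c2" using R by (auto simp: field_simps)
  qed (simp add: c_def)
  have "u \<epsilon> z \<le> 2 * exp (- (c * ((z - y0) \<bullet> \<nu>)) / \<epsilon>)"
    if \<epsilon>: "0 < \<epsilon>" "\<epsilon> < min \<epsilon>1 1" and z: "z \<in> ball x R" for \<epsilon> z
  proof -
    define s where "s = (z - y0) \<bullet> \<nu>"
    have b: "(norm (z - y0))\<^sup>2 < 2 * R * s" using in_ball_iff z by (simp add: s_def)
    have s0: "s \<ge> 0"
    proof -
      have "0 \<le> (norm (z - y0))\<^sup>2" by simp
      hence "0 < 2 * R * s" using b by linarith
      thus ?thesis using R by (simp add: zero_less_mult_iff)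
    qed
    have s2: "s \<le> 2 * R"
    proof -
      have "s \<le> norm (z - y0)" using Cauchy_Schwarz_ineq2[of "z - y0" \<nu>] norm_\<nu> by (simp add: s_def)
      also have "\<dots> \<le> norm (z - x) + norm (x - y0)" using norm_triangle_ineq[of "z - x" "x - y0"] by simp
      also have "\<dots> \<le> 2 * R" using z norm_x_y0 by (simp add: dist_norm norm_minus_commute)
      finally show ?thesis .
    qed
    have far: "exp (- d / \<epsilon>) \<le> exp (- (c * s) / \<epsilon>)" if "2 * R * c \<le> d" for d
    proof -
      have "c * s \<le> c * (2 * R)" using c s2 by (intro mult_left_mono) auto
      hence "- d / \<epsilon> \<le> - (c * s) / \<epsilon>" using that \<epsilon> by (intro divide_right_mono) (auto simp: mult_ac)
      thus ?thesis by simp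
    qed
    show ?thesis
    proof (cases "norm (z - y0) < r")
      case True
      have "(sqrt P / 4 * c') * s \<le> sqrt P / 4 * height z"
        using h(4)[OF z] True r sP by (simp add: s_def mult.assoc)
      moreover have "c * s \<le> (sqrt P / 4 * c') * s" using cc(1) s0 by (intro mult_right_mono)
      ultimately have "c * s \<le> (1 - 1 * (1/2))\<^sup>2 * sqrt P * height z" by (simp add: power2_eq_square)
      hence "- ((1 - 1 * (1/2))\<^sup>2 * sqrt P * height z) / \<epsilon> \<le> - (c * s) / \<epsilon>"
        using \<epsilon> by (intro divide_right_mono) auto
      hence "exp (- ((1 - 1 * (1/2))\<^sup>2 * sqrt P * height z) / \<epsilon>) \<le> exp (- (c * s) / \<epsilon>)" by simp
      moreover have "u \<epsilon> z \<le> exp (- ((1 - 1 * (1/2))\<^sup>2 * sqrt P * height z) / \<epsilon>) + exp (- c1 / \<epsilon>)"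
        using a(4)[of \<epsilon> z] True r \<epsilon> z by simp
      ultimately show ?thesis using far[OF cc(2)] unfolding s_def by linarith
    next
      case False
      hence "z \<in> Q" using z by (auto simp: Q_def dist_norm norm_minus_commute)
      from c2(2)[OF \<epsilon>(1) _ this] \<epsilon> have "u \<epsilon> z \<le> exp (- c2 / \<epsilon>)" by simp
      thus ?thesis using far[OF cc(3)] exp_ge_zero[of "- (c * s) / \<epsilon>"] unfolding s_def by linarith
    qed
  qed
  with c a show ?thesis by (intro that[of c "min \<epsilon>1 1"]) auto
qed

end

section \<open>Characterization of the q-mean\<close>

text \<open>The function \<open>sgn t \<bar>t\<bar>\<^sup>m\<close>. Splitting it into its positive and negative part makes continuity evident and separates
the two contributions whose balance determines the mean.\<close>

definition signed_powr :: "real \<Rightarrow> real \<Rightarrow> real" where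
  "signed_powr m t = max t 0 powr m - max (- t) 0 powr m"

lemma signed_powr_pos: "t > 0 \<Longrightarrow> signed_powr m t = t powr m"
  and signed_powr_neg: "t < 0 \<Longrightarrow> signed_powr m t = - ((- t) powr m)"
  and signed_powr_0 [simp]: "signed_powr m 0 = 0"
  by (auto simp: signed_powr_def max_def)

lemma continuous_signed_powr [continuous_intros]:
  "m > 0 \<Longrightarrow> continuous_on S g \<Longrightarrow> continuous_on S (\<lambda>y. signed_powr m (g y))"
  unfolding signed_powr_def by (intro continuous_intros continuous_on_powr') auto

lemma signed_powr_mono: "m > 0 \<Longrightarrow> s \<le> t \<Longrightarrow> signed_powr m s \<le> signed_powr m t"
  unfolding signed_powr_def by (intro diff_mono powr_mono2) auto

lemma abs_signed_powr_le: "m > 0 \<Longrightarrow> \<bar>t\<bar> \<le> M \<Longrightarrow> \<bar>signed_powr m t\<bar> \<le> M powr m"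
  by (cases "t > 0"; cases "t < 0") (auto simp: signed_powr_pos signed_powr_neg intro!: powr_mono2)

lemma powr_tangent_pos:
  fixes q s t :: real
  assumes q: "q > 1" and t: "t > 0" and ne: "s \<noteq> t"
  shows "t powr q + q * t powr (q - 1) * (s - t) < \<bar>s\<bar> powr q"
proof (cases "s \<le> 0")
  case True
  have tq: "t powr (q - 1) * t = t powr q" using t by (simp add: powr_diff)
  have "q * t powr (q - 1) * s \<le> 0" using True q by (intro mult_nonneg_nonpos) auto
  moreover have "t powr q > 0" using t by simp
  hence "(q - 1) * t powr q > 0" using q by simp
  ultimately have "t powr q + q * t powr (q - 1) * (s - t) < 0"
    using tq by (simp add: algebra_simps)
  thus ?thesis by (meson less_le_trans powr_ge_zero)
next
  case False
  hence s: "s > 0" by simp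
  have der: "((\<lambda>x. x powr q) has_real_derivative q * x powr (q - 1)) (at x)" if "x > 0" for x
    using that by (auto intro!: derivative_eq_intros)
  have strict: "x powr (q - 1) < y powr (q - 1)" if "0 < x" "x < y" for x y :: real
    using that q by (intro powr_less_mono2) auto
  show ?thesis
  proof (cases "t < s")
    case True
    obtain z where z: "t < z" "z < s" "s powr q - t powr q = (s - t) * (q * z powr (q - 1))"
      using MVT2[OF True, of "\<lambda>x. x powr q" "\<lambda>x. q * x powr (q - 1)"] der t by auto
    have "(s - t) * (q * t powr (q - 1)) < (s - t) * (q * z powr (q - 1))"
      using True q strict[OF t z(1)] by (intro mult_strict_left_mono) auto
    thus ?thesis using z(3) s by (simp add: algebra_simps)
  next
    case False
    hence lt: "s < t" using ne by simp
    obtain z where z: "s < z" "z < t" "t powr q - s powr q = (t - s) * (q * z powr (q - 1))"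
      using MVT2[OF lt, of "\<lambda>x. x powr q" "\<lambda>x. q * x powr (q - 1)"] der s by auto
    have "(t - s) * (q * z powr (q - 1)) < (t - s) * (q * t powr (q - 1))"
      using lt q s z by (intro mult_strict_left_mono strict) auto
    thus ?thesis using z(3) s by (simp add: algebra_simps)
  qed
qed

text \<open>Strict convexity of \<open>\<bar>t\<bar>\<^sup>q\<close> in the form of the tangent line inequality, which can be integrated over
the ball; this takes the place of differentiating the norm.\<close>

lemma powr_tangent:
  fixes q s t :: real
  assumes q: "q > 1" and ne: "s \<noteq> t"
  shows "\<bar>t\<bar> powr q + q * signed_powr (q - 1) t * (s - t) < \<bar>s\<bar> powr q"
proof -
  consider "t = 0" | "t > 0" | "t < 0" by linarith
  thus ?thesis
  proof cases
    case 2 thus ?thesis using powr_tangent_pos[OF q 2 ne] by (simp add: signed_powr_pos)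
  next
    case 3 thus ?thesis using powr_tangent_pos[of q "- t" "- s"] q ne
      by (simp add: signed_powr_neg algebra_simps)
  qed (use ne in simp)
qed

lemma ball_indicator_measurable:
  fixes g :: "real^'n \<Rightarrow> real"
  assumes c: "continuous_on (ball x R) g"
  shows "(\<lambda>y. indicator (ball x R) y *\<^sub>R g y) \<in> borel_measurable borel"
  using c by (intro borel_measurable_continuous_on_indicator) auto

lemma ball_set_integrable:
  fixes g :: "real^'n \<Rightarrow> real"
  assumes c: "continuous_on (ball x R) g" and b: "\<And>y. y \<in> ball x R \<Longrightarrow> \<bar>g y\<bar> \<le> M"
  shows "set_integrable lborel (ball x R) g"
proof -
  have "integrable lborel (\<lambda>y. indicator (ball x R) y *\<^sub>R (indicator (ball x R) y *\<^sub>R g y))"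
  proof (rule integrableI_bounded_set_indicator[of _ _ _ M])
    show "(\<lambda>y. indicator (ball x R) y *\<^sub>R g y) \<in> borel_measurable lborel"
      using ball_indicator_measurable[OF c] by simp
    show "emeasure lborel (ball x R) < \<infinity>" by (rule emeasure_lborel_ball_finite)
  qed (use b in \<open>auto simp: indicator_def\<close>)
  moreover have "(\<lambda>y. indicator (ball x R) y *\<^sub>R (indicator (ball x R) y *\<^sub>R g y)) = (\<lambda>y. indicator (ball x R) y *\<^sub>R g y)"
    by (auto simp: indicator_def)
  ultimately show ?thesis unfolding set_integrable_def by (simp only:)
qed

text \<open>Strict inequality survives integration because balls have positive measure; this gives uniqueness of the mean.\<close>

lemma set_integral_ball_pos:
  fixes g :: "real^'n \<Rightarrow> real"
  assumes R: "R > 0" and i: "set_integrable lborel (ball x R) g" and p: "\<And>y. y \<in> ball x R \<Longrightarrow> g y > 0"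
  shows "(LINT y:ball x R|lborel. g y) > 0"
proof (rule ccontr)
  assume n: "\<not> ?thesis"
  have nn: "0 \<le> indicator (ball x R) y *\<^sub>R g y" for y using p by (auto simp: indicator_def less_imp_le)
  have "(LINT y:ball x R|lborel. g y) \<ge> 0"
    unfolding set_lebesgue_integral_def using nn by (intro integral_nonneg_AE) auto
  hence "(LINT y|lborel. indicator (ball x R) y *\<^sub>R g y) = 0"
    using n by (simp add: set_lebesgue_integral_def)
  hence "AE y in lborel. indicator (ball x R) y *\<^sub>R g y = 0"
    using nn i unfolding set_integrable_def by (subst (asm) integral_nonneg_eq_0_iff_AE) auto
  hence "AE y in lborel. y \<notin> ball x R"
  proof eventually_elim
    case (elim y) thus ?case using p[of y] by (auto simp: indicator_def)
  qed
  hence "emeasure lborel (ball x R) = 0"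
    by (subst (asm) AE_iff_null_sets[symmetric]) auto
  moreover have "measure lborel (ball x R) > 0" using R by simp
  ultimately show False by (simp add: measure_def)
qed

definition mean_gap :: "real \<Rightarrow> (real^'n) set \<Rightarrow> (real^'n \<Rightarrow> real) \<Rightarrow> real \<Rightarrow> real" where
  "mean_gap m B v c = (LINT y:B|lborel. signed_powr m (v y - c))"

lemma mean_gap_integrable:
  fixes v :: "real^'n \<Rightarrow> real"
  assumes "m > 0" "continuous_on (ball x R) v" "\<And>y. y \<in> ball x R \<Longrightarrow> 0 \<le> v y \<and> v y \<le> 1"
  shows "set_integrable lborel (ball x R) (\<lambda>y. signed_powr m (v y - c))"
proof (rule ball_set_integrable)
  show "continuous_on (ball x R) (\<lambda>y. signed_powr m (v y - c))"
    using assms by (intro continuous_intros) auto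
  fix y assume "y \<in> ball x R"
  hence "\<bar>v y - c\<bar> \<le> 1 + \<bar>c\<bar>" using assms(3) by fastforce
  thus "\<bar>signed_powr m (v y - c)\<bar> \<le> (1 + \<bar>c\<bar>) powr m" by (rule abs_signed_powr_le[OF assms(1)])
qed

lemma mean_gap_antimono:
  fixes v :: "real^'n \<Rightarrow> real"
  assumes "m > 0" "continuous_on (ball x R) v" "\<And>y. y \<in> ball x R \<Longrightarrow> 0 \<le> v y \<and> v y \<le> 1" "c \<le> d"
  shows "mean_gap m (ball x R) v d \<le> mean_gap m (ball x R) v c"
  unfolding mean_gap_def using assms
  by (intro set_integral_mono mean_gap_integrable signed_powr_mono) auto

lemma mean_gap_zero_exists:
  fixes v :: "real^'n \<Rightarrow> real"
  assumes m: "m > 0" and v: "continuous_on (ball x R) v" "\<And>y. y \<in> ball x R \<Longrightarrow> 0 \<le> v y \<and> v y \<le> 1"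
  shows "\<exists>\<mu>. mean_gap m (ball x R) v \<mu> = 0"
proof -
  let ?B = "ball x R"
  have 0: "mean_gap m ?B v 0 \<ge> 0"
    unfolding mean_gap_def set_lebesgue_integral_def
    using v(2) signed_powr_mono[OF m, of 0] by (intro integral_nonneg_AE) (auto simp: indicator_def)
  have 1: "mean_gap m ?B v 1 \<le> 0"
  proof -
    have "(LINT y:?B|lborel. - signed_powr m (v y - 1)) \<ge> 0"
      unfolding set_lebesgue_integral_def
      using v(2) signed_powr_mono[OF m, of _ 0] by (intro integral_nonneg_AE) (auto simp: indicator_def)
    thus ?thesis unfolding mean_gap_def by (simp add: set_lebesgue_integral_def)
  qed
  have "continuous_on {0..1} (mean_gap m ?B v)"
    unfolding continuous_on_sequentially
  proof (intro allI impI ballI)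
    fix X :: "nat \<Rightarrow> real" and c assume c: "c \<in> {0..1}" and X: "(\<forall>n. X n \<in> {0..1}) \<and> X \<longlonglongrightarrow> c"
    have meas: "(\<lambda>y. indicator ?B y *\<^sub>R signed_powr m (v y - d)) \<in> borel_measurable lborel" for d
    proof -
      have "continuous_on ?B (\<lambda>y. signed_powr m (v y - d))" using m v(1) by (intro continuous_intros)
      from ball_indicator_measurable[OF this] show ?thesis by simp
    qed
    have "(\<lambda>n. LINT y|lborel. indicator ?B y *\<^sub>R signed_powr m (v y - X n))
       \<longlonglongrightarrow> (LINT y|lborel. indicator ?B y *\<^sub>R signed_powr m (v y - c))"
    proof (rule integral_dominated_convergence[where w = "\<lambda>y. indicator ?B y"])
      show "integrable lborel (\<lambda>y. indicator ?B y :: real)"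
        by (intro integrable_real_indicator emeasure_lborel_ball_finite) simp
      show "(\<lambda>y. indicator ?B y *\<^sub>R signed_powr m (v y - c)) \<in> borel_measurable lborel"
        "(\<lambda>y. indicator ?B y *\<^sub>R signed_powr m (v y - X n)) \<in> borel_measurable lborel" for n
        by (rule meas)+
      show "AE y in lborel. (\<lambda>n. indicator ?B y *\<^sub>R signed_powr m (v y - X n))
          \<longlonglongrightarrow> indicator ?B y *\<^sub>R signed_powr m (v y - c)"
      proof (intro AE_I2 tendsto_scaleR tendsto_const)
        fix y
        have "continuous_on UNIV (\<lambda>d. signed_powr m (v y - d))" using m by (intro continuous_intros)
        hence "isCont (\<lambda>d. signed_powr m (v y - d)) c" by (simp add: continuous_on_eq_continuous_at)
        thus "(\<lambda>n. signed_powr m (v y - X n)) \<longlonglongrightarrow> signed_powr m (v y - c)"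
          using X isCont_tendsto_compose by blast
      qed
      fix n
      have "\<bar>signed_powr m (v y - X n)\<bar> \<le> 1" if "y \<in> ?B" for y
      proof -
        have "0 \<le> X n \<and> X n \<le> 1" using X by auto
        hence "\<bar>v y - X n\<bar> \<le> 1" using v(2)[OF that] by linarith
        from abs_signed_powr_le[OF m this] show ?thesis by simp
      qed
      thus "AE y in lborel. norm (indicator ?B y *\<^sub>R signed_powr m (v y - X n)) \<le> indicator ?B y"
        by (intro AE_I2) (auto simp: indicator_def)
    qed
    thus "(mean_gap m ?B v \<circ> X) \<longlonglongrightarrow> mean_gap m ?B v c"
      by (simp add: mean_gap_def set_lebesgue_integral_def comp_def)
  qed
  from IVT2'[OF 1 0 _ this] show ?thesis by auto
qed

lemma Lq_norm_ball:
  fixes w :: "real^'n \<Rightarrow> real"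
  assumes q: "q > 1" and c: "continuous_on (ball x R) w" and b: "\<And>y. y \<in> ball x R \<Longrightarrow> \<bar>w y\<bar> \<le> M"
  shows "Lq_norm (ereal q) (ball x R) w = ennreal ((LINT y:ball x R|lborel. \<bar>w y\<bar> powr q) powr (1 / q))"
    "set_integrable lborel (ball x R) (\<lambda>y. \<bar>w y\<bar> powr q)"
proof -
  have c': "continuous_on (ball x R) (\<lambda>y. \<bar>w y\<bar> powr q)"
    using c q by (intro continuous_on_powr' continuous_intros) auto
  show i: "set_integrable lborel (ball x R) (\<lambda>y. \<bar>w y\<bar> powr q)"
    by (rule ball_set_integrable[OF c', of "M powr q"]) (use b q in \<open>auto intro!: powr_mono2\<close>)
  note me = ball_indicator_measurable[OF c']
  have "set_integrable lebesgue (ball x R) (\<lambda>y. \<bar>w y\<bar> powr q)"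
    using i me unfolding set_integrable_def by (subst integrable_completion) auto
  moreover have "(LINT y:ball x R|lebesgue. \<bar>w y\<bar> powr q) = (LINT y:ball x R|lborel. \<bar>w y\<bar> powr q)"
    using me unfolding set_lebesgue_integral_def by (subst integral_completion) auto
  ultimately show "Lq_norm (ereal q) (ball x R) w = ennreal ((LINT y:ball x R|lborel. \<bar>w y\<bar> powr q) powr (1 / q))"
    by (simp add: Lq_norm_def)
qed

text \<open>Integrating the tangent line inequality at \<open>v - \<mu>\<close> against any other constant, the linear term drops out when the gap vanishes,
so that \<open>\<mu>\<close> is the strict minimizer.\<close>

lemma q_mean_eqI:
  fixes v :: "real^'n \<Rightarrow> real"
  assumes q: "q > 1" and R: "R > 0"
    and v: "continuous_on (ball x R) v" "\<And>y. y \<in> ball x R \<Longrightarrow> 0 \<le> v y \<and> v y \<le> 1"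
    and z: "mean_gap (q - 1) (ball x R) v \<mu> = 0"
  shows "q_mean (ereal q) (ball x R) v = \<mu>"
proof -
  let ?B = "ball x R"
  define \<Phi> where "\<Phi> c = (LINT y:?B|lborel. \<bar>v y - c\<bar> powr q)" for c
  have bd: "\<bar>v y - c\<bar> \<le> 1 + \<bar>c\<bar>" if "y \<in> ?B" for y c using v(2)[OF that] by linarith
  have cont: "continuous_on ?B (\<lambda>y. v y - c)" for c using v by (intro continuous_intros)
  note L = Lq_norm_ball[OF q cont bd]
  have L1: "Lq_norm (ereal q) ?B (\<lambda>y. v y - c) = ennreal (\<Phi> c powr (1 / q))" for c
    unfolding \<Phi>_def by (rule L(1))
  have Li: "set_integrable lborel ?B (\<lambda>y. \<bar>v y - c\<bar> powr q)" for c by (rule L(2))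
  have nn: "\<Phi> c \<ge> 0" for c unfolding \<Phi>_def set_lebesgue_integral_def
    by (intro integral_nonneg_AE) auto
  have lt: "\<Phi> \<mu> < \<Phi> c" if ne: "c \<noteq> \<mu>" for c
  proof -
    define g where "g y = \<bar>v y - c\<bar> powr q - (\<bar>v y - \<mu>\<bar> powr q + q * (\<mu> - c) * signed_powr (q - 1) (v y - \<mu>))" for y
    have i: "set_integrable lborel ?B (\<lambda>y. signed_powr (q - 1) (v y - \<mu>))"
      using q by (intro mean_gap_integrable v) auto
    have i': "set_integrable lborel ?B (\<lambda>y. q * (\<mu> - c) * signed_powr (q - 1) (v y - \<mu>))"
      by (intro set_integrable_mult_right i)
    have i2: "set_integrable lborel ?B (\<lambda>y. \<bar>v y - \<mu>\<bar> powr q + q * (\<mu> - c) * signed_powr (q - 1) (v y - \<mu>))"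
      by (intro set_integral_add(1) Li i')
    have ig: "set_integrable lborel ?B g" unfolding g_def by (intro set_integral_diff(1) Li i2)
    have "0 < (LINT y:?B|lborel. g y)"
    proof (rule set_integral_ball_pos[OF R ig])
      fix y
      have "v y - c \<noteq> v y - \<mu>" using ne by simp
      from powr_tangent[OF q this] show "g y > 0" by (simp add: g_def algebra_simps)
    qed
    also have "(LINT y:?B|lborel. g y) = \<Phi> c - (\<Phi> \<mu> + q * (\<mu> - c) * mean_gap (q - 1) ?B v \<mu>)"
      unfolding g_def \<Phi>_def mean_gap_def
      using set_integral_diff(2)[OF Li[of c] i2] set_integral_add(2)[OF Li[of \<mu>] i'] by simp
    finally show ?thesis using z by simp
  qed
  show ?thesis unfolding q_mean_def L1
  proof (rule the_equality)
    show "\<forall>c. ennreal (\<Phi> \<mu> powr (1 / q)) \<le> ennreal (\<Phi> c powr (1 / q))"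
    proof
      fix c show "ennreal (\<Phi> \<mu> powr (1 / q)) \<le> ennreal (\<Phi> c powr (1 / q))"
        using lt[of c] nn[of \<mu>] q by (cases "c = \<mu>") (auto intro!: ennreal_leI powr_mono2)
    qed
    fix d assume "\<forall>c. ennreal (\<Phi> d powr (1 / q)) \<le> ennreal (\<Phi> c powr (1 / q))"
    hence le: "\<Phi> d powr (1 / q) \<le> \<Phi> \<mu> powr (1 / q)" by simp
    show "d = \<mu>"
    proof (rule ccontr)
      assume "d \<noteq> \<mu>"
      from lt[OF this] have "\<Phi> \<mu> powr (1 / q) < \<Phi> d powr (1 / q)"
        using nn[of \<mu>] q by (intro powr_less_mono2) auto
      thus False using le by simp
    qed
  qed
qed

text \<open>The gap is decreasing in \<open>c\<close>, so its sign at \<open>c\<close> tells on which side of \<open>c\<close> the mean lies.\<close>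

lemma q_mean_bounds:
  fixes v :: "real^'n \<Rightarrow> real"
  assumes q: "q > 1" and R: "R > 0"
    and v: "continuous_on (ball x R) v" "\<And>y. y \<in> ball x R \<Longrightarrow> 0 \<le> v y \<and> v y \<le> 1"
  shows "mean_gap (q - 1) (ball x R) v c > 0 \<Longrightarrow> c < q_mean (ereal q) (ball x R) v"
    and "mean_gap (q - 1) (ball x R) v c < 0 \<Longrightarrow> q_mean (ereal q) (ball x R) v < c"
proof -
  have m: "q - 1 > 0" using q by simp
  obtain \<mu> where \<mu>: "mean_gap (q - 1) (ball x R) v \<mu> = 0" using mean_gap_zero_exists[OF m v] by auto
  have e: "q_mean (ereal q) (ball x R) v = \<mu>" by (rule q_mean_eqI[OF q R v \<mu>])
  note mono = mean_gap_antimono[OF m v]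
  show "mean_gap (q - 1) (ball x R) v c > 0 \<Longrightarrow> c < q_mean (ereal q) (ball x R) v"
    using mono[of \<mu> c] \<mu> e by (cases "\<mu> \<le> c") auto
  show "mean_gap (q - 1) (ball x R) v c < 0 \<Longrightarrow> q_mean (ereal q) (ball x R) v < c"
    using mono[of c \<mu>] \<mu> e by (cases "c \<le> \<mu>") auto
qed

text \<open>For a continuous function on an open set the essential supremum is the supremum, hence the best constant is
the midpoint of the range.\<close>

lemma q_mean_infinity:
  fixes v :: "real^'n \<Rightarrow> real"
  assumes R: "R > 0" and v: "continuous_on (ball x R) v" and b: "bounded (v ` ball x R)"
  shows "q_mean \<infinity> (ball x R) v = (Sup (v ` ball x R) + Inf (v ` ball x R)) / 2"
proof -
  let ?B = "ball x R"
  define S I where "S = Sup (v ` ?B)" and "I = Inf (v ` ?B)"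
  have ne: "v ` ?B \<noteq> {}" using R by auto
  have ba: "bdd_above (v ` ?B)" "bdd_below (v ` ?B)" using b bounded_imp_bdd_above bounded_imp_bdd_below by auto
  have SI: "I \<le> v y" "v y \<le> S" if "y \<in> ?B" for y
    using that ba by (auto simp: S_def I_def intro: cInf_lower cSup_upper)
  define E where "E c = Lq_norm \<infinity> ?B (\<lambda>y. v y - c)" for c
  have E: "E c = esssup (lebesgue_on ?B) (\<lambda>y. ennreal \<bar>v y - c\<bar>)" for c by (simp add: E_def Lq_norm_def)
  have meas: "(\<lambda>y. ennreal \<bar>v y - c\<bar>) \<in> borel_measurable (lebesgue_on ?B)" for c
  proof -
    have "(\<lambda>y. \<bar>v y - c\<bar>) \<in> borel_measurable (lebesgue_on ?B)"
      using v by (intro continuous_imp_measurable_on_sets_lebesgue continuous_intros) auto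
    thus ?thesis by simp
  qed
  have up: "E ((S + I) / 2) \<le> ennreal ((S - I) / 2)"
    unfolding E
  proof (rule esssup_I[OF meas], rule AE_I2)
    fix y assume "y \<in> space (lebesgue_on ?B)"
    hence "y \<in> ?B" by simp
    from SI[OF this] have "\<bar>v y - (S + I) / 2\<bar> \<le> (S - I) / 2" by (auto simp: abs_if field_simps)
    thus "ennreal \<bar>v y - (S + I) / 2\<bar> \<le> ennreal ((S - I) / 2)" by (rule ennreal_leI)
  qed
  have low: "ennreal \<bar>v y - c\<bar> \<le> E c" if y: "y \<in> ?B" for y c
  proof (rule ccontr)
    assume "\<not> ennreal \<bar>v y - c\<bar> \<le> E c"
    hence lt: "E c < ennreal \<bar>v y - c\<bar>" by simp
    then obtain e where e: "e \<ge> 0" "E c = ennreal e" by (cases "E c") auto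
    define U where "U = {z \<in> ?B. e < \<bar>v z - c\<bar>}"
    have yU: "y \<in> U" using y lt e by (auto simp: U_def ennreal_less_iff)
    have oU: "open U"
    proof -
      have "U = ?B \<inter> (\<lambda>z. \<bar>v z - c\<bar>) -` {e<..}" by (auto simp: U_def)
      thus ?thesis using v by (auto intro!: continuous_open_preimage continuous_intros)
    qed
    have "AE z in lebesgue_on ?B. ennreal \<bar>v z - c\<bar> \<le> E c" unfolding E by (rule esssup_AE)
    hence "AE z in lebesgue. z \<in> ?B \<longrightarrow> ennreal \<bar>v z - c\<bar> \<le> E c"
      by (subst (asm) AE_restrict_space_iff) auto
    hence "AE z in lebesgue. z \<notin> U"
      by eventually_elim (use e in \<open>auto simp: U_def ennreal_le_iff not_le\<close>)
    hence "negligible U" using oU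
      by (subst (asm) AE_iff_null_sets[symmetric]) (auto simp: negligible_iff_null_sets)
    thus False using open_not_negligible[OF oU] yU by auto
  qed
  have key: "c = (S + I) / 2" if "E c \<le> ennreal ((S - I) / 2)" for c
  proof -
    have "x \<in> ?B" using R by simp
    hence SI0: "S - I \<ge> 0" using SI[of x] by linarith
    have ab: "\<bar>v y - c\<bar> \<le> (S - I) / 2" if "y \<in> ?B" for y
      using low[OF that, of c] \<open>E c \<le> _\<close> SI0 by (metis ennreal_le_iff order_trans divide_nonneg_pos zero_less_numeral)
    have "v y \<le> c + (S - I) / 2" "c - (S - I) / 2 \<le> v y" if "y \<in> ?B" for y
      using ab[OF that] by linarith+
    hence "S \<le> c + (S - I) / 2" "c - (S - I) / 2 \<le> I"
      unfolding S_def I_def using ne by (auto intro!: cSup_least cInf_greatest)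
    thus ?thesis by (simp add: field_simps)
  qed
  show ?thesis unfolding q_mean_def E_def[symmetric] S_def[symmetric] I_def[symmetric]
  proof (rule the_equality)
    show "\<forall>c. E ((S + I) / 2) \<le> E c"
    proof
      fix c show "E ((S + I) / 2) \<le> E c"
      proof (cases "E c \<le> ennreal ((S - I) / 2)")
        case True from key[OF this] show ?thesis by (simp only: order_refl)
      qed (use up in auto)
    qed
    fix d assume "\<forall>c. E d \<le> E c"
    thus "d = (S + I) / 2" using key up order_trans by blast
  qed
qed

section \<open>Changes of variables and the integral over the paraboloid\<close>

text \<open>By Vitali's covering theorem an open set is a countable disjoint union of balls up to a null set, and
orthogonal maps send balls to balls of the same radius.\<close>

lemma emeasure_orthogonal_image_open:
  fixes T :: "'a::euclidean_space \<Rightarrow> 'a"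
  assumes T: "orthogonal_transformation T" and U: "open U"
  shows "emeasure lborel (T ` U) = emeasure lborel U"
proof -
  define K where "K = {(c :: 'a, r :: real). 0 < r \<and> ball c r \<subseteq> U}"
  have cov: "\<exists>i. i \<in> K \<and> x \<in> ball (fst i) (snd i) \<and> snd i < d" if "x \<in> U" "0 < d" for x d
  proof -
    obtain r where r: "r > 0" "ball x r \<subseteq> U" using U \<open>x \<in> U\<close> by (meson openE)
    have "ball x (min r (d/2)) \<subseteq> U" using r by auto
    thus ?thesis using r that by (intro exI[of _ "(x, min r (d/2))"]) (auto simp: K_def)
  qed
  obtain C where C: "countable C" "C \<subseteq> K"
     "pairwise (\<lambda>i j. disjnt (ball (fst i) (snd i)) (ball (fst j) (snd j))) C"
     "negligible (U - (\<Union>i\<in>C. ball (fst i) (snd i)))"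
    by (rule Vitali_covering_theorem_balls[of U K fst snd]) (use cov in blast)+
  define V where "V = (\<Union>i\<in>C. ball (fst i) (snd i))"
  define N where "N = U - V"
  have Vop: "open V" by (auto simp: V_def)
  have "ball (fst i) (snd i) \<subseteq> U" if "i \<in> C" for i
    using C(2) that unfolding K_def by (cases i) auto
  hence VU: "V \<subseteq> U" unfolding V_def by blast
  have inj: "inj T" using T by (rule orthogonal_transformation_inj)
  have Top: "open (T ` W)" if "open W" for W
    using that T orthogonal_transformation_inj[OF T] orthogonal_transformation_surj[OF T]
    by (metis open_bijective_linear_image_eq bij_def orthogonal_transformation_linear)
  have null: "M \<in> null_sets lborel" if "negligible M" "M \<in> sets borel" for M :: "'a set"
    using that by (simp add: negligible_iff_null_sets null_sets_completion_iff)
  have N: "N \<in> null_sets lborel"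
    using C(4) U Vop by (intro null) (auto simp: N_def V_def[symmetric])
  have TN: "T ` N \<in> null_sets lborel"
  proof (rule null)
    show "negligible (T ` N)"
      using C(4) orthogonal_transformation_linear[OF T]
      by (intro negligible_differentiable_image_negligible linear_imp_differentiable_on)
         (auto simp: N_def V_def)
    have "T ` N = T ` U - T ` V" using inj by (simp add: N_def image_set_diff)
    thus "T ` N \<in> sets borel" using Top[OF U] Top[OF Vop] by simp
  qed
  have dV: "disjoint_family_on (\<lambda>i. ball (fst i) (snd i)) C"
    using C(3) by (auto simp: disjoint_family_on_def pairwise_def disjnt_def)
  have dTV: "disjoint_family_on (\<lambda>i. T ` ball (fst i) (snd i)) C"
    using dV inj unfolding disjoint_family_on_def
    by (metis image_Int image_empty)
  have Tb: "emeasure lborel (T ` ball (fst i) (snd i)) = emeasure lborel (ball (fst i) (snd i))" if "i \<in> C" for i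
  proof -
    have "snd i \<ge> 0" using that C(2) by (auto simp: K_def)
    thus ?thesis unfolding image_orthogonal_transformation_ball[OF T] by (simp only: emeasure_ball)
  qed
  have "emeasure lborel (T ` V) = emeasure lborel (\<Union>i\<in>C. T ` ball (fst i) (snd i))"
    by (simp add: V_def image_UN)
  also have "\<dots> = (\<integral>\<^sup>+i. emeasure lborel (T ` ball (fst i) (snd i)) \<partial>count_space C)"
    using C(1) dTV Top by (intro emeasure_UN_countable) auto
  also have "\<dots> = (\<integral>\<^sup>+i. emeasure lborel (ball (fst i) (snd i)) \<partial>count_space C)"
    by (intro nn_integral_cong) (simp add: Tb)
  also have "\<dots> = emeasure lborel V"
    unfolding V_def using C(1) dV by (intro emeasure_UN_countable[symmetric]) auto
  finally have V: "emeasure lborel (T ` V) = emeasure lborel V" .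
  have "T ` U = T ` V \<union> T ` N" "U = V \<union> N" using VU by (auto simp: N_def)
  thus ?thesis using V emeasure_Un_null_set[OF _ N, of V] emeasure_Un_null_set[OF _ TN, of "T ` V"] Vop Top[OF Vop]
    by simp
qed

lemma lborel_distr_orthogonal:
  fixes T :: "'a::euclidean_space \<Rightarrow> 'a"
  assumes T: "orthogonal_transformation T"
  shows "distr lborel borel T = lborel"
proof (rule lborel_eqI[symmetric])
  have meas: "T \<in> borel_measurable borel"
    using orthogonal_transformation_linear[OF T]
    by (intro borel_measurable_continuous_onI linear_continuous_on) (simp add: linear_conv_bounded_linear)
  have bij: "bij T" using T by (rule orthogonal_transformation_bij)
  fix l u :: 'a assume lu: "\<And>b. b \<in> Basis \<Longrightarrow> l \<bullet> b \<le> u \<bullet> b"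
  have "emeasure (distr lborel borel T) (box l u) = emeasure lborel (T -` box l u)"
    using meas by (subst emeasure_distr) auto
  also have "T -` box l u = inv T ` box l u" using bij by (simp add: bij_vimage_eq_inv_image)
  also have "emeasure lborel \<dots> = emeasure lborel (box l u)"
    by (rule emeasure_orthogonal_image_open[OF orthogonal_transformation_inv[OF T]]) auto
  also have "\<dots> = (\<Prod>b\<in>Basis. (u - l) \<bullet> b)" using lu by (rule emeasure_lborel_box)
  finally show "emeasure (distr lborel borel T) (box l u) = (\<Prod>b\<in>Basis. (u - l) \<bullet> b)" .
qed simp

lemma Basis_vec_eq: "(Basis :: (real^'n) set) = (\<lambda>i. axis i 1) ` UNIV"
  by (auto simp: Basis_vec_def)

lemma prod_Basis_vec: "(\<Prod>b\<in>(Basis :: (real^'n) set). F b) = (\<Prod>i\<in>UNIV. F (axis i 1))"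
  unfolding Basis_vec_eq by (subst prod.reindex) (auto simp: inj_on_def axis_eq_axis)

lemma sum_Basis_vec: "(\<Sum>b\<in>(Basis :: (real^'n) set). F b) = (\<Sum>i\<in>UNIV. F (axis i 1))"
  unfolding Basis_vec_eq by (subst sum.reindex) (auto simp: inj_on_def axis_eq_axis)

lemma lborel_integral_frame:
  fixes g :: "real^'n \<Rightarrow> real" and T :: "real^'n \<Rightarrow> real^'n"
  assumes T: "orthogonal_transformation T" and d: "\<And>j. d j > 0" and g: "g \<in> borel_measurable borel"
  shows "(LINT y|lborel. g y) = (\<Prod>j\<in>UNIV. d j) * (LINT \<zeta>|lborel. g (y0 + T (\<chi> j. d j * \<zeta> $ j)))"
proof -
  have mT: "T \<in> borel_measurable borel"
    using orthogonal_transformation_linear[OF T]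
    by (intro borel_measurable_continuous_onI linear_continuous_on) (simp add: linear_conv_bounded_linear)
  have "(LINT y|lborel. g y) = (LINT y|distr lborel borel ((+) y0). g y)"
    by (simp add: lborel_distr_plus)
  also have "\<dots> = (LINT z|lborel. g (y0 + z))" using g by (subst integral_distr) auto
  also have "\<dots> = (LINT z|distr lborel borel T. g (y0 + z))" by (simp add: lborel_distr_orthogonal[OF T])
  also have "\<dots> = (LINT w|lborel. g (y0 + T w))" using g mT by (subst integral_distr) auto
  also have "\<dots> = (\<Prod>j\<in>UNIV. d j) * (LINT \<zeta>|lborel. g (y0 + T (\<chi> j. d j * \<zeta> $ j)))"
  proof -
    define c :: "real^'n \<Rightarrow> real" where "c b = (\<Sum>j\<in>UNIV. d j * b $ j)" for b
    have c: "c (axis i 1) = d i" for i by (simp add: c_def axis_def if_distrib cong: if_cong)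
    define D where "D x = 0 + (\<Sum>b\<in>Basis. (c b * (x \<bullet> b)) *\<^sub>R b)" for x :: "real^'n"
    have D: "D \<zeta> = (\<chi> j. d j * \<zeta> $ j)" for \<zeta>
    proof -
      have "\<zeta> \<bullet> axis i 1 = \<zeta> $ i" for i by (simp add: inner_axis)
      thus ?thesis unfolding D_def sum_Basis_vec c
        by (simp add: vec_eq_iff axis_def if_distrib cong: if_cong)
    qed
    have mD: "D \<in> borel_measurable borel" unfolding D_def
      by (intro borel_measurable_continuous_onI continuous_intros)
    have p: "(\<Prod>b\<in>Basis. \<bar>c b\<bar>) = (\<Prod>j\<in>UNIV. d j)"
      unfolding prod_Basis_vec c using d by (intro prod.cong) (auto simp: abs_of_pos)
    have pp: "(\<Prod>j\<in>UNIV. d j) \<ge> 0" using d by (intro prod_nonneg) (auto simp: less_imp_le)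
    have "lborel = density (distr lborel borel (\<lambda>x. 0 + (\<Sum>b\<in>Basis. (c b * (x \<bullet> b)) *\<^sub>R b))) (\<lambda>_. ennreal (\<Prod>b\<in>Basis. \<bar>c b\<bar>))"
      by (rule lborel_affine_euclidean) (use c d in \<open>auto simp: Basis_vec_eq less_imp_neq[THEN not_sym]\<close>)
    hence "(LINT w|lborel. g (y0 + T w)) = (LINT w|density (distr lborel borel D) (\<lambda>_. ennreal (\<Prod>j\<in>UNIV. d j)). g (y0 + T w))"
      unfolding p by (simp add: D_def[abs_def])
    also have "\<dots> = (\<Prod>j\<in>UNIV. d j) * (LINT w|distr lborel borel D. g (y0 + T w))"
      using g mT pp by (subst integral_density) auto
    also have "(LINT w|distr lborel borel D. g (y0 + T w)) = (LINT \<zeta>|lborel. g (y0 + T (D \<zeta>)))"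
      using g mT mD by (subst integral_distr) auto
    finally show ?thesis by (simp add: D)
  qed
  finally show ?thesis .
qed

lemma nn_integral_lborel_split:
  fixes F :: "'a::euclidean_space \<Rightarrow> ennreal"
  assumes b: "b \<in> Basis" and F[measurable]: "F \<in> borel_measurable borel"
  shows "(\<integral>\<^sup>+x. F x \<partial>lborel) =
    (\<integral>\<^sup>+y. (\<integral>\<^sup>+t. F (t *\<^sub>R b + (\<Sum>i\<in>Basis - {b}. y i *\<^sub>R i)) \<partial>lborel) \<partial>(\<Pi>\<^sub>M i\<in>Basis - {b}. lborel))"
proof -
  interpret product_sigma_finite "\<lambda>_::'a. lborel :: real measure" ..
  have B: "Basis = insert b (Basis - {b})" using b by auto
  have eq: "(\<Sum>i\<in>Basis. (y(b := t)) i *\<^sub>R i) = t *\<^sub>R b + (\<Sum>i\<in>Basis - {b}. y i *\<^sub>R i)" for y t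
    using b by (subst sum.remove[of Basis b]) (auto intro!: sum.cong)
  have m: "(\<lambda>f. F (\<Sum>i\<in>Basis. f i *\<^sub>R i)) \<in> borel_measurable (\<Pi>\<^sub>M i\<in>insert b (Basis - {b}). lborel)"
    unfolding B[symmetric] by measurable
  have "(\<integral>\<^sup>+x. F x \<partial>lborel) = (\<integral>\<^sup>+f. F (\<Sum>i\<in>Basis. f i *\<^sub>R i) \<partial>(\<Pi>\<^sub>M i\<in>Basis. lborel))"
    by (subst lborel_eq, subst nn_integral_distr) auto
  also have "(\<Pi>\<^sub>M i\<in>Basis. lborel :: real measure) = (\<Pi>\<^sub>M i\<in>insert b (Basis - {b}). lborel)" using B by simp
  also have "(\<integral>\<^sup>+f. F (\<Sum>i\<in>Basis. f i *\<^sub>R i) \<partial>\<dots>)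
    = (\<integral>\<^sup>+y. (\<integral>\<^sup>+t. F (\<Sum>i\<in>Basis. (y(b := t)) i *\<^sub>R i) \<partial>lborel) \<partial>(\<Pi>\<^sub>M i\<in>Basis - {b}. lborel))"
    by (rule product_nn_integral_insert[OF _ _ m]) auto
  finally show ?thesis by (simp only: eq)
qed

text \<open>Fubini in the direction \<open>b\<close> and translation invariance of the one-dimensional integrals.\<close>

lemma nn_integral_shear:
  fixes F :: "'a::euclidean_space \<Rightarrow> ennreal"
  assumes b: "b \<in> Basis" and F[measurable]: "F \<in> borel_measurable borel"
    and Q[measurable]: "Q \<in> borel_measurable borel" and inv: "\<And>z t. Q (t *\<^sub>R b + z) = Q z"
  shows "(\<integral>\<^sup>+z. F z \<partial>lborel) = (\<integral>\<^sup>+z. F (z + Q z *\<^sub>R b) \<partial>lborel)"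
proof -
  have "(\<integral>\<^sup>+t. F (t *\<^sub>R b + Y) \<partial>lborel) = (\<integral>\<^sup>+t. F ((t *\<^sub>R b + Y) + Q (t *\<^sub>R b + Y) *\<^sub>R b) \<partial>lborel)" for Y
  proof -
    have "(\<integral>\<^sup>+t. F (t *\<^sub>R b + Y) \<partial>lborel) = (\<integral>\<^sup>+t. F ((Q Y + 1 * t) *\<^sub>R b + Y) \<partial>lborel)"
      by (subst nn_integral_real_affine[where t="Q Y" and c=1]) auto
    moreover have "(Q Y + 1 * t) *\<^sub>R b + Y = (t *\<^sub>R b + Y) + Q (t *\<^sub>R b + Y) *\<^sub>R b" for t
      unfolding inv by (simp add: scaleR_left_distrib)
    ultimately show ?thesis by (simp only:)
  qed
  thus ?thesis by (simp add: nn_integral_lborel_split[OF b])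
qed

lemma nn_integral_gaussian:
  assumes "\<alpha> > 0"
  shows "(\<integral>\<^sup>+x. ennreal (exp (- \<alpha> * x\<^sup>2)) \<partial>lborel) = ennreal (sqrt (pi / \<alpha>))"
proof -
  define s where "s = sqrt (1 / (2 * \<alpha>))"
  have s: "s > 0" "s\<^sup>2 = 1 / (2 * \<alpha>)" using assms by (auto simp: s_def)
  have c: "2 * pi * s\<^sup>2 = pi / \<alpha>" using s assms by simp
  have e: "exp (- \<alpha> * x\<^sup>2) = sqrt (pi / \<alpha>) * normal_density 0 s x" for x
  proof -
    have "x\<^sup>2 / (2 * s\<^sup>2) = \<alpha> * x\<^sup>2" using s assms by simp
    thus ?thesis using assms unfolding normal_density_def c by simp
  qed
  have "(\<integral>\<^sup>+x. ennreal (exp (- \<alpha> * x\<^sup>2)) \<partial>lborel) = ennreal (LINT x|lborel. sqrt (pi / \<alpha>) * normal_density 0 s x)"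
    unfolding e using s assms by (intro nn_integral_eq_integral) auto
  thus ?thesis using s by simp
qed

lemma nn_integral_exp_decay:
  assumes "a > 0"
  shows "(\<integral>\<^sup>+x. ennreal (indicator {0<..} x * exp (- a * x)) \<partial>lborel) = ennreal (1 / a)"
proof -
  have "(\<integral>\<^sup>+x. ennreal (indicator {0<..} x * exp (- a * x)) \<partial>lborel)
     = (\<integral>\<^sup>+x. ennreal (exp (- a * x)) * indicator {0..} x \<partial>lborel)"
  proof (rule nn_integral_cong_AE)
    have "AE x::real in lborel. x \<noteq> 0" by (rule AE_lborel_singleton)
    thus "AE x in lborel. ennreal (indicator {0<..} x * exp (- a * x)) = ennreal (exp (- a * x)) * indicator {0..} x"
      by eventually_elim (auto simp: indicator_def)
  qed
  also have "\<dots> = ennreal (0 - (- exp (- a * 0) / a))"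
  proof (rule nn_integral_FTC_atLeast)
    show "((\<lambda>x. - exp (- a * x) / a) \<longlongrightarrow> 0) at_top"
      using assms by real_asymp
    fix x :: real
    show "((\<lambda>x. - exp (- a * x) / a) has_real_derivative exp (- a * x)) (at x)"
      using assms by (auto intro!: derivative_eq_intros)
  qed (use assms in auto)
  finally show ?thesis by simp
qed

text \<open>The shear along the normal axis by \<open>\<Sum> \<zeta>\<^sub>j\<^sup>2 / (2 R)\<close> straightens the paraboloid into a half space. The
exponent becomes \<open>- a (\<tau> + \<Sum> (1 / R - \<kappa>\<^sub>j) \<zeta>\<^sub>j\<^sup>2 / 2)\<close>, so the integral splits into a one-sided exponential
and Gaussians, which converge because \<open>\<kappa>\<^sub>j < 1 / R\<close>.\<close>

lemma paraboloid_integral: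
  fixes \<kappa> :: "'n::finite \<Rightarrow> real"
  assumes a: "a > 0" and R: "R > 0" and \<kappa>: "\<And>j. j \<noteq> k \<Longrightarrow> \<kappa> j < 1 / R"
  shows "(\<integral>\<^sup>+\<zeta>. ennreal (indicator {\<zeta> :: real^'n. (\<Sum>j\<in>UNIV - {k}. (\<zeta> $ j)\<^sup>2) < 2 * R * \<zeta> $ k} \<zeta>
           * exp (- a * (\<zeta> $ k - (\<Sum>j\<in>UNIV - {k}. \<kappa> j * (\<zeta> $ j)\<^sup>2) / 2))) \<partial>lborel)
     = ennreal (1 / a * (\<Prod>j\<in>UNIV - {k}. sqrt (2 * pi / (a * (1 / R - \<kappa> j)))))"
proof -
  define b :: "real^'n" where "b = axis k 1"
  have b: "b \<in> Basis" by (simp add: b_def Basis_vec_eq)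
  define F where "F \<zeta> = ennreal (indicator {\<zeta> :: real^'n. (\<Sum>j\<in>UNIV - {k}. (\<zeta> $ j)\<^sup>2) < 2 * R * \<zeta> $ k} \<zeta>
           * exp (- a * (\<zeta> $ k - (\<Sum>j\<in>UNIV - {k}. \<kappa> j * (\<zeta> $ j)\<^sup>2) / 2)))" for \<zeta>
  define Q where "Q \<zeta> = (\<Sum>j\<in>UNIV - {k}. (\<zeta> $ j)\<^sup>2) / (2 * R)" for \<zeta> :: "real^'n"
  have F: "F \<in> borel_measurable borel" unfolding F_def
    by measurable
  have Q: "Q \<in> borel_measurable borel" unfolding Q_def by measurable
  have inv: "Q (t *\<^sub>R b + z) = Q z" for z t
  proof -
    have "(\<Sum>j\<in>UNIV - {k}. ((t *\<^sub>R b + z) $ j)\<^sup>2) = (\<Sum>j\<in>UNIV - {k}. (z $ j)\<^sup>2)"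
      by (intro sum.cong refl) (auto simp: b_def axis_def)
    thus ?thesis unfolding Q_def by simp
  qed
  \<comment> \<open>A function on vectors with value \<open>\<kappa> j\<close> at the \<open>j\<close>-th basis vector, as the product formula is indexed by basis vectors.\<close>
  define K where "K c = (\<Sum>j\<in>UNIV. \<kappa> j * c $ j)" for c :: "real^'n"
  have K: "K (axis i 1) = \<kappa> i" for i by (simp add: K_def axis_def if_distrib cong: if_cong)
  define G where "G c t = (if c = b then ennreal (indicator {0<..} t * exp (- a * t))
      else ennreal (exp (- (a / 2 * (1 / R - K c)) * t\<^sup>2)))" for c :: "real^'n" and t :: real
  have FG: "F (\<zeta> + Q \<zeta> *\<^sub>R b) = (\<Prod>c\<in>Basis. G c (\<zeta> \<bullet> c))" for \<zeta>
  proof -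
    have co: "(\<zeta> + Q \<zeta> *\<^sub>R b) $ k = \<zeta> $ k + Q \<zeta>" "j \<noteq> k \<Longrightarrow> (\<zeta> + Q \<zeta> *\<^sub>R b) $ j = \<zeta> $ j" for j
      by (auto simp: b_def axis_def)
    have s1: "(\<Sum>j\<in>UNIV - {k}. ((\<zeta> + Q \<zeta> *\<^sub>R b) $ j)\<^sup>2) = 2 * R * Q \<zeta>"
    proof -
      have "(\<Sum>j\<in>UNIV - {k}. ((\<zeta> + Q \<zeta> *\<^sub>R b) $ j)\<^sup>2) = (\<Sum>j\<in>UNIV - {k}. (\<zeta> $ j)\<^sup>2)"
        by (intro sum.cong refl) (auto simp: b_def axis_def)
      thus ?thesis using R by (simp add: Q_def)
    qed
    have s2: "(\<Sum>j\<in>UNIV - {k}. \<kappa> j * ((\<zeta> + Q \<zeta> *\<^sub>R b) $ j)\<^sup>2) = (\<Sum>j\<in>UNIV - {k}. \<kappa> j * (\<zeta> $ j)\<^sup>2)"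
      by (intro sum.cong refl) (auto simp: b_def axis_def)
    have i: "(\<zeta> + Q \<zeta> *\<^sub>R b \<in> {\<zeta>. (\<Sum>j\<in>UNIV - {k}. (\<zeta> $ j)\<^sup>2) < 2 * R * \<zeta> $ k}) = (\<zeta> $ k \<in> {0<..})"
      unfolding mem_Collect_eq s1 co(1) using R by (simp add: distrib_left zero_less_mult_iff)
    have e: "- a * (\<zeta> $ k + Q \<zeta> - (\<Sum>j\<in>UNIV - {k}. \<kappa> j * (\<zeta> $ j)\<^sup>2) / 2)
       = - a * \<zeta> $ k + (\<Sum>j\<in>UNIV - {k}. - (a / 2 * (1 / R - \<kappa> j)) * (\<zeta> $ j)\<^sup>2)"
    proof -
      have "(\<Sum>j\<in>UNIV - {k}. - (a / 2 * (1 / R - \<kappa> j)) * (\<zeta> $ j)\<^sup>2)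
        = (- a / (2 * R)) * (\<Sum>j\<in>UNIV - {k}. (\<zeta> $ j)\<^sup>2) + a / 2 * (\<Sum>j\<in>UNIV - {k}. \<kappa> j * (\<zeta> $ j)\<^sup>2)"
        unfolding sum_distrib_left sum.distrib[symmetric] using R
        by (intro sum.cong refl) (simp add: field_simps)
      thus ?thesis unfolding Q_def using R by (simp add: algebra_simps)
    qed
    have "F (\<zeta> + Q \<zeta> *\<^sub>R b) = ennreal (indicator {0<..} (\<zeta> $ k) * exp (- a * \<zeta> $ k)
        * (\<Prod>j\<in>UNIV - {k}. exp (- (a / 2 * (1 / R - \<kappa> j)) * (\<zeta> $ j)\<^sup>2)))"
      unfolding F_def s2 co(1) e exp_add using i by (simp add: indicator_def exp_sum mult.assoc)
    also have "\<dots> = G b (\<zeta> $ k) * (\<Prod>j\<in>UNIV - {k}. G (axis j 1) (\<zeta> $ j))"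
      by (simp add: G_def K b_def axis_eq_axis prod_ennreal ennreal_mult prod_nonneg)
    also have "\<dots> = (\<Prod>j\<in>UNIV. G (axis j 1) (\<zeta> $ j))"
      by (simp add: prod.remove[of UNIV k] b_def)
    also have "\<dots> = (\<Prod>c\<in>Basis. G c (\<zeta> \<bullet> c))"
      unfolding prod_Basis_vec by (simp add: inner_axis)
    finally show ?thesis .
  qed
  have "(\<integral>\<^sup>+\<zeta>. F \<zeta> \<partial>lborel) = (\<integral>\<^sup>+\<zeta>. (\<Prod>c\<in>Basis. G c (\<zeta> \<bullet> c)) \<partial>lborel)"
    by (subst nn_integral_shear[OF b F Q inv]) (simp add: FG)
  also have "\<dots> = (\<Prod>c\<in>Basis. (\<integral>\<^sup>+t. G c t \<partial>lborel))"
    by (rule nn_integral_lborel_prod) (auto simp: G_def)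
  also have "\<dots> = (\<integral>\<^sup>+t. G b t \<partial>lborel) * (\<Prod>j\<in>UNIV - {k}. (\<integral>\<^sup>+t. G (axis j 1) t \<partial>lborel))"
    unfolding prod_Basis_vec by (simp add: prod.remove[of UNIV k] b_def)
  also have "(\<integral>\<^sup>+t. G b t \<partial>lborel) = ennreal (1 / a)"
    unfolding G_def using nn_integral_exp_decay[OF a] by simp
  also have "(\<Prod>j\<in>UNIV - {k}. (\<integral>\<^sup>+t. G (axis j 1) t \<partial>lborel))
     = (\<Prod>j\<in>UNIV - {k}. ennreal (sqrt (2 * pi / (a * (1 / R - \<kappa> j)))))"
  proof (intro prod.cong refl)
    fix j assume j: "j \<in> UNIV - {k}"
    have "a / 2 * (1 / R - \<kappa> j) > 0" using a \<kappa>[of j] j by (intro mult_pos_pos) auto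
    from nn_integral_gaussian[OF this] show "(\<integral>\<^sup>+t. G (axis j 1) t \<partial>lborel) = ennreal (sqrt (2 * pi / (a * (1 / R - \<kappa> j))))"
      using j by (simp add: G_def b_def axis_eq_axis K mult_ac)
  qed
  also have "ennreal (1 / a) * \<dots> = ennreal (1 / a * (\<Prod>j\<in>UNIV - {k}. sqrt (2 * pi / (a * (1 / R - \<kappa> j)))))"
  proof -
    have nn: "sqrt (2 * pi / (a * (1 / R - \<kappa> j))) \<ge> 0" if "j \<in> UNIV - {k}" for j
      unfolding real_sqrt_ge_0_iff
      using a \<kappa>[of j] that by (intro divide_nonneg_nonneg mult_nonneg_nonneg) (auto simp: less_imp_le)
    have "(\<Prod>j\<in>UNIV - {k}. ennreal (sqrt (2 * pi / (a * (1 / R - \<kappa> j)))))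
        = ennreal (\<Prod>j\<in>UNIV - {k}. sqrt (2 * pi / (a * (1 / R - \<kappa> j))))"
      by (rule prod_ennreal[OF nn])
    moreover have "(\<Prod>j\<in>UNIV - {k}. sqrt (2 * pi / (a * (1 / R - \<kappa> j)))) \<ge> 0"
      by (rule prod_nonneg) (use nn in blast)
    ultimately show ?thesis using a ennreal_mult[of "1 / a" "\<Prod>j\<in>UNIV - {k}. sqrt (2 * pi / (a * (1 / R - \<kappa> j)))"]
      by simp
  qed
  finally show ?thesis by (simp add: F_def)
qed

section \<open>Zooming in at the contact point\<close>

lemma dominated_convergence_at_right_0:
  fixes s :: "real \<Rightarrow> 'a \<Rightarrow> real"
  assumes "f \<in> borel_measurable M" "\<And>\<epsilon>. \<epsilon> > 0 \<Longrightarrow> s \<epsilon> \<in> borel_measurable M" "integrable M w"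
    and lim: "AE x in M. ((\<lambda>\<epsilon>. s \<epsilon> x) \<longlongrightarrow> f x) (at_right 0)"
    and bound: "\<forall>\<^sub>F \<epsilon> in at_right 0. AE x in M. norm (s \<epsilon> x) \<le> w x"
  shows "((\<lambda>\<epsilon>. LINT x|M. s \<epsilon> x) \<longlongrightarrow> (LINT x|M. f x)) (at_right 0)"
proof -
  define s' where "s' t = (if t > 0 then s (inverse t) else (\<lambda>_. 0))" for t
  have pos: "\<forall>\<^sub>F t::real in at_top. t > 0" by (rule eventually_gt_at_top)
  have "((\<lambda>t. LINT x|M. s' t x) \<longlongrightarrow> (LINT x|M. f x)) at_top"
  proof (rule integral_dominated_convergence_at_top[OF assms(1) _ assms(3)])
    show "s' t \<in> borel_measurable M" for t using assms(2)[of "inverse t"] by (simp add: s'_def)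
    show "AE x in M. ((\<lambda>t. s' t x) \<longlongrightarrow> f x) at_top"
      using lim
    proof eventually_elim
      case (elim x)
      hence "((\<lambda>t. s (inverse t) x) \<longlongrightarrow> f x) at_top" by (simp add: filterlim_at_right_to_top)
      moreover have "\<forall>\<^sub>F t in at_top. s (inverse t) x = s' t x"
        using pos by eventually_elim (simp add: s'_def)
      ultimately show ?case by (rule Lim_transform_eventually)
    qed
    have "\<forall>\<^sub>F t in at_top. AE x in M. norm (s (inverse t) x) \<le> w x"
      using bound by (simp add: eventually_at_right_to_top)
    thus "\<forall>\<^sub>F t in at_top. AE x in M. norm (s' t x) \<le> w x"
      using pos by eventually_elim (simp add: s'_def)
  qed
  moreover have "\<forall>\<^sub>F t in at_top. (LINT x|M. s' t x) = (LINT x|M. s (inverse t) x)"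
    using pos by eventually_elim (simp add: s'_def)
  ultimately have "((\<lambda>t. LINT x|M. s (inverse t) x) \<longlongrightarrow> (LINT x|M. f x)) at_top"
    by (rule Lim_transform_eventually)
  thus ?thesis by (simp add: filterlim_at_right_to_top)
qed

context touching_ball
begin

text \<open>Normal distances of order \<open>\<epsilon>\<close> and tangential distances of order \<open>\<surd>\<epsilon>\<close> are the scales on which both the layer and the
shape of the ball, with its second order contact, are visible.\<close>

definition stretch :: "real \<Rightarrow> 'n \<Rightarrow> real" where
  "stretch \<epsilon> j = (if j = k then \<epsilon> else sqrt \<epsilon>)"

definition zoom :: "real \<Rightarrow> real^'n \<Rightarrow> real^'n" where
  "zoom \<epsilon> \<zeta> = y0 + frame (\<chi> j. stretch \<epsilon> j * \<zeta> $ j)"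

lemma prod_stretch: assumes "\<epsilon> > 0" shows "(\<Prod>j\<in>UNIV. stretch \<epsilon> j) = \<epsilon> powr ((real CARD('n) + 1) / 2)"
proof -
  have "(\<Prod>j\<in>UNIV. stretch \<epsilon> j) = \<epsilon> * (\<Prod>j\<in>UNIV - {k}. sqrt \<epsilon>)"
    by (subst prod.remove[of UNIV k]) (auto simp: stretch_def intro!: prod.cong)
  also have "\<dots> = \<epsilon> powr 1 * (\<epsilon> powr (1/2)) powr (real (CARD('n) - 1))"
  proof -
    have "(\<Prod>j\<in>UNIV - {k}. sqrt \<epsilon>) = sqrt \<epsilon> ^ (CARD('n) - 1)" by simp
    also have "\<dots> = sqrt \<epsilon> powr (real (CARD('n) - 1))" using assms by (intro powr_realpow[symmetric]) simp
    finally show ?thesis using assms by (simp only: powr_half_sqrt less_imp_le powr_one)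
  qed
  also have "\<dots> = \<epsilon> powr ((real CARD('n) + 1) / 2)"
  proof -
    have "real (CARD('n) - 1) = real CARD('n) - 1" using zero_less_card_finite[where 'a='n] by linarith
    thus ?thesis using assms unfolding powr_powr powr_add[symmetric] by (simp add: field_simps)
  qed
  finally show ?thesis .
qed

lemma zoom_coords:
  assumes "\<epsilon> > 0"
  shows "tan2 (\<chi> j. stretch \<epsilon> j * \<zeta> $ j) = \<epsilon> * tan2 \<zeta>"
    "quad (\<chi> j. stretch \<epsilon> j * \<zeta> $ j) = \<epsilon> * quad \<zeta>"
    "(\<chi> j. stretch \<epsilon> j * \<zeta> $ j) $ k = \<epsilon> * \<zeta> $ k"
    "(zoom \<epsilon> \<zeta> - y0) \<bullet> \<nu> = \<epsilon> * \<zeta> $ k"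
    "(norm (zoom \<epsilon> \<zeta> - y0))\<^sup>2 = \<epsilon> * tan2 \<zeta> + \<epsilon>\<^sup>2 * (\<zeta> $ k)\<^sup>2"
proof -
  show 1: "tan2 (\<chi> j. stretch \<epsilon> j * \<zeta> $ j) = \<epsilon> * tan2 \<zeta>"
    using assms unfolding tan2_def sum_distrib_left
    by (intro sum.cong) (auto simp: stretch_def power_mult_distrib)
  show "quad (\<chi> j. stretch \<epsilon> j * \<zeta> $ j) = \<epsilon> * quad \<zeta>"
    using assms unfolding quad_def sum_distrib_left
    by (intro sum.cong) (auto simp: stretch_def power_mult_distrib)
  show 2: "(\<chi> j. stretch \<epsilon> j * \<zeta> $ j) $ k = \<epsilon> * \<zeta> $ k" by (simp add: stretch_def)
  show "(zoom \<epsilon> \<zeta> - y0) \<bullet> \<nu> = \<epsilon> * \<zeta> $ k" by (simp add: zoom_def frame_normal stretch_def)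
  show "(norm (zoom \<epsilon> \<zeta> - y0))\<^sup>2 = \<epsilon> * tan2 \<zeta> + \<epsilon>\<^sup>2 * (\<zeta> $ k)\<^sup>2"
    by (simp add: zoom_def norm_tan2 1 power_mult_distrib) (simp add: stretch_def power_mult_distrib)
qed

lemma zoom_in_ball:
  assumes "\<epsilon> > 0"
  shows "zoom \<epsilon> \<zeta> \<in> ball x R \<longleftrightarrow> tan2 \<zeta> + \<epsilon> * (\<zeta> $ k)\<^sup>2 < 2 * R * \<zeta> $ k"
proof -
  have "zoom \<epsilon> \<zeta> \<in> ball x R \<longleftrightarrow> \<epsilon> * (tan2 \<zeta> + \<epsilon> * (\<zeta> $ k)\<^sup>2) < \<epsilon> * (2 * R * \<zeta> $ k)"
    unfolding in_ball_iff zoom_coords[OF assms] by (simp add: algebra_simps power2_eq_square)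
  thus ?thesis by (simp only: mult_less_cancel_left_pos[OF assms])
qed

text \<open>The limit of the ball under zooming in.\<close>

definition paraboloid :: "(real^'n) set" where "paraboloid = {\<zeta>. tan2 \<zeta> < 2 * R * \<zeta> $ k}"

lemma zoom_ball_paraboloid: "\<epsilon> > 0 \<Longrightarrow> zoom \<epsilon> \<zeta> \<in> ball x R \<Longrightarrow> \<zeta> \<in> paraboloid"
  using zoom_in_ball[of \<epsilon> \<zeta>] unfolding paraboloid_def
  by (smt (verit) mem_Collect_eq mult_nonneg_nonneg zero_le_power2)

lemma eventually_zoom_in_ball:
  assumes "\<zeta> \<in> paraboloid"
  shows "\<forall>\<^sub>F \<epsilon> in at_right 0. zoom \<epsilon> \<zeta> \<in> ball x R"
proof -
  have "((\<lambda>\<epsilon>. tan2 \<zeta> + \<epsilon> * (\<zeta> $ k)\<^sup>2) \<longlongrightarrow> tan2 \<zeta> + 0 * (\<zeta> $ k)\<^sup>2) (at_right 0)"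
    by (intro tendsto_intros)
  hence "\<forall>\<^sub>F \<epsilon> in at_right 0. tan2 \<zeta> + \<epsilon> * (\<zeta> $ k)\<^sup>2 < 2 * R * \<zeta> $ k"
    using assms by (intro order_tendstoD) (auto simp: paraboloid_def)
  thus ?thesis using eventually_at_right_less[of 0]
    by eventually_elim (simp only: zoom_in_ball)
qed

lemma eventually_zoom_near:
  assumes "r > 0" shows "\<forall>\<^sub>F \<epsilon> in at_right 0. norm (zoom \<epsilon> \<zeta> - y0) \<le> r"
proof -
  have "((\<lambda>\<epsilon>. \<epsilon> * tan2 \<zeta> + \<epsilon>\<^sup>2 * (\<zeta> $ k)\<^sup>2) \<longlongrightarrow> 0 * tan2 \<zeta> + 0\<^sup>2 * (\<zeta> $ k)\<^sup>2) (at_right 0)"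
    by (intro tendsto_intros)
  hence "\<forall>\<^sub>F \<epsilon> in at_right 0. \<epsilon> * tan2 \<zeta> + \<epsilon>\<^sup>2 * (\<zeta> $ k)\<^sup>2 < r\<^sup>2"
    using assms by (intro order_tendstoD) auto
  thus ?thesis using eventually_at_right_less[of 0]
  proof eventually_elim
    case (elim \<epsilon>)
    hence "(norm (zoom \<epsilon> \<zeta> - y0))\<^sup>2 \<le> r\<^sup>2" by (simp add: zoom_coords)
    thus ?case using assms by (meson less_imp_le power2_le_imp_le)
  qed
qed

text \<open>At these scales only the second order part of \<open>f\<close> survives.\<close>

lemma height_zoom_limit: "((\<lambda>\<epsilon>. height (zoom \<epsilon> \<zeta>) / \<epsilon>) \<longlongrightarrow> \<zeta> $ k - quad \<zeta> / 2) (at_right 0)"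
proof (rule tendstoI)
  fix e :: real assume e: "e > 0"
  define \<eta> where "\<eta> = e / (2 * (tan2 \<zeta> + 1))"
  have t: "tan2 \<zeta> \<ge> 0" by (rule tan2_nonneg)
  have \<eta>: "\<eta> > 0" using e t by (simp add: \<eta>_def)
  have \<eta>e: "\<eta> * tan2 \<zeta> < e"
  proof -
    have "e / (2 * w) * w = e / 2" if "w \<noteq> 0" for w :: real using that by simp
    from this[of "tan2 \<zeta> + 1"] have "\<eta> * (tan2 \<zeta> + 1) = e / 2" using t by (simp only: \<eta>_def)
    thus ?thesis using \<eta> e by (simp add: algebra_simps)
  qed
  obtain r where r: "r > 0" "\<And>\<zeta>. tan2 \<zeta> < r \<Longrightarrow> \<bar>f (frame \<zeta>) - quad \<zeta> / 2\<bar> \<le> \<eta> * tan2 \<zeta>"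
    using f_frame_expansion[OF \<eta>] by blast
  have "((\<lambda>\<epsilon>. \<epsilon> * tan2 \<zeta>) \<longlongrightarrow> 0 * tan2 \<zeta>) (at_right 0)" by (intro tendsto_intros)
  hence "\<forall>\<^sub>F \<epsilon> in at_right 0. \<epsilon> * tan2 \<zeta> < r" using r(1) by (intro order_tendstoD) auto
  thus "\<forall>\<^sub>F \<epsilon> in at_right 0. dist (height (zoom \<epsilon> \<zeta>) / \<epsilon>) (\<zeta> $ k - quad \<zeta> / 2) < e"
    using eventually_at_right_less[of 0]
  proof eventually_elim
    case (elim \<epsilon>)
    define \<zeta>' where "\<zeta>' = (\<chi> j. stretch \<epsilon> j * \<zeta> $ j)"
    have A: "\<bar>f (frame \<zeta>') - \<epsilon> * quad \<zeta> / 2\<bar> \<le> \<eta> * (\<epsilon> * tan2 \<zeta>)"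
      using r(2)[of \<zeta>'] elim by (simp add: \<zeta>'_def zoom_coords)
    have hz: "height (zoom \<epsilon> \<zeta>) = \<epsilon> * \<zeta> $ k - f (frame \<zeta>')"
      using zoom_coords(4)[OF elim(2), of \<zeta>] by (simp add: height_def zoom_def \<zeta>'_def)
    have eq: "height (zoom \<epsilon> \<zeta>) / \<epsilon> - (\<zeta> $ k - quad \<zeta> / 2) = - (f (frame \<zeta>') - \<epsilon> * quad \<zeta> / 2) / \<epsilon>"
      unfolding hz using elim by (simp add: field_simps)
    have "\<bar>height (zoom \<epsilon> \<zeta>) / \<epsilon> - (\<zeta> $ k - quad \<zeta> / 2)\<bar> \<le> \<eta> * tan2 \<zeta>"
      unfolding eq abs_divide abs_minus_cancel using A elim by (simp add: pos_divide_le_eq mult_ac)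
    thus ?case using \<eta>e by (simp add: dist_real_def)
  qed
qed

end

lemma exp_over_powr_tendsto_0:
  fixes a b :: real
  assumes "a > 0"
  shows "((\<lambda>\<epsilon>. exp (- a / \<epsilon>) * \<epsilon> powr b) \<longlongrightarrow> 0) (at_right 0)"
  using assms by real_asymp

lemma powr_tendsto_0:
  fixes b :: real
  assumes "b > 0"
  shows "((\<lambda>\<epsilon>. \<epsilon> powr b) \<longlongrightarrow> 0) (at_right 0)"
  using assms by real_asymp

lemma exp_tendsto_0:
  fixes a :: real
  assumes "a > 0"
  shows "((\<lambda>\<epsilon>. exp (- a / \<epsilon>)) \<longlongrightarrow> 0) (at_right 0)"
  using assms by real_asymp

context touching_ball_solutions
begin

lemma u_ball_range: "\<epsilon> > 0 \<Longrightarrow> y \<in> ball x R \<Longrightarrow> 0 \<le> u \<epsilon> y \<and> u \<epsilon> y \<le> 1"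
  using u_range[of \<epsilon> y] ball_closure by blast

lemma u_ball_cont: "\<epsilon> > 0 \<Longrightarrow> continuous_on (ball x R) (u \<epsilon>)"
  by (rule continuous_on_subset[OF u_cont ball_closure])

text \<open>For every \<open>\<delta>\<close> the estimates near the contact point pin down the limit up to the factor \<open>(1 \<plusminus> \<delta>)\<^sup>2\<close> in the exponent;
then \<open>\<delta>\<close> tends to \<open>0\<close>.\<close>

lemma u_zoom_limit:
  assumes \<zeta>: "\<zeta> \<in> paraboloid"
  shows "((\<lambda>\<epsilon>. u \<epsilon> (zoom \<epsilon> \<zeta>)) \<longlongrightarrow> exp (- sqrt P * (\<zeta> $ k - quad \<zeta> / 2))) (at_right 0)"
proof -
  define a where "a = \<zeta> $ k - quad \<zeta> / 2"
  have e: "((\<lambda>\<epsilon>. exp (- (b * sqrt P * height (zoom \<epsilon> \<zeta>)) / \<epsilon>)) \<longlongrightarrow> exp (- (b * sqrt P) * a)) (at_right 0)" for b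
  proof -
    have "((\<lambda>\<epsilon>. exp (- (b * sqrt P) * (height (zoom \<epsilon> \<zeta>) / \<epsilon>))) \<longlongrightarrow> exp (- (b * sqrt P) * a)) (at_right 0)"
      unfolding a_def by (intro tendsto_intros height_zoom_limit)
    thus ?thesis by simp
  qed
  have side: "\<forall>\<^sub>F \<epsilon> in at_right 0. s * u \<epsilon> (zoom \<epsilon> \<zeta>) < l"
    if s: "s = 1 \<or> s = -1" and l: "s * exp (- sqrt P * a) < l" for s l
  proof -
    have "((\<lambda>\<delta>. s * exp (- ((1 - s * \<delta>)\<^sup>2 * sqrt P) * a)) \<longlongrightarrow> s * exp (- ((1 - s * 0)\<^sup>2 * sqrt P) * a)) (at_right 0)"
      by (intro tendsto_intros)
    hence "\<forall>\<^sub>F \<delta> in at_right 0. s * exp (- ((1 - s * \<delta>)\<^sup>2 * sqrt P) * a) < l"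
      using l by (intro order_tendstoD) auto
    moreover have "\<forall>\<^sub>F \<delta>::real in at_right 0. \<delta> \<in> {0<..<1}" by (rule eventually_at_right_real) auto
    ultimately have "\<forall>\<^sub>F \<delta> in at_right 0. s * exp (- ((1 - s * \<delta>)\<^sup>2 * sqrt P) * a) < l \<and> \<delta> \<in> {0<..<1}"
      by eventually_elim auto
    then obtain \<delta> where \<delta>: "0 < \<delta>" "\<delta> < 1" "s * exp (- ((1 - s * \<delta>)\<^sup>2 * sqrt P) * a) < l"
      using eventually_happens'[OF trivial_limit_at_right_real] by force
    obtain r c \<epsilon>1 where b: "r > 0" "c > 0" "\<epsilon>1 > 0"
      "\<And>\<epsilon> z. 0 < \<epsilon> \<Longrightarrow> \<epsilon> < \<epsilon>1 \<Longrightarrow> z \<in> ball x R \<Longrightarrow> norm (z - y0) \<le> r \<Longrightarrow>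
         s * u \<epsilon> z \<le> s * exp (- ((1 - s * \<delta>)\<^sup>2 * sqrt P * height z) / \<epsilon>) + exp (- c / \<epsilon>)"
      by (rule pointwise_estimate[OF s \<delta>(1,2)]) auto
    have "((\<lambda>\<epsilon>. s * exp (- ((1 - s * \<delta>)\<^sup>2 * sqrt P * height (zoom \<epsilon> \<zeta>)) / \<epsilon>) + exp (- c / \<epsilon>))
       \<longlongrightarrow> s * exp (- ((1 - s * \<delta>)\<^sup>2 * sqrt P) * a) + 0) (at_right 0)"
      by (intro tendsto_add tendsto_mult tendsto_const e exp_tendsto_0 b)
    hence "\<forall>\<^sub>F \<epsilon> in at_right 0. s * exp (- ((1 - s * \<delta>)\<^sup>2 * sqrt P * height (zoom \<epsilon> \<zeta>)) / \<epsilon>) + exp (- c / \<epsilon>) < l"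
      using \<delta>(3) by (intro order_tendstoD) auto
    moreover have "\<forall>\<^sub>F \<epsilon> in at_right 0. \<epsilon> \<in> {0<..<\<epsilon>1}" using b by (intro eventually_at_right_real) auto
    ultimately show ?thesis
      using eventually_zoom_in_ball[OF \<zeta>] eventually_zoom_near[OF b(1), of \<zeta>]
    proof eventually_elim
      case (elim \<epsilon>)
      have "s * u \<epsilon> (zoom \<epsilon> \<zeta>)
          \<le> s * exp (- ((1 - s * \<delta>)\<^sup>2 * sqrt P * height (zoom \<epsilon> \<zeta>)) / \<epsilon>) + exp (- c / \<epsilon>)"
        using elim by (intro b(4)) auto
      thus ?case using elim(1) by linarith
    qed
  qed
  show ?thesis unfolding a_def[symmetric]
  proof (rule order_tendstoI)
    fix l assume "l < exp (- sqrt P * a)"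
    thus "\<forall>\<^sub>F \<epsilon> in at_right 0. l < u \<epsilon> (zoom \<epsilon> \<zeta>)" using side[of "-1" "- l"] by simp
  next
    fix l assume "l > exp (- sqrt P * a)"
    thus "\<forall>\<^sub>F \<epsilon> in at_right 0. u \<epsilon> (zoom \<epsilon> \<zeta>) < l" using side[of 1 l] by simp
  qed
qed

text \<open>The value of the paraboloid integral with \<open>a = m \<surd>p'\<close>.\<close>

definition boundary_mass :: "real \<Rightarrow> real" where
  "boundary_mass m = 1 / (m * sqrt P) * (\<Prod>j\<in>UNIV - {k}. sqrt (2 * pi / (m * sqrt P * (1 / R - \<kappa> (\<sigma> j)))))"

lemma paraboloid_mass:
  assumes m: "m > 0"
  shows "(LINT \<zeta>|lborel. indicator paraboloid \<zeta> * exp (- sqrt P * (\<zeta> $ k - quad \<zeta> / 2)) powr m) = boundary_mass m"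
    and "boundary_mass m > 0"
proof -
  have a: "m * sqrt P > 0" using m P_pos by simp
  have \<kappa>: "\<kappa> (\<sigma> j) < 1 / R" if "j \<noteq> k" for j using curv \<sigma>_in[OF that] by blast
  show pos: "boundary_mass m > 0" unfolding boundary_mass_def
    using a \<kappa> by (intro mult_pos_pos prod_pos) (auto intro!: divide_pos_pos mult_pos_pos)
  have e: "indicator paraboloid \<zeta> * exp (- sqrt P * (\<zeta> $ k - quad \<zeta> / 2)) powr m
      = indicator {\<zeta> :: real^'n. (\<Sum>j\<in>UNIV - {k}. (\<zeta> $ j)\<^sup>2) < 2 * R * \<zeta> $ k} \<zeta>
           * exp (- (m * sqrt P) * (\<zeta> $ k - (\<Sum>j\<in>UNIV - {k}. \<kappa> (\<sigma> j) * (\<zeta> $ j)\<^sup>2) / 2))" for \<zeta>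
    by (simp add: paraboloid_def tan2_def quad_def exp_powr_real mult_ac)
  show "(LINT \<zeta>|lborel. indicator paraboloid \<zeta> * exp (- sqrt P * (\<zeta> $ k - quad \<zeta> / 2)) powr m) = boundary_mass m"
    unfolding e
  proof (subst integral_eq_nn_integral)
    show "enn2real (\<integral>\<^sup>+\<zeta>. ennreal (indicator {\<zeta> :: real^'n. (\<Sum>j\<in>UNIV - {k}. (\<zeta> $ j)\<^sup>2) < 2 * R * \<zeta> $ k} \<zeta>
           * exp (- (m * sqrt P) * (\<zeta> $ k - (\<Sum>j\<in>UNIV - {k}. \<kappa> (\<sigma> j) * (\<zeta> $ j)\<^sup>2) / 2))) \<partial>lborel) = boundary_mass m"
    proof (subst paraboloid_integral[OF a R])
      show "enn2real (ennreal (1 / (m * sqrt P) * (\<Prod>j\<in>UNIV - {k}. sqrt (2 * pi / (m * sqrt P * (1 / R - \<kappa> (\<sigma> j))))))) = boundary_mass m"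
        unfolding boundary_mass_def[symmetric] using pos by simp
    qed (rule \<kappa>)
  qed (auto intro!: AE_I2)
qed

lemma dominant_integrable:
  assumes m: "m > 0" and c: "c > 0"
  shows "integrable lborel (\<lambda>\<zeta> :: real^'n. indicator paraboloid \<zeta> * (2 * exp (- c * \<zeta> $ k)) powr m)"
proof -
  have a: "m * c > 0" using m c by simp
  define g where "g \<zeta> = indicator {\<zeta> :: real^'n. (\<Sum>j\<in>UNIV - {k}. (\<zeta> $ j)\<^sup>2) < 2 * R * \<zeta> $ k} \<zeta>
           * exp (- (m * c) * (\<zeta> $ k - (\<Sum>j\<in>UNIV - {k}. 0 * (\<zeta> $ j)\<^sup>2) / 2))" for \<zeta> :: "real^'n"
  have "integrable lborel g"
  proof (rule integrableI_nonneg)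
    have "(\<integral>\<^sup>+\<zeta>. ennreal (g \<zeta>) \<partial>lborel) = ennreal (1 / (m * c) * (\<Prod>j\<in>UNIV - {k}. sqrt (2 * pi / (m * c * (1 / R - 0)))))"
      unfolding g_def using R by (intro paraboloid_integral[OF a R, where \<kappa>="\<lambda>_. 0"]) auto
    thus "(\<integral>\<^sup>+\<zeta>. ennreal (g \<zeta>) \<partial>lborel) < \<infinity>" by simp
    show "g \<in> borel_measurable lborel" unfolding g_def by measurable
  qed (auto simp: g_def)
  hence "integrable lborel (\<lambda>\<zeta>. 2 powr m * g \<zeta>)" by simp
  moreover have "2 powr m * g \<zeta> = indicator paraboloid \<zeta> * (2 * exp (- c * \<zeta> $ k)) powr m" for \<zeta>
    by (simp add: g_def paraboloid_def tan2_def powr_mult exp_powr_real mult_ac)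
  ultimately show ?thesis by simp
qed

lemma zoom_measurable: "zoom \<epsilon> \<in> borel_measurable borel"
proof -
  have "bounded_linear frame" using linear_frame by (simp add: linear_conv_bounded_linear)
  thus ?thesis unfolding zoom_def[abs_def]
    by (intro borel_measurable_continuous_onI continuous_intros bounded_linear.continuous_on[of frame])
qed

text \<open>Dominated convergence after zooming in; the threshold \<open>c \<epsilon>\<close> disappears in the limit.\<close>

lemma upper_part_limit:
  assumes m: "m > 0" and c: "\<And>\<epsilon>. \<epsilon> > 0 \<Longrightarrow> c \<epsilon> \<ge> 0" "(c \<longlongrightarrow> 0) (at_right 0)"
  shows "((\<lambda>\<epsilon>. \<epsilon> powr (- ((real CARD('n) + 1) / 2)) * (LINT y:ball x R|lborel. max (u \<epsilon> y - c \<epsilon>) 0 powr m))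
     \<longlongrightarrow> boundary_mass m) (at_right 0)"
proof -
  define h where "h \<epsilon> y = indicator (ball x R) y *\<^sub>R (max (u \<epsilon> y - c \<epsilon>) 0 powr m)" for \<epsilon> y
  define s where "s \<epsilon> \<zeta> = h \<epsilon> (zoom \<epsilon> \<zeta>)" for \<epsilon> \<zeta>
  have hm: "h \<epsilon> \<in> borel_measurable borel" if "\<epsilon> > 0" for \<epsilon>
    unfolding h_def[abs_def]
  proof (rule ball_indicator_measurable)
    show "continuous_on (ball x R) (\<lambda>y. max (u \<epsilon> y - c \<epsilon>) 0 powr m)"
      using u_ball_cont[OF that] m by (intro continuous_on_powr' continuous_intros) auto
  qed
  obtain c2 \<epsilon>1 where ub: "c2 > 0" "\<epsilon>1 > 0"
    "\<And>\<epsilon> z. 0 < \<epsilon> \<Longrightarrow> \<epsilon> < \<epsilon>1 \<Longrightarrow> z \<in> ball x R \<Longrightarrow>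
       u \<epsilon> z \<le> 2 * exp (- (c2 * ((z - y0) \<bullet> \<nu>)) / \<epsilon>)"
    by (rule uniform_upper) auto
  have "((\<lambda>\<epsilon>. LINT \<zeta>|lborel. s \<epsilon> \<zeta>) \<longlongrightarrow>
      (LINT \<zeta>|lborel. indicator paraboloid \<zeta> * exp (- sqrt P * (\<zeta> $ k - quad \<zeta> / 2)) powr m)) (at_right 0)"
  proof (rule dominated_convergence_at_right_0[OF _ _ dominant_integrable[OF m ub(1)]])
    show "(\<lambda>\<zeta>. indicator paraboloid \<zeta> * exp (- sqrt P * (\<zeta> $ k - quad \<zeta> / 2)) powr m) \<in> borel_measurable lborel"
      unfolding paraboloid_def tan2_def quad_def by measurable
    show "s \<epsilon> \<in> borel_measurable lborel" if "\<epsilon> > 0" for \<epsilon>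
      using measurable_compose[OF zoom_measurable hm[OF that]] by (simp add: s_def[abs_def])
    show "AE \<zeta> in lborel. ((\<lambda>\<epsilon>. s \<epsilon> \<zeta>) \<longlongrightarrow> indicator paraboloid \<zeta> * exp (- sqrt P * (\<zeta> $ k - quad \<zeta> / 2)) powr m) (at_right 0)"
    proof (rule AE_I2)
      fix \<zeta>
      show "((\<lambda>\<epsilon>. s \<epsilon> \<zeta>) \<longlongrightarrow> indicator paraboloid \<zeta> * exp (- sqrt P * (\<zeta> $ k - quad \<zeta> / 2)) powr m) (at_right 0)"
      proof (cases "\<zeta> \<in> paraboloid")
        case True
        have "((\<lambda>\<epsilon>. max (u \<epsilon> (zoom \<epsilon> \<zeta>) - c \<epsilon>) 0 powr m) \<longlongrightarrow>
            max (exp (- sqrt P * (\<zeta> $ k - quad \<zeta> / 2)) - 0) 0 powr m) (at_right 0)"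
          using m by (intro tendsto_powr' tendsto_intros u_zoom_limit[OF True] c(2)) auto
        moreover have "\<forall>\<^sub>F \<epsilon> in at_right 0. max (u \<epsilon> (zoom \<epsilon> \<zeta>) - c \<epsilon>) 0 powr m = s \<epsilon> \<zeta>"
          using eventually_zoom_in_ball[OF True] by eventually_elim (simp add: s_def h_def)
        ultimately have "((\<lambda>\<epsilon>. s \<epsilon> \<zeta>) \<longlongrightarrow> max (exp (- sqrt P * (\<zeta> $ k - quad \<zeta> / 2)) - 0) 0 powr m) (at_right 0)"
          by (rule Lim_transform_eventually)
        moreover have "max (exp (- sqrt P * (\<zeta> $ k - quad \<zeta> / 2)) - 0) 0 = exp (- sqrt P * (\<zeta> $ k - quad \<zeta> / 2))"
          using exp_ge_zero[of "- sqrt P * (\<zeta> $ k - quad \<zeta> / 2)"] by (simp add: max_def)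
        ultimately show ?thesis using True by simp
      next
        case False
        have "\<forall>\<^sub>F \<epsilon> in at_right 0. s \<epsilon> \<zeta> = 0"
          using eventually_at_right_less[of 0]
          by eventually_elim (use False zoom_ball_paraboloid in \<open>auto simp: s_def h_def indicator_def\<close>)
        thus ?thesis using False by (auto intro: tendsto_eventually)
      qed
    qed
    have "\<forall>\<^sub>F \<epsilon>::real in at_right 0. \<epsilon> \<in> {0<..<\<epsilon>1}" by (rule eventually_at_right_real) (use ub in auto)
    thus "\<forall>\<^sub>F \<epsilon> in at_right 0. AE \<zeta> in lborel. norm (s \<epsilon> \<zeta>) \<le> indicator paraboloid \<zeta> * (2 * exp (- c2 * \<zeta> $ k)) powr m"
    proof eventually_elim
      case (elim \<epsilon>)
      hence \<epsilon>: "0 < \<epsilon>" "\<epsilon> < \<epsilon>1" by auto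
      show ?case
      proof (rule AE_I2)
        fix \<zeta>
        show "norm (s \<epsilon> \<zeta>) \<le> indicator paraboloid \<zeta> * (2 * exp (- c2 * \<zeta> $ k)) powr m"
        proof (cases "zoom \<epsilon> \<zeta> \<in> ball x R")
          case True
          have "u \<epsilon> (zoom \<epsilon> \<zeta>) \<le> 2 * exp (- c2 * \<zeta> $ k)"
            using ub(3)[OF \<epsilon> True] \<epsilon> by (simp add: zoom_coords)
          hence "max (u \<epsilon> (zoom \<epsilon> \<zeta>) - c \<epsilon>) 0 \<le> 2 * exp (- c2 * \<zeta> $ k)"
            using c(1)[OF \<epsilon>(1)] by simp
          hence "max (u \<epsilon> (zoom \<epsilon> \<zeta>) - c \<epsilon>) 0 powr m \<le> (2 * exp (- c2 * \<zeta> $ k)) powr m"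
            using m by (intro powr_mono2) auto
          thus ?thesis using True zoom_ball_paraboloid[OF \<epsilon>(1) True] by (simp add: s_def h_def)
        qed (simp add: s_def h_def)
      qed
    qed
  qed
  hence lim: "((\<lambda>\<epsilon>. LINT \<zeta>|lborel. s \<epsilon> \<zeta>) \<longlongrightarrow> boundary_mass m) (at_right 0)"
    by (simp only: paraboloid_mass[OF m])
  have "\<forall>\<^sub>F \<epsilon> in at_right 0. (LINT \<zeta>|lborel. s \<epsilon> \<zeta>)
     = \<epsilon> powr (- ((real CARD('n) + 1) / 2)) * (LINT y:ball x R|lborel. max (u \<epsilon> y - c \<epsilon>) 0 powr m)"
    using eventually_at_right_less[of 0]
  proof eventually_elim
    case (elim \<epsilon>)
    have "(LINT y|lborel. h \<epsilon> y) = (\<Prod>j\<in>UNIV. stretch \<epsilon> j) * (LINT \<zeta>|lborel. s \<epsilon> \<zeta>)"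
      unfolding s_def zoom_def using elim
      by (intro lborel_integral_frame[OF orthogonal_frame _ hm[OF elim]]) (auto simp: stretch_def)
    thus ?case using elim
      by (simp add: prod_stretch[OF elim] h_def set_lebesgue_integral_def powr_minus field_simps)
  qed
  from Lim_transform_eventually[OF lim this] show ?thesis .
qed

text \<open>Dominated convergence without zooming: at each point of the ball \<open>u\<close> is exponentially small, hence negligible compared with
the threshold, which is a power of \<open>\<epsilon>\<close>.\<close>

lemma lower_part_limit:
  assumes m: "m > 0" and t: "t > 0"
  shows "((\<lambda>\<epsilon>. \<epsilon> powr (- ((real CARD('n) + 1) / 2)) * (LINT y:ball x R|lborel. max (t * \<epsilon> powr (((real CARD('n) + 1) / 2) / m) - u \<epsilon> y) 0 powr m))
     \<longlongrightarrow> t powr m * measure lborel (ball x R)) (at_right 0)"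
proof -
  define c where "c \<epsilon> = t * \<epsilon> powr (((real CARD('n) + 1) / 2) / m)" for \<epsilon>
  have cpos: "c \<epsilon> > 0" if "\<epsilon> > 0" for \<epsilon> using that t by (simp add: c_def)
  define s where "s \<epsilon> y = indicator (ball x R) y *\<^sub>R (t powr m * max (1 - u \<epsilon> y / c \<epsilon>) 0 powr m)" for \<epsilon> y
  obtain c2 \<epsilon>1 where ub: "c2 > 0" "\<epsilon>1 > 0"
    "\<And>\<epsilon> z. 0 < \<epsilon> \<Longrightarrow> \<epsilon> < \<epsilon>1 \<Longrightarrow> z \<in> ball x R \<Longrightarrow>
       u \<epsilon> z \<le> 2 * exp (- (c2 * ((z - y0) \<bullet> \<nu>)) / \<epsilon>)"
    by (rule uniform_upper) auto
  have small: "((\<lambda>\<epsilon>. u \<epsilon> y / c \<epsilon>) \<longlongrightarrow> 0) (at_right 0)" if y: "y \<in> ball x R" for y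
  proof -
    have "0 \<le> (norm (y - y0))\<^sup>2" by simp
    hence "0 < 2 * R * ((y - y0) \<bullet> \<nu>)" using in_ball_iff[THEN iffD1, OF y] by linarith
    hence "(y - y0) \<bullet> \<nu> > 0" using R by (simp add: zero_less_mult_iff)
    hence a: "c2 * ((y - y0) \<bullet> \<nu>) > 0" using ub by simp
    have "((\<lambda>\<epsilon>. 2 / t * (exp (- (c2 * ((y - y0) \<bullet> \<nu>)) / \<epsilon>) * \<epsilon> powr (- (((real CARD('n) + 1) / 2) / m)))) \<longlongrightarrow> 2 / t * 0) (at_right 0)"
      by (intro tendsto_intros exp_over_powr_tendsto_0 a)
    hence lim: "((\<lambda>\<epsilon>. 2 / t * (exp (- (c2 * ((y - y0) \<bullet> \<nu>)) / \<epsilon>) * \<epsilon> powr (- (((real CARD('n) + 1) / 2) / m)))) \<longlongrightarrow> 0) (at_right 0)"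
      by simp
    have ev: "\<forall>\<^sub>F \<epsilon>::real in at_right 0. \<epsilon> \<in> {0<..<\<epsilon>1}" by (rule eventually_at_right_real) (use ub in auto)
    show ?thesis
    proof (rule tendsto_sandwich[OF _ _ tendsto_const lim])
      show "\<forall>\<^sub>F \<epsilon> in at_right 0. 0 \<le> u \<epsilon> y / c \<epsilon>"
        using ev by eventually_elim (use u_ball_range y cpos in \<open>auto intro!: divide_nonneg_pos\<close>)
      show "\<forall>\<^sub>F \<epsilon> in at_right 0. u \<epsilon> y / c \<epsilon> \<le> 2 / t * (exp (- (c2 * ((y - y0) \<bullet> \<nu>)) / \<epsilon>) * \<epsilon> powr (- (((real CARD('n) + 1) / 2) / m)))"
        using ev
      proof eventually_elim
        case (elim \<epsilon>)
        hence \<epsilon>: "0 < \<epsilon>" "\<epsilon> < \<epsilon>1" by auto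
        have "u \<epsilon> y / c \<epsilon> \<le> 2 * exp (- (c2 * ((y - y0) \<bullet> \<nu>)) / \<epsilon>) / c \<epsilon>"
          using ub(3)[OF \<epsilon> y] cpos[OF \<epsilon>(1)] by (intro divide_right_mono) auto
        also have "\<dots> = 2 / t * (exp (- (c2 * ((y - y0) \<bullet> \<nu>)) / \<epsilon>) * \<epsilon> powr (- (((real CARD('n) + 1) / 2) / m)))"
          unfolding c_def powr_minus inverse_eq_divide by simp
        finally show ?case .
      qed
    qed
  qed
  have "((\<lambda>\<epsilon>. LINT y|lborel. s \<epsilon> y) \<longlongrightarrow> (LINT y|lborel. indicator (ball x R) y *\<^sub>R (t powr m))) (at_right 0)"
  proof (rule dominated_convergence_at_right_0[where w = "\<lambda>y. indicator (ball x R) y *\<^sub>R (t powr m)"])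
    show "s \<epsilon> \<in> borel_measurable lborel" if "\<epsilon> > 0" for \<epsilon>
    proof -
      have "continuous_on (ball x R) (\<lambda>y. t powr m * max (1 - u \<epsilon> y / c \<epsilon>) 0 powr m)"
        using u_ball_cont[OF that] m cpos[OF that] by (intro continuous_on_powr' continuous_intros) auto
      from ball_indicator_measurable[OF this] show ?thesis by (simp add: s_def[abs_def])
    qed
    show "integrable lborel (\<lambda>y. indicator (ball x R) y *\<^sub>R (t powr m))"
      using emeasure_lborel_ball_finite[of x R] by (simp add: integrable_real_indicator)
    show "AE y in lborel. ((\<lambda>\<epsilon>. s \<epsilon> y) \<longlongrightarrow> indicator (ball x R) y *\<^sub>R (t powr m)) (at_right 0)"
    proof (rule AE_I2)
      fix y
      show "((\<lambda>\<epsilon>. s \<epsilon> y) \<longlongrightarrow> indicator (ball x R) y *\<^sub>R (t powr m)) (at_right 0)"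
      proof (cases "y \<in> ball x R")
        case True
        have "((\<lambda>\<epsilon>. t powr m * max (1 - u \<epsilon> y / c \<epsilon>) 0 powr m) \<longlongrightarrow> t powr m * max (1 - 0) 0 powr m) (at_right 0)"
          using m by (intro tendsto_mult tendsto_const tendsto_powr' tendsto_max tendsto_diff small[OF True]) auto
        thus ?thesis using True by (simp add: s_def)
      qed (simp add: s_def)
    qed
    show "\<forall>\<^sub>F \<epsilon> in at_right 0. AE y in lborel. norm (s \<epsilon> y) \<le> indicator (ball x R) y *\<^sub>R (t powr m)"
      using eventually_at_right_less[of 0]
    proof eventually_elim
      case (elim \<epsilon>)
      show ?case
      proof (rule AE_I2)
        fix y
        have "max (1 - u \<epsilon> y / c \<epsilon>) 0 powr m \<le> 1 powr m" if "y \<in> ball x R"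
          using u_ball_range[OF elim that] cpos[OF elim] m by (intro powr_mono2) auto
        hence "t powr m * max (1 - u \<epsilon> y / c \<epsilon>) 0 powr m \<le> t powr m * 1" if "y \<in> ball x R"
          using that by (intro mult_left_mono) auto
        thus "norm (s \<epsilon> y) \<le> indicator (ball x R) y *\<^sub>R (t powr m)"
          by (auto simp: s_def indicator_def abs_mult)
      qed
    qed
    show "(\<lambda>y. indicator (ball x R) y *\<^sub>R (t powr m)) \<in> borel_measurable lborel"
      using ball_indicator_measurable[OF continuous_on_const[of "ball x R" "t powr m"]] by simp
  qed
  hence lim: "((\<lambda>\<epsilon>. LINT y|lborel. s \<epsilon> y) \<longlongrightarrow> t powr m * measure lborel (ball x R)) (at_right 0)"
    by (simp add: mult.commute)
  have "\<forall>\<^sub>F \<epsilon> in at_right 0. (LINT y|lborel. s \<epsilon> y)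
     = \<epsilon> powr (- ((real CARD('n) + 1) / 2)) * (LINT y:ball x R|lborel. max (t * \<epsilon> powr (((real CARD('n) + 1) / 2) / m) - u \<epsilon> y) 0 powr m)"
    using eventually_at_right_less[of 0]
  proof eventually_elim
    case (elim \<epsilon>)
    have "s \<epsilon> y = \<epsilon> powr (- ((real CARD('n) + 1) / 2)) * (indicator (ball x R) y *\<^sub>R max (c \<epsilon> - u \<epsilon> y) 0 powr m)" for y
    proof -
      have "max (c \<epsilon> - u \<epsilon> y) 0 = c \<epsilon> * max (1 - u \<epsilon> y / c \<epsilon>) 0"
        using cpos[OF elim] by (simp add: max_def field_simps)
      hence "max (c \<epsilon> - u \<epsilon> y) 0 powr m = c \<epsilon> powr m * max (1 - u \<epsilon> y / c \<epsilon>) 0 powr m"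
        using cpos[OF elim] by (simp add: powr_mult)
      moreover have "c \<epsilon> powr m = t powr m * \<epsilon> powr ((real CARD('n) + 1) / 2)"
        using t m elim by (simp add: c_def powr_mult powr_powr)
      moreover have "\<epsilon> powr (- ((real CARD('n) + 1) / 2)) * \<epsilon> powr ((real CARD('n) + 1) / 2) = 1"
        using elim by (simp add: powr_minus)
      ultimately show ?thesis by (simp add: s_def algebra_simps)
    qed
    thus ?case by (simp add: set_lebesgue_integral_def c_def)
  qed
  from Lim_transform_eventually[OF lim this] show ?thesis .
qed

lemma mean_gap_limit:
  assumes m: "m > 0" and t: "t > 0"
  shows "((\<lambda>\<epsilon>. \<epsilon> powr (- ((real CARD('n) + 1) / 2)) * mean_gap m (ball x R) (u \<epsilon>) (t * \<epsilon> powr (((real CARD('n) + 1) / 2) / m)))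
     \<longlongrightarrow> boundary_mass m - t powr m * measure lborel (ball x R)) (at_right 0)"
proof -
  define c where "c \<epsilon> = t * \<epsilon> powr (((real CARD('n) + 1) / 2) / m)" for \<epsilon>
  have "((\<lambda>\<epsilon>. t * \<epsilon> powr (((real CARD('n) + 1) / 2) / m)) \<longlongrightarrow> t * 0) (at_right 0)"
    by (intro tendsto_mult tendsto_const powr_tendsto_0) (use m in \<open>auto intro!: divide_pos_pos add_pos_pos\<close>)
  hence c0: "(c \<longlongrightarrow> 0) (at_right 0)" by (simp add: c_def[abs_def])
  have "((\<lambda>\<epsilon>. \<epsilon> powr (- ((real CARD('n) + 1) / 2)) * (LINT y:ball x R|lborel. max (u \<epsilon> y - c \<epsilon>) 0 powr m)
      - \<epsilon> powr (- ((real CARD('n) + 1) / 2)) * (LINT y:ball x R|lborel. max (c \<epsilon> - u \<epsilon> y) 0 powr m))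
     \<longlongrightarrow> boundary_mass m - t powr m * measure lborel (ball x R)) (at_right 0)"
    by (rule tendsto_diff[OF upper_part_limit[OF m _ c0] lower_part_limit[OF m t, folded c_def]])
       (use t in \<open>auto simp: c_def\<close>)
  moreover have "\<forall>\<^sub>F \<epsilon> in at_right 0. \<epsilon> powr (- ((real CARD('n) + 1) / 2)) * (LINT y:ball x R|lborel. max (u \<epsilon> y - c \<epsilon>) 0 powr m)
      - \<epsilon> powr (- ((real CARD('n) + 1) / 2)) * (LINT y:ball x R|lborel. max (c \<epsilon> - u \<epsilon> y) 0 powr m)
    = \<epsilon> powr (- ((real CARD('n) + 1) / 2)) * mean_gap m (ball x R) (u \<epsilon>) (c \<epsilon>)"
    using eventually_at_right_less[of 0]
  proof eventually_elim
    case (elim \<epsilon>)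
    have uc: "continuous_on (ball x R) (u \<epsilon>)" using u_ball_cont[OF elim] .
    have b: "\<bar>u \<epsilon> y\<bar> \<le> 1" if "y \<in> ball x R" for y using u_ball_range[OF elim that] by auto
    have "set_integrable lborel (ball x R) (\<lambda>y. max (u \<epsilon> y - c \<epsilon>) 0 powr m)"
    proof (rule ball_set_integrable[of _ _ _ "(1 + \<bar>c \<epsilon>\<bar>) powr m"])
      show "continuous_on (ball x R) (\<lambda>y. max (u \<epsilon> y - c \<epsilon>) 0 powr m)"
        using uc m by (intro continuous_on_powr' continuous_intros) auto
      fix y assume "y \<in> ball x R"
      from b[OF this] show "\<bar>max (u \<epsilon> y - c \<epsilon>) 0 powr m\<bar> \<le> (1 + \<bar>c \<epsilon>\<bar>) powr m"
        using m by (auto intro!: powr_mono2)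
    qed
    moreover have "set_integrable lborel (ball x R) (\<lambda>y. max (c \<epsilon> - u \<epsilon> y) 0 powr m)"
    proof (rule ball_set_integrable[of _ _ _ "(1 + \<bar>c \<epsilon>\<bar>) powr m"])
      show "continuous_on (ball x R) (\<lambda>y. max (c \<epsilon> - u \<epsilon> y) 0 powr m)"
        using uc m by (intro continuous_on_powr' continuous_intros) auto
      fix y assume "y \<in> ball x R"
      from b[OF this] show "\<bar>max (c \<epsilon> - u \<epsilon> y) 0 powr m\<bar> \<le> (1 + \<bar>c \<epsilon>\<bar>) powr m"
        using m by (auto intro!: powr_mono2)
    qed
    ultimately show ?case
      unfolding mean_gap_def signed_powr_def minus_diff_eq
      by (subst set_integral_diff(2)) (auto simp: algebra_simps)
  qed
  ultimately show ?thesis unfolding c_def by (rule Lim_transform_eventually)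
qed

text \<open>The limit of the rescaled gap changes sign exactly at the asserted value of \<open>t\<close>, so any smaller and any larger
multiple of the power of \<open>\<epsilon>\<close> eventually bounds the mean from below and from above.\<close>

lemma q_mean_limit:
  assumes q: "q > 1"
  shows "((\<lambda>\<epsilon>. \<epsilon> powr (- (((real CARD('n) + 1) / 2) / (q - 1))) * q_mean (ereal q) (ball x R) (u \<epsilon>))
    \<longlongrightarrow> (boundary_mass (q - 1) / measure lborel (ball x R)) powr (1 / (q - 1))) (at_right 0)"
proof -
  define m where "m = q - 1"
  have m: "m > 0" using q by (simp add: m_def)
  define vol where "vol = measure lborel (ball x R)"
  have vol: "vol > 0" using R by (simp add: vol_def)
  have bm: "boundary_mass m > 0" by (rule paraboloid_mass(2)[OF m])
  define \<tau> where "\<tau> = (boundary_mass m / vol) powr (1 / m)"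
  have \<tau>: "\<tau> > 0" using bm vol by (simp add: \<tau>_def)
  have \<tau>m: "\<tau> powr m * vol = boundary_mass m" using bm vol m by (simp add: \<tau>_def powr_powr)
  have pw: "\<epsilon> powr (- (((real CARD('n) + 1) / 2) / m)) * \<epsilon> powr (((real CARD('n) + 1) / 2) / m) = 1" if "\<epsilon> > 0" for \<epsilon>
    using that by (simp add: powr_minus)
  have "((\<lambda>\<epsilon>. \<epsilon> powr (- (((real CARD('n) + 1) / 2) / m)) * q_mean (ereal q) (ball x R) (u \<epsilon>)) \<longlongrightarrow> \<tau>) (at_right 0)"
  proof (rule order_tendstoI)
    fix b assume "b < \<tau>"
    define t where "t = (max b 0 + \<tau>) / 2"
    have t: "0 < t" "b < t" "t < \<tau>" using \<open>b < \<tau>\<close> \<tau> by (auto simp: t_def max_def)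
    have "t powr m * vol < \<tau> powr m * vol" using t m vol by (intro mult_strict_right_mono powr_less_mono2) auto
    hence "0 < boundary_mass m - t powr m * vol" using \<tau>m by simp
    from order_tendstoD(1)[OF mean_gap_limit[OF m t(1), folded vol_def] this]
    show "\<forall>\<^sub>F \<epsilon> in at_right 0. b < \<epsilon> powr (- (((real CARD('n) + 1) / 2) / m)) * q_mean (ereal q) (ball x R) (u \<epsilon>)"
      using eventually_at_right_less[of 0]
    proof eventually_elim
      case (elim \<epsilon>)
      hence "mean_gap (q - 1) (ball x R) (u \<epsilon>) (t * \<epsilon> powr (((real CARD('n) + 1) / 2) / m)) > 0"
        by (simp add: m_def zero_less_mult_iff)
      hence "t * \<epsilon> powr (((real CARD('n) + 1) / 2) / m) < q_mean (ereal q) (ball x R) (u \<epsilon>)"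
        by (intro q_mean_bounds(1)[OF q R u_ball_cont[OF elim(2)] u_ball_range[OF elim(2)]])
      hence "\<epsilon> powr (- (((real CARD('n) + 1) / 2) / m)) * (t * \<epsilon> powr (((real CARD('n) + 1) / 2) / m))
          < \<epsilon> powr (- (((real CARD('n) + 1) / 2) / m)) * q_mean (ereal q) (ball x R) (u \<epsilon>)"
        using elim by (intro mult_strict_left_mono) auto
      thus ?case using pw[OF elim(2)] t(2) by (simp add: mult.left_commute)
    qed
  next
    fix b assume "b > \<tau>"
    hence b: "b > 0" using \<tau> by simp
    have "\<tau> powr m * vol < b powr m * vol" using \<open>b > \<tau>\<close> \<tau> m vol by (intro mult_strict_right_mono powr_less_mono2) auto
    hence "boundary_mass m - b powr m * vol < 0" using \<tau>m by simp
    from order_tendstoD(2)[OF mean_gap_limit[OF m b, folded vol_def] this]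
    show "\<forall>\<^sub>F \<epsilon> in at_right 0. \<epsilon> powr (- (((real CARD('n) + 1) / 2) / m)) * q_mean (ereal q) (ball x R) (u \<epsilon>) < b"
      using eventually_at_right_less[of 0]
    proof eventually_elim
      case (elim \<epsilon>)
      hence "mean_gap (q - 1) (ball x R) (u \<epsilon>) (b * \<epsilon> powr (((real CARD('n) + 1) / 2) / m)) < 0"
        by (simp add: m_def mult_less_0_iff)
      hence "q_mean (ereal q) (ball x R) (u \<epsilon>) < b * \<epsilon> powr (((real CARD('n) + 1) / 2) / m)"
        by (intro q_mean_bounds(2)[OF q R u_ball_cont[OF elim(2)] u_ball_range[OF elim(2)]])
      hence "\<epsilon> powr (- (((real CARD('n) + 1) / 2) / m)) * q_mean (ereal q) (ball x R) (u \<epsilon>)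
          < \<epsilon> powr (- (((real CARD('n) + 1) / 2) / m)) * (b * \<epsilon> powr (((real CARD('n) + 1) / 2) / m))"
        using elim by (intro mult_strict_left_mono) auto
      thus ?case using pw[OF elim(2)] by (simp add: mult.left_commute)
    qed
  qed
  thus ?thesis by (simp add: \<tau>_def m_def vol_def)
qed

text \<open>The supremum equals \<open>1\<close> for each \<open>\<epsilon>\<close>, by continuity at the contact point; the infimum is at most the value at the centre.\<close>

lemma q_mean_infinity_limit:
  "((\<lambda>\<epsilon>. q_mean \<infinity> (ball x R) (u \<epsilon>)) \<longlongrightarrow> 1 / 2) (at_right 0)"
proof -
  have xb: "x \<in> ball x R" using R by simp
  obtain c2 \<epsilon>1 where ub: "c2 > 0" "\<epsilon>1 > 0"
    "\<And>\<epsilon> z. 0 < \<epsilon> \<Longrightarrow> \<epsilon> < \<epsilon>1 \<Longrightarrow> z \<in> ball x R \<Longrightarrow>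
       u \<epsilon> z \<le> 2 * exp (- (c2 * ((z - y0) \<bullet> \<nu>)) / \<epsilon>)"
    by (rule uniform_upper) auto
  have "(x - y0) \<bullet> \<nu> = R" using center norm_\<nu> by (simp add: norm_eq_1)
  hence a: "c2 * ((x - y0) \<bullet> \<nu>) > 0" using ub R by simp
  have "((\<lambda>\<epsilon>. (1 + 2 * exp (- (c2 * ((x - y0) \<bullet> \<nu>)) / \<epsilon>)) / 2) \<longlongrightarrow> (1 + 2 * 0) / 2) (at_right 0)"
    by (intro tendsto_intros exp_tendsto_0 a) auto
  hence lim: "((\<lambda>\<epsilon>. (1 + 2 * exp (- (c2 * ((x - y0) \<bullet> \<nu>)) / \<epsilon>)) / 2) \<longlongrightarrow> 1 / 2) (at_right 0)" by simp
  have ev: "\<forall>\<^sub>F \<epsilon>::real in at_right 0. \<epsilon> \<in> {0<..<\<epsilon>1}" by (rule eventually_at_right_real) (use ub in auto)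
  have *: "1 / 2 \<le> q_mean \<infinity> (ball x R) (u \<epsilon>) \<and>
      q_mean \<infinity> (ball x R) (u \<epsilon>) \<le> (1 + 2 * exp (- (c2 * ((x - y0) \<bullet> \<nu>)) / \<epsilon>)) / 2"
    if \<epsilon>: "0 < \<epsilon>" "\<epsilon> < \<epsilon>1" for \<epsilon>
  proof -
    let ?U = "u \<epsilon> ` ball x R"
    have bd: "bounded ?U" using u_ball_range[OF \<epsilon>(1)] by (auto simp: bounded_iff intro!: exI[of _ 1])
    have ne: "?U \<noteq> {}" using xb by blast
    have ba: "bdd_above ?U" "bdd_below ?U" using bd bounded_imp_bdd_above bounded_imp_bdd_below by auto
    have "Sup ?U \<le> 1" using ne u_ball_range[OF \<epsilon>(1)] by (intro cSup_least) auto
    moreover have "1 \<le> Sup ?U"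
    proof -
      have cl: "closure (ball x R) \<subseteq> closure \<Omega>" by (rule closure_mono[OF ball])
      have "u \<epsilon> ` closure (ball x R) \<subseteq> {..Sup ?U}"
        by (rule image_closure_subset[OF continuous_on_subset[OF u_cont[OF \<epsilon>(1)] cl]])
           (auto intro!: cSup_upper ba)
      moreover have "y0 \<in> closure (ball x R)" using contact by auto
      moreover have "u \<epsilon> y0 = 1" by (rule u_frontier[OF \<epsilon>(1) y0])
      ultimately show ?thesis by force
    qed
    ultimately have S: "Sup ?U = 1" by simp
    have "0 \<le> Inf ?U" using ne u_ball_range[OF \<epsilon>(1)] by (intro cInf_greatest) auto
    moreover have "Inf ?U \<le> u \<epsilon> x" using ba xb by (intro cInf_lower) auto
    moreover have "u \<epsilon> x \<le> 2 * exp (- (c2 * ((x - y0) \<bullet> \<nu>)) / \<epsilon>)" by (rule ub(3)[OF \<epsilon> xb])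
    ultimately show ?thesis unfolding q_mean_infinity[OF R u_ball_cont[OF \<epsilon>(1)] bd] S by simp
  qed
  show ?thesis
  proof (rule tendsto_sandwich[OF _ _ tendsto_const lim])
    show "\<forall>\<^sub>F \<epsilon> in at_right 0. 1 / 2 \<le> q_mean \<infinity> (ball x R) (u \<epsilon>)"
      using ev by eventually_elim (use * in auto)
    show "\<forall>\<^sub>F \<epsilon> in at_right 0. q_mean \<infinity> (ball x R) (u \<epsilon>) \<le> (1 + 2 * exp (- (c2 * ((x - y0) \<bullet> \<nu>)) / \<epsilon>)) / 2"
      using ev by eventually_elim (use * in auto)
  qed
qed

end

section \<open>The constant\<close>

lemma Gamma_half_duplication:
  fixes N :: nat
  shows "Gamma ((real N + 1) / 2) * Gamma (real N / 2 + 1) = 2 powr (- real N) * sqrt pi * fact N"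
proof -
  define D where "D = (real N + 1) / 2"
  have D: "D > 0" by (simp add: D_def)
  have np: "complex_of_real y \<notin> \<int>\<^sub>\<le>\<^sub>0" if "y > 0" for y
  proof
    assume "complex_of_real y \<in> \<int>\<^sub>\<le>\<^sub>0"
    hence "y \<in> \<int>\<^sub>\<le>\<^sub>0" by (simp add: of_real_in_nonpos_Ints_iff)
    thus False using that by (simp add: nonpos_Ints_nonpos not_le[symmetric])
  qed
  have h: "complex_of_real D + 1 / 2 = of_real (D + 1 / 2)" by simp
  have "Gamma (complex_of_real D) * Gamma (complex_of_real D + 1 / 2)
      = exp ((1 - 2 * complex_of_real D) * of_real (ln 2)) * of_real (sqrt pi) * Gamma (2 * complex_of_real D)"
    by (rule Gamma_legendre_duplication) (use np[of D] np[of "D + 1/2"] D in auto)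
  also have "exp ((1 - 2 * complex_of_real D) * of_real (ln 2)) = of_real (exp ((1 - 2 * D) * ln 2))"
    by (simp add: exp_of_real[symmetric])
  also have "Gamma (2 * complex_of_real D) = of_real (Gamma (2 * D))"
    by (simp add: Gamma_complex_of_real[symmetric])
  finally have "complex_of_real (Gamma D * Gamma (D + 1 / 2)) = of_real (exp ((1 - 2 * D) * ln 2) * sqrt pi * Gamma (2 * D))"
    unfolding h Gamma_complex_of_real by simp
  hence G: "Gamma D * Gamma (D + 1 / 2) = exp ((1 - 2 * D) * ln 2) * sqrt pi * Gamma (2 * D)"
    by (simp only: of_real_eq_iff)
  have e1: "2 * D = 1 + real N" and e2: "D + 1 / 2 = real N / 2 + 1" and e3: "1 - (1 + real N) = - real N"
    by (auto simp: D_def field_simps)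
  show ?thesis using G unfolding D_def[symmetric] e1 e2 e3 Gamma_fact by (simp add: powr_def)
qed

text \<open>With \<open>S\<close> the curvature product, both sides are products of powers of positive numbers; after taking logarithms the identity is linear, and the duplication formula relates
the Gamma value in the volume of the unit ball to the one on the right.\<close>

lemma limit_constant:
  fixes N :: nat and R m P S :: real
  assumes R: "R > 0" and m: "m > 0" and P: "P > 0" and S: "S > 0"
  defines "D \<equiv> (real N + 1) / 2"
  shows "R powr D * (1 / (m * sqrt P) * ((2 * pi * R / (m * sqrt P)) powr ((real N - 1) / 2) * S powr (- (1/2))))
        / (unit_ball_vol (real N) * R ^ N)
     = 2 powr (- D) * fact N / (m powr D * Gamma D) * (P powr D * S) powr (- (1/2))"
proof -
  define g1 g2 a where "g1 = Gamma D" and "g2 = Gamma (real N / 2 + 1)" and "a = m * sqrt P"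
  have G: "g1 > 0" "g2 > 0" by (auto simp: g1_def g2_def D_def intro!: Gamma_real_pos)
  have a: "a > 0" using m P by (simp add: a_def)
  have "g1 * g2 = 2 powr (- real N) * sqrt pi * fact N"
    unfolding g1_def g2_def D_def by (rule Gamma_half_duplication)
  hence "ln (g1 * g2) = ln (2 powr (- real N) * sqrt pi * fact N)" by simp
  hence "ln g1 + ln g2 = - real N * ln 2 + ln pi / 2 + ln (fact N)"
    using G by (simp add: ln_mult ln_powr ln_sqrt)
  hence dup: "ln g2 = - real N * ln 2 + ln pi / 2 + ln (fact N) - ln g1" by simp
  have lna: "ln a = ln m + ln P / 2" using m P by (simp add: a_def ln_mult ln_sqrt)
  have vol: "unit_ball_vol (real N) = pi powr (real N / 2) / g2" by (simp add: unit_ball_vol_def g2_def)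
  define L where "L = R powr D * (1 / a * ((2 * pi * R / a) powr ((real N - 1) / 2) * S powr (- (1/2))))
        / (pi powr (real N / 2) / g2 * R ^ N)"
  define M where "M = 2 powr (- D) * fact N / (m powr D * g1) * (P powr D * S) powr (- (1/2))"
  have LM: "L > 0" "M > 0" using R S a G m P by (auto simp: L_def M_def intro!: divide_pos_pos mult_pos_pos)
  have "ln L = D * ln R - ln a + (real N - 1) / 2 * (ln 2 + ln pi + ln R - ln a) - ln S / 2
      - (real N / 2 * ln pi - ln g2 + real N * ln R)"
    unfolding L_def using R S a G m P by (simp add: ln_mult ln_div ln_powr ln_realpow)
  also have "\<dots> = - D * ln 2 + ln (fact N) - (D * ln m + ln g1) - (D * ln P + ln S) / 2"
    unfolding dup lna D_def by (simp add: field_simps)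
  also have "\<dots> = ln M"
    unfolding M_def using m P S G by (simp add: ln_mult ln_div ln_powr field_simps)
  finally have "L = M" using LM by simp
  thus ?thesis unfolding L_def M_def vol a_def g1_def .
qed

context touching_ball_solutions
begin

lemma boundary_mass_eq:
  assumes m: "m > 0"
  shows "boundary_mass m = 1 / (m * sqrt P) * ((2 * pi * R / (m * sqrt P)) powr ((real CARD('n) - 1) / 2)
           * Pi_curv TYPE('n) R \<kappa> powr (- (1/2)))"
    and "Pi_curv TYPE('n) R \<kappa> > 0"
proof -
  have a: "m * sqrt P > 0" using m P_pos by simp
  have pos: "1 - R * \<kappa> j > 0" if "j \<in> {1..CARD('n) - 1}" for j
    using curv[OF that] R by (simp add: field_simps)
  show "Pi_curv TYPE('n) R \<kappa> > 0" unfolding Pi_curv_def using pos by (intro prod_pos) auto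
  define A where "A = 2 * pi * R / (m * sqrt P)"
  have A: "A > 0" using a R by (simp add: A_def)
  have "(\<Prod>j\<in>UNIV - {k}. sqrt (2 * pi / (m * sqrt P * (1 / R - \<kappa> (\<sigma> j)))))
     = (\<Prod>j\<in>{1..CARD('n) - 1}. sqrt (2 * pi / (m * sqrt P * (1 / R - \<kappa> j))))"
    by (rule prod.reindex_bij_betw[OF \<sigma>])
  also have "\<dots> = (\<Prod>j\<in>{1..CARD('n) - 1}. sqrt A * (1 - R * \<kappa> j) powr (- (1/2)))"
  proof (rule prod.cong[OF refl])
    fix j assume j: "j \<in> {1..CARD('n) - 1}"
    have eA: "2 * pi / (m * sqrt P * (1 / R - \<kappa> j)) = A / (1 - R * \<kappa> j)"
      using R a pos[OF j] by (simp add: A_def field_simps)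
    have ew: "(1 - R * \<kappa> j) powr (- (1/2)) = inverse (sqrt (1 - R * \<kappa> j))"
      using pos[OF j] by (simp only: powr_minus powr_half_sqrt less_imp_le)
    show "sqrt (2 * pi / (m * sqrt P * (1 / R - \<kappa> j))) = sqrt A * (1 - R * \<kappa> j) powr (- (1/2))"
      unfolding eA ew real_sqrt_divide by (simp only: divide_inverse)
  qed
  also have "\<dots> = sqrt A ^ (CARD('n) - 1) * (\<Prod>j\<in>{1..CARD('n) - 1}. (1 - R * \<kappa> j) powr (- (1/2)))"
    by (simp add: prod.distrib)
  also have "(\<Prod>j\<in>{1..CARD('n) - 1}. (1 - R * \<kappa> j) powr (- (1/2))) = Pi_curv TYPE('n) R \<kappa> powr (- (1/2))"
    unfolding Pi_curv_def by (rule prod_powr_distrib[symmetric])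
  also have "sqrt A ^ (CARD('n) - 1) = A powr ((real CARD('n) - 1) / 2)"
  proof -
    have n1: "real (CARD('n) - 1) = real CARD('n) - 1" using zero_less_card_finite[where 'a='n] by linarith
    have "sqrt A ^ (CARD('n) - 1) = sqrt A powr real (CARD('n) - 1)"
      using A by (intro powr_realpow[symmetric]) simp
    also have "\<dots> = (A powr (1/2)) powr real (CARD('n) - 1)" using A by (simp only: powr_half_sqrt less_imp_le)
    also have "\<dots> = A powr ((real CARD('n) - 1) / 2)" by (simp add: powr_powr n1)
    finally show ?thesis .
  qed
  finally show "boundary_mass m = 1 / (m * sqrt P) * ((2 * pi * R / (m * sqrt P)) powr ((real CARD('n) - 1) / 2)
           * Pi_curv TYPE('n) R \<kappa> powr (- (1/2)))"
    unfolding boundary_mass_def A_def by simp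
qed

lemma q_mean_scaled_limit:
  assumes q: "q > 1"
  shows "((\<lambda>\<epsilon>. (\<epsilon> / R) powr (- ((real CARD('n) + 1) / (2 * (q - 1)))) * q_mean (ereal q) (ball x R) (u \<epsilon>))
        \<longlongrightarrow>
          (2 powr (- ((real CARD('n) + 1) / 2)) * fact CARD('n)
             / ((q - 1) powr ((real CARD('n) + 1) / 2) * Gamma ((real CARD('n) + 1) / 2)))
            powr (1 / (q - 1))
        * (conj_exponent p powr ((real CARD('n) + 1) / 2) * Pi_curv TYPE('n) R \<kappa>)
            powr (- (1 / (2 * (q - 1))))) (at_right 0)"
proof -
  define m where "m = q - 1"
  define D where "D = (real CARD('n) + 1) / 2"
  define vol where "vol = measure lborel (ball x R)"
  define C where "C = 2 powr (- D) * fact CARD('n) / (m powr D * Gamma D)"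
  define S where "S = Pi_curv TYPE('n) R \<kappa>"
  have m: "m > 0" using q by (simp add: m_def)
  have D: "D > 0" by (simp add: D_def)
  have volpos: "vol > 0" using R by (simp add: vol_def)
  have vol: "vol = unit_ball_vol (real CARD('n)) * R ^ CARD('n)"
    unfolding vol_def using R by (subst content_ball) auto
  have S: "S > 0" unfolding S_def by (rule boundary_mass_eq(2)[OF m])
  have bm: "boundary_mass m > 0" by (rule paraboloid_mass(2)[OF m])
  have C: "C > 0" unfolding C_def using m D by (intro divide_pos_pos mult_pos_pos Gamma_real_pos) auto
  have key: "R powr D * boundary_mass m / vol = C * (P powr D * S) powr (- (1/2))"
    unfolding vol boundary_mass_eq(1)[OF m] C_def S_def D_def
    by (rule limit_constant[OF R m P_pos boundary_mass_eq(2)[OF m]])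
  have "R powr (D / m) * (boundary_mass m / vol) powr (1 / m) = (R powr D * boundary_mass m / vol) powr (1 / m)"
    using R bm volpos by (simp add: powr_mult powr_divide powr_powr)
  also have "\<dots> = C powr (1 / m) * (P powr D * S) powr (- (1 / (2 * m)))"
    unfolding key using C P_pos S by (simp add: powr_mult powr_powr)
  finally have lim_eq: "R powr (D / m) * (boundary_mass m / vol) powr (1 / m)
      = C powr (1 / m) * (P powr D * S) powr (- (1 / (2 * m)))" .
  have "((\<lambda>\<epsilon>. R powr (D / m) * (\<epsilon> powr (- (D / m)) * q_mean (ereal q) (ball x R) (u \<epsilon>)))
    \<longlongrightarrow> R powr (D / m) * (boundary_mass m / vol) powr (1 / m)) (at_right 0)"
    using q_mean_limit[OF q] unfolding D_def m_def vol_def by (intro tendsto_mult tendsto_const)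
  moreover have "\<forall>\<^sub>F \<epsilon> in at_right 0. R powr (D / m) * (\<epsilon> powr (- (D / m)) * q_mean (ereal q) (ball x R) (u \<epsilon>))
     = (\<epsilon> / R) powr (- ((real CARD('n) + 1) / (2 * (q - 1)))) * q_mean (ereal q) (ball x R) (u \<epsilon>)"
    using eventually_at_right_less[of 0]
  proof eventually_elim
    case (elim \<epsilon>)
    have "(real CARD('n) + 1) / (2 * (q - 1)) = D / m" by (simp add: D_def m_def)
    moreover have "(\<epsilon> / R) powr (- (D / m)) = R powr (D / m) * \<epsilon> powr (- (D / m))"
      using elim R by (simp add: powr_divide powr_minus field_simps)
    ultimately show ?case by simp
  qed
  ultimately have "((\<lambda>\<epsilon>. (\<epsilon> / R) powr (- ((real CARD('n) + 1) / (2 * (q - 1)))) * q_mean (ereal q) (ball x R) (u \<epsilon>))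
      \<longlongrightarrow> R powr (D / m) * (boundary_mass m / vol) powr (1 / m)) (at_right 0)"
    by (rule Lim_transform_eventually)
  from this[unfolded lim_eq] show ?thesis unfolding C_def S_def D_def m_def .
qed

end

theorem theorem4p11:
  fixes \<Omega> :: "(real^'n) set" and x y\<^sub>x :: "real^'n" and R :: real and p :: ereal
    and \<kappa> :: "nat \<Rightarrow> real" and u :: "real \<Rightarrow> real^'n \<Rightarrow> real"
  assumes "CARD('n) \<ge> 2"
    and "C2_domain \<Omega>"
    and "1 < p"
    and "x \<in> \<Omega>" and "R > 0"
    and "ball x R \<subseteq> \<Omega>"
    and "y\<^sub>x \<in> frontier \<Omega>"
    and "closure (ball x R) \<inter> (UNIV - \<Omega>) = {y\<^sub>x}"
    and "principal_curvatures \<Omega> y\<^sub>x \<kappa>"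
    and "\<forall>j\<in>{1..CARD('n) - 1}. \<kappa> j < 1 / R"
    and "\<forall>\<epsilon>>0. bounded_visc_solution_bdry1 p \<epsilon> \<Omega> (u \<epsilon>)"
  shows "(\<forall>q::real. 1 < q \<longrightarrow>
      ((\<lambda>\<epsilon>. (\<epsilon> / R) powr (- ((real CARD('n) + 1) / (2 * (q - 1))))
              * q_mean (ereal q) (ball x R) (u \<epsilon>))
        \<longlongrightarrow>
          (2 powr (- ((real CARD('n) + 1) / 2)) * fact CARD('n)
             / ((q - 1) powr ((real CARD('n) + 1) / 2) * Gamma ((real CARD('n) + 1) / 2)))
            powr (1 / (q - 1))
        * (conj_exponent p powr ((real CARD('n) + 1) / 2) * Pi_curv TYPE('n) R \<kappa>)
            powr (- (1 / (2 * (q - 1)))))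
      (at_right 0))
    \<and> ((\<lambda>\<epsilon>. q_mean \<infinity> (ball x R) (u \<epsilon>)) \<longlongrightarrow> 1 / 2) (at_right 0)"
proof -
  have op: "open \<Omega>" using assms(2) by (simp add: C2_domain_def)
  obtain \<nu> f Df D2f e where g: "C2_graph_at \<Omega> y\<^sub>x \<nu> f Df D2f" "Df 0 = 0"
    and ortho: "\<forall>i\<in>{1..CARD('n) - 1}. \<forall>j\<in>{1..CARD('n) - 1}. e i \<bullet> e j = (if i = j then 1 else 0)"
    and eig: "\<forall>j\<in>{1..CARD('n) - 1}. e j \<bullet> \<nu> = 0 \<and> D2f 0 *v e j = \<kappa> j *\<^sub>R e j"
    using assms(9) unfolding principal_curvatures_def by blast
  obtain r0 where r0: "r0 > 0" "C2_on (ball 0 r0) f Df D2f"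
      "\<forall>z\<in>ball y\<^sub>x r0. z \<in> \<Omega> \<longleftrightarrow> f (z - y\<^sub>x) < (z - y\<^sub>x) \<bullet> \<nu>"
    and \<nu>: "norm \<nu> = 1" "\<forall>z t. f (z + t *\<^sub>R \<nu>) = f z"
    using g(1) unfolding C2_graph_at_def by blast
  fix k :: 'n
  have "card (UNIV - {k}) = card {1..CARD('n) - 1}" by simp
  then obtain \<sigma> where \<sigma>: "bij_betw \<sigma> (UNIV - {k}) {1..CARD('n) - 1}"
    using finite_same_card_bij[of "UNIV - {k}" "{1..CARD('n) - 1}"] by auto
  interpret touching_ball_solutions \<Omega> x y\<^sub>x R p \<kappa> \<nu> f Df D2f e r0 k \<sigma> u
    by unfold_locales
       (use assms op g r0 \<nu> \<sigma> ortho eig in \<open>auto simp del: closure_ball\<close>)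
  show ?thesis using q_mean_scaled_limit q_mean_infinity_limit by blast
qed

end
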